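(* Let $A=(\mathbf a_0,\ldots,\mathbf a_n)$ be an integer $d\times(n+1)$ matrix with $d\le n+1$ and $\mathbb ZA=\mathbb Z^d$, and let $\beta\in\mathbb C^d$. Assume that $S_A$ is standard graded (i.e. $A$ is homogeneous: the row span of $A$ contains $(1,\ldots,1)$). For $p\in\mathbb C^{n+1}$ generic (i.e. in a suitable nonempty Zariski open subset), the $b$-function $b_p(s)$ for restriction of $M_A(\beta)$ to the point $x+p=0$ divides $s(s-1)\cdots(s-k+1)$, where $k-1$ denotes the highest degree (with $\deg\partial_j=1$ for all $j$) in which the quotient $S_A/S_A\cdot(A\cdot\mathcal E\cdot\partial)$ is nonzero. If, in addition, $S_A$ is normal, then one may take $k=d$, i.e. $b_p(s)$ divides $s(s-1)\cdots(s-d+1)$ for generic $p$.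
   Context: $R_A=\mathbb C[\partial_0,\ldots,\partial_n]$; $D_A$ is the Weyl algebra in $x_0,\ldots,x_n$ with $\partial_j=\partial/\partial x_j$. The toric ideal $I_A\subseteq R_A$ is generated by all $\partial^{\mathbf v_+}-\partial^{\mathbf v_-}$ with $\mathbf v\in\mathbb Z^{n+1}$, $A\mathbf v=0$ ($(\mathbf v_\pm)_j=\max(0,\pm v_j)$); $S_A=R_A/I_A\cong\mathbb C[\mathbb NA]$. $H_A(\beta)\subseteq D_A$ is the left ideal generated by $I_A$ and $E_i-\beta_i$, $E_i=\sum_{j=0}^na_{i,j}x_j\partial_j$, $1\le i\le d$; $M_A(\beta)=D_A/H_A(\beta)$. For $p=(p_0,\ldots,p_n)\in\mathbb C^{n+1}$, $\mathcal E$ is the diagonal $(n+1)\times(n+1)$ matrix with diagonal entries $p_0,\ldots,p_n$, $\partial$ is the column vector $(\partial_0,\ldots,\partial_n)^T$, and $A\cdot\mathcal E\cdot\partial$ denotes the $d$ linear forms $\sum_ja_{i,j}p_j\partial_j$, $1\le i\le d$. Let $\theta_p=\sum_{j=0}^n(x_j+p_j)\partial_j$ and let $V^k_pD_A$ be the $\mathbb C$-span of all $(x+p)^{\mathbf u}\partial^{\mathbf v}$ with $|\mathbf u|-|\mathbf v|\ge k$. The $b$-function for restriction of $D_A/I$ to the point $x+p=0$ is the monic polynomial $b_p(s)$ of minimal degree such that $b_p(\theta_p)\in I+V^1_pD_A$. *)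

theory Defs
  imports
    "HOL-Analysis.Cartesian_Space"
    "HOL-Computational_Algebra.Polynomial"
    "HOL-Library.Poly_Mapping"
    "HOL-Algebra.QuotRing"
begin

section \<open>Polynomials in finitely many variables\<close>

text \<open>
  The index set \<open>{0,\<dots>,n}\<close> is a finite type \<open>'n\<close>. The type \<open>'n mpoly\<close> serves both as
  \<open>\<complex>[x\<^sub>0,\<dots>,x\<^sub>n]\<close>, on which differential operators act, and as \<open>R\<^sub>A = \<complex>[\<partial>\<^sub>0,\<dots>,\<partial>\<^sub>n]\<close>.
\<close>

type_synonym 'n mpoly = "('n \<Rightarrow>\<^sub>0 nat) \<Rightarrow>\<^sub>0 complex"

definition Const :: "complex \<Rightarrow> 'n mpoly" where
  "Const c = Poly_Mapping.single 0 c"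

definition Var :: "'n \<Rightarrow> 'n mpoly" where
  "Var j = Poly_Mapping.single (Poly_Mapping.single j 1) 1"

definition peval :: "'n::finite mpoly \<Rightarrow> complex ^ 'n \<Rightarrow> complex" where
  "peval f p = (\<Sum>u\<in>Poly_Mapping.keys f.
     Poly_Mapping.lookup f u * (\<Prod>j\<in>UNIV. (p $ j) ^ Poly_Mapping.lookup u j))"

definition homogeneous_poly :: "nat \<Rightarrow> 'n::finite mpoly \<Rightarrow> bool" where
  "homogeneous_poly m f \<longleftrightarrow>
     (\<forall>u\<in>Poly_Mapping.keys f. (\<Sum>j\<in>UNIV. Poly_Mapping.lookup u j) = m)"

definition zariski_closed :: "(complex ^ 'n::finite) set \<Rightarrow> bool" where
  "zariski_closed Z \<longleftrightarrow> (\<exists>F. Z = {p. \<forall>f\<in>F. peval f p = 0})"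

definition zariski_open :: "(complex ^ 'n::finite) set \<Rightarrow> bool" where
  "zariski_open U \<longleftrightarrow> zariski_closed (- U)"


section \<open>Integral closedness in the field of fractions\<close>

definition fraction_rel :: "('a, 'b) ring_scheme \<Rightarrow> (('a \<times> 'a) \<times> ('a \<times> 'a)) set" where
  "fraction_rel R = {((a, b), (c, d)). a \<in> carrier R \<and> c \<in> carrier R \<and>
     b \<in> carrier R - {\<zero>\<^bsub>R\<^esub>} \<and> d \<in> carrier R - {\<zero>\<^bsub>R\<^esub>} \<and> a \<otimes>\<^bsub>R\<^esub> d = c \<otimes>\<^bsub>R\<^esub> b}"

definition fraction :: "('a, 'b) ring_scheme \<Rightarrow> 'a \<Rightarrow> 'a \<Rightarrow> ('a \<times> 'a) set" where
  "fraction R a b = fraction_rel R `` {(a, b)}"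

definition fraction_field :: "('a, 'b) ring_scheme \<Rightarrow> ('a \<times> 'a) set ring" where
  "fraction_field R =
     \<lparr>carrier = {fraction R a b | a b. a \<in> carrier R \<and> b \<in> carrier R - {\<zero>\<^bsub>R\<^esub>}},
      mult = (\<lambda>x y. \<Union>(a, b)\<in>x. \<Union>(c, d)\<in>y. fraction R (a \<otimes>\<^bsub>R\<^esub> c) (b \<otimes>\<^bsub>R\<^esub> d)),
      one = fraction R \<one>\<^bsub>R\<^esub> \<one>\<^bsub>R\<^esub>,
      zero = fraction R \<zero>\<^bsub>R\<^esub> \<one>\<^bsub>R\<^esub>,
      add = (\<lambda>x y. \<Union>(a, b)\<in>x. \<Union>(c, d)\<in>y.
        fraction R (a \<otimes>\<^bsub>R\<^esub> d \<oplus>\<^bsub>R\<^esub> c \<otimes>\<^bsub>R\<^esub> b) (b \<otimes>\<^bsub>R\<^esub> d))\<rparr>"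

definition integral_over :: "('a, 'b) ring_scheme \<Rightarrow> ('a \<times> 'a) set \<Rightarrow> bool" where
  "integral_over R x \<longleftrightarrow> (\<exists>m c. c \<in> {..<m} \<rightarrow> carrier R \<and>
     (let K = fraction_field R in
        x [^]\<^bsub>K\<^esub> (m::nat) \<oplus>\<^bsub>K\<^esub> (\<Oplus>\<^bsub>K\<^esub>i\<in>{..<m}. fraction R (c i) \<one>\<^bsub>R\<^esub> \<otimes>\<^bsub>K\<^esub> x [^]\<^bsub>K\<^esub> i) = \<zero>\<^bsub>K\<^esub>))"

definition normal_domain :: "('a, 'b) ring_scheme \<Rightarrow> bool" where
  "normal_domain R \<longleftrightarrow> domain R \<and>
     (\<forall>x\<in>carrier (fraction_field R). integral_over R x \<longrightarrow> (\<exists>r\<in>carrier R. x = fraction R r \<one>\<^bsub>R\<^esub>))"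

lemma UN_pair_const:
  assumes "z \<in> S" "\<And>a b. (a, b) \<in> S \<Longrightarrow> F a b = X"
  shows "(\<Union>(a, b)\<in>S. F a b) = X"
proof -
  have "(\<Union>(a, b)\<in>S. F a b) = (\<Union>x\<in>S. X)"
    by (rule SUP_cong) (auto simp: assms(2))
  also have "\<dots> = X" using assms(1) by blast
  finally show ?thesis .
qed

context domain
begin

lemma fraction_rel_equiv: "equiv (carrier R \<times> (carrier R - {\<zero>})) (fraction_rel R)"
proof (rule equivI)
  show "fraction_rel R \<subseteq> (carrier R \<times> (carrier R - {\<zero>})) \<times> (carrier R \<times> (carrier R - {\<zero>}))"
    by (auto simp: fraction_rel_def)
  show "refl_on (carrier R \<times> (carrier R - {\<zero>})) (fraction_rel R)"
    by (auto simp: refl_on_def fraction_rel_def)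
  show "sym (fraction_rel R)"
    by (auto simp: sym_def fraction_rel_def)
  show "trans (fraction_rel R)"
  proof (rule transI, clarify)
    fix a b c d e f
    assume 1: "((a, b), (c, d)) \<in> fraction_rel R" and 2: "((c, d), (e, f)) \<in> fraction_rel R"
    have in_R: "a \<in> carrier R" "b \<in> carrier R" "c \<in> carrier R" "d \<in> carrier R"
      "e \<in> carrier R" "f \<in> carrier R" "d \<noteq> \<zero>"
      and eq: "a \<otimes> d = c \<otimes> b" "c \<otimes> f = e \<otimes> d"
      using 1 2 by (auto simp: fraction_rel_def)
    have "d \<otimes> (a \<otimes> f) = (a \<otimes> d) \<otimes> f" using in_R by (simp add: m_ac)
    also have "\<dots> = (c \<otimes> f) \<otimes> b" unfolding eq(1) using in_R by (simp add: m_ac)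
    also have "\<dots> = d \<otimes> (e \<otimes> b)" unfolding eq(2) using in_R by (simp add: m_ac)
    finally have "a \<otimes> f = e \<otimes> b" using in_R m_lcancel by simp
    then show "((a, b), (e, f)) \<in> fraction_rel R"
      using 1 2 by (auto simp: fraction_rel_def)
  qed
qed

lemma fraction_mult:
  assumes "a \<in> carrier R" "b \<in> carrier R - {\<zero>}" "c \<in> carrier R" "d \<in> carrier R - {\<zero>}"
  shows "fraction R a b \<otimes>\<^bsub>fraction_field R\<^esub> fraction R c d = fraction R (a \<otimes> c) (b \<otimes> d)"
proof -
  have eq: "fraction R (a' \<otimes> c') (b' \<otimes> d') = fraction R (a \<otimes> c) (b \<otimes> d)"
    if "(a', b') \<in> fraction R a b" "(c', d') \<in> fraction R c d" for a' b' c' d'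
  proof -
    have in_R: "a' \<in> carrier R" "b' \<in> carrier R" "b' \<noteq> \<zero>" "c' \<in> carrier R" "d' \<in> carrier R" "d' \<noteq> \<zero>"
      and e: "a \<otimes> b' = a' \<otimes> b" "c \<otimes> d' = c' \<otimes> d"
      using that by (auto simp: fraction_def fraction_rel_def)
    have "(a \<otimes> c) \<otimes> (b' \<otimes> d') = (a \<otimes> b') \<otimes> (c \<otimes> d')" using in_R assms by (simp add: m_ac)
    also have "\<dots> = (a' \<otimes> c') \<otimes> (b \<otimes> d)" unfolding e using in_R assms by (simp add: m_ac)
    finally have "((a \<otimes> c, b \<otimes> d), (a' \<otimes> c', b' \<otimes> d')) \<in> fraction_rel R"
      using in_R assms by (simp add: fraction_rel_def integral_iff)
    then show ?thesis
      unfolding fraction_def using equiv_class_eq[OF fraction_rel_equiv] by metis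
  qed
  have ne: "(a, b) \<in> fraction R a b" "(c, d) \<in> fraction R c d"
    using assms by (auto simp: fraction_def fraction_rel_def)
  show ?thesis
    unfolding fraction_field_def monoid.simps ring.simps
    by (rule UN_pair_const[OF ne(1)], rule UN_pair_const[OF ne(2)], rule eq)
qed

lemma fraction_add:
  assumes "a \<in> carrier R" "b \<in> carrier R - {\<zero>}" "c \<in> carrier R" "d \<in> carrier R - {\<zero>}"
  shows "fraction R a b \<oplus>\<^bsub>fraction_field R\<^esub> fraction R c d
    = fraction R (a \<otimes> d \<oplus> c \<otimes> b) (b \<otimes> d)"
proof -
  have eq: "fraction R (a' \<otimes> d' \<oplus> c' \<otimes> b') (b' \<otimes> d') = fraction R (a \<otimes> d \<oplus> c \<otimes> b) (b \<otimes> d)"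
    if "(a', b') \<in> fraction R a b" "(c', d') \<in> fraction R c d" for a' b' c' d'
  proof -
    have in_R: "a' \<in> carrier R" "b' \<in> carrier R" "b' \<noteq> \<zero>" "c' \<in> carrier R" "d' \<in> carrier R" "d' \<noteq> \<zero>"
      and e: "a \<otimes> b' = a' \<otimes> b" "c \<otimes> d' = c' \<otimes> d"
      using that by (auto simp: fraction_def fraction_rel_def)
    have "(a \<otimes> d \<oplus> c \<otimes> b) \<otimes> (b' \<otimes> d') = (a \<otimes> b') \<otimes> (d \<otimes> d') \<oplus> (c \<otimes> d') \<otimes> (b \<otimes> b')"
      using in_R assms by (simp add: l_distr r_distr m_ac)
    also have "\<dots> = (a' \<otimes> d' \<oplus> c' \<otimes> b') \<otimes> (b \<otimes> d)"
      unfolding e using in_R assms by (simp add: l_distr r_distr m_ac)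
    finally have "((a \<otimes> d \<oplus> c \<otimes> b, b \<otimes> d), (a' \<otimes> d' \<oplus> c' \<otimes> b', b' \<otimes> d')) \<in> fraction_rel R"
      using in_R assms by (simp add: fraction_rel_def integral_iff)
    then show ?thesis
      unfolding fraction_def using equiv_class_eq[OF fraction_rel_equiv] by metis
  qed
  have ne: "(a, b) \<in> fraction R a b" "(c, d) \<in> fraction R c d"
    using assms by (auto simp: fraction_def fraction_rel_def)
  show ?thesis
    unfolding fraction_field_def monoid.simps ring.simps
    by (rule UN_pair_const[OF ne(1)], rule UN_pair_const[OF ne(2)], rule eq)
qed

end


section \<open>Toric rings\<close>

definition R_A :: "'n mpoly ring" where
  "R_A = \<lparr>carrier = UNIV, mult = (*), one = 1, zero = 0, add = (+)\<rparr>"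

text \<open>\<open>nat (v $ j)\<close> and \<open>nat (- v $ j)\<close> are the \<open>j\<close>-th entries of \<open>v\<^sub>+\<close> and \<open>v\<^sub>-\<close>.\<close>

definition I_A :: "int ^ 'n ^ 'd \<Rightarrow> 'n::finite mpoly set" where
  "I_A A = Idl\<^bsub>R_A\<^esub> {(\<Prod>j\<in>UNIV. Var j ^ nat (v $ j)) - (\<Prod>j\<in>UNIV. Var j ^ nat (- (v $ j))) | v. A *v v = 0}"

definition S_A :: "int ^ 'n ^ 'd \<Rightarrow> 'n::finite mpoly set ring" where
  "S_A A = R_A Quot I_A A"

text \<open>The entry with index \<open>i\<close> of \<open>A \<cdot> \<E> \<cdot> \<partial>\<close>.\<close>

definition AE_form :: "int ^ 'n ^ 'd \<Rightarrow> complex ^ 'n \<Rightarrow> 'd \<Rightarrow> 'n::finite mpoly" where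
  "AE_form A p i = (\<Sum>j\<in>UNIV. Const (of_int (A $ i $ j) * p $ j) * Var j)"

text \<open>
  The degrees in which \<open>S\<^sub>A / S\<^sub>A \<cdot> (A \<cdot> \<E> \<cdot> \<partial>)\<close> is nonzero: its part of degree \<open>m\<close> consists of
  the images of the homogeneous polynomials of degree \<open>m\<close>.
\<close>

definition nonzero_degrees :: "int ^ 'n ^ 'd \<Rightarrow> complex ^ 'n \<Rightarrow> nat set" where
  "nonzero_degrees A p = {m. \<exists>f :: 'n::finite mpoly. homogeneous_poly m f \<and>
     I_A A +>\<^bsub>R_A\<^esub> f \<notin> Idl\<^bsub>S_A A\<^esub> (range (\<lambda>i. I_A A +>\<^bsub>R_A\<^esub> AE_form A p i))}"


section \<open>The Weyl algebra and A-hypergeometric ideals\<close>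

text \<open>
  The Weyl algebra is realised as the algebra of polynomial differential operators on
  \<open>\<complex>[x\<^sub>0,\<dots>,x\<^sub>n]\<close> (a faithful representation in characteristic 0); its multiplication is
  composition of functions.
\<close>

type_synonym 'n oper = "'n mpoly \<Rightarrow> 'n mpoly"

definition pd :: "'n \<Rightarrow> 'n oper" where
  "pd j f = (\<Sum>u\<in>Poly_Mapping.keys f. Poly_Mapping.single (u - Poly_Mapping.single j 1)
     (of_nat (Poly_Mapping.lookup u j) * Poly_Mapping.lookup f u))"

inductive_set D_A :: "'n oper set" where
  const: "(\<lambda>f. Const c * f) \<in> D_A"
| var: "(\<lambda>f. Var j * f) \<in> D_A"
| pd: "pd j \<in> D_A"
| add: "P \<in> D_A \<Longrightarrow> Q \<in> D_A \<Longrightarrow> (\<lambda>f. P f + Q f) \<in> D_A"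
| mult: "P \<in> D_A \<Longrightarrow> Q \<in> D_A \<Longrightarrow> P \<circ> Q \<in> D_A"

definition left_ideal :: "'n oper set \<Rightarrow> bool" where
  "left_ideal I \<longleftrightarrow> I \<subseteq> D_A \<and> (\<lambda>_. 0) \<in> I \<and>
     (\<forall>P\<in>I. \<forall>Q\<in>I. (\<lambda>f. P f + Q f) \<in> I) \<and> (\<forall>P\<in>D_A. \<forall>Q\<in>I. P \<circ> Q \<in> I)"

definition left_ideal_gen :: "'n oper set \<Rightarrow> 'n oper set" where
  "left_ideal_gen S = \<Inter>{I. left_ideal I \<and> S \<subseteq> I}"

text \<open>
  \<open>\<partial>\<^sup>v\<close>, the product of the \<open>\<partial>\<^sub>j\<^bsup>v j\<^esup>\<close> over all \<open>j\<close>. The order of the factors is irrelevant by the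
  lemma \<open>comp_fun_commute_pd\<close> below, which is what makes the fold well defined.
\<close>

definition dpow :: "('n::finite \<Rightarrow> nat) \<Rightarrow> 'n oper" where
  "dpow v = Finite_Set.fold (\<lambda>j P. (pd j ^^ v j) \<circ> P) id UNIV"

text \<open>The embedding of \<open>R\<^sub>A\<close> into the Weyl algebra.\<close>

definition dop :: "'n::finite mpoly \<Rightarrow> 'n oper" where
  "dop g f = (\<Sum>v\<in>Poly_Mapping.keys g. Const (Poly_Mapping.lookup g v) * dpow (Poly_Mapping.lookup v) f)"

definition euler_op :: "int ^ 'n ^ 'd \<Rightarrow> 'd \<Rightarrow> 'n::finite oper" where
  "euler_op A i f = (\<Sum>j\<in>UNIV. of_int (A $ i $ j) * Var j * pd j f)"

definition H_A :: "int ^ 'n ^ 'd \<Rightarrow> complex ^ 'd \<Rightarrow> 'n::finite oper set" where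
  "H_A A \<beta> = left_ideal_gen (dop ` I_A A \<union> range (\<lambda>i f. euler_op A i f - Const (\<beta> $ i) * f))"


section \<open>The b-function for restriction to a point\<close>

definition theta :: "complex ^ 'n \<Rightarrow> 'n::finite oper" where
  "theta p f = (\<Sum>j\<in>UNIV. (Var j + Const (p $ j)) * pd j f)"

definition xpow :: "complex ^ 'n \<Rightarrow> ('n \<Rightarrow> nat) \<Rightarrow> 'n::finite mpoly" where
  "xpow p u = (\<Prod>j\<in>UNIV. (Var j + Const (p $ j)) ^ u j)"

definition V_filt :: "int \<Rightarrow> complex ^ 'n \<Rightarrow> 'n::finite oper set" where
  "V_filt k p = {(\<lambda>f. \<Sum>(u, v)\<in>T. Const (c u v) * (xpow p u * dpow v f)) | T c. finite T \<and>
     T \<subseteq> {(u, v). int (\<Sum>j\<in>UNIV. u j) - int (\<Sum>j\<in>UNIV. v j) \<ge> k}}"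

definition poly_oper :: "complex poly \<Rightarrow> 'n oper \<Rightarrow> 'n oper" where
  "poly_oper b P f = (\<Sum>i\<le>Polynomial.degree b. Const (Polynomial.coeff b i) * (P ^^ i) f)"

definition b_condition :: "'n::finite oper set \<Rightarrow> complex ^ 'n \<Rightarrow> complex poly \<Rightarrow> bool" where
  "b_condition I p b \<longleftrightarrow>
     (\<exists>P\<in>I. \<exists>Q\<in>V_filt 1 p. poly_oper b (theta p) = (\<lambda>f. P f + Q f))"

definition is_b_function :: "'n::finite oper set \<Rightarrow> complex ^ 'n \<Rightarrow> complex poly \<Rightarrow> bool" where
  "is_b_function I p b \<longleftrightarrow> lead_coeff b = 1 \<and> b_condition I p b \<and>
     (\<forall>c. lead_coeff c = 1 \<longrightarrow> b_condition I p c \<longrightarrow> Polynomial.degree b \<le> Polynomial.degree c)"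

definition b_function :: "'n::finite oper set \<Rightarrow> complex ^ 'n \<Rightarrow> complex poly" where
  "b_function I p = (THE b. is_b_function I p b)"


section \<open>Commutation of partial derivatives\<close>

lemma lookup_pd:
  "Poly_Mapping.lookup (pd j f) u =
     of_nat (Suc (Poly_Mapping.lookup u j)) * Poly_Mapping.lookup f (u + Poly_Mapping.single j 1)"
proof -
  let ?e = "Poly_Mapping.single j (1::nat)"
  have shift: "u - ?e + ?e = u" if "Poly_Mapping.lookup u j \<noteq> 0" for u :: "'a \<Rightarrow>\<^sub>0 nat"
    using that by (intro poly_mapping_eqI) (auto simp: lookup_add lookup_minus lookup_single when_def)
  have "Poly_Mapping.lookup (pd j f) u = (\<Sum>w\<in>Poly_Mapping.keys f.
      (of_nat (Poly_Mapping.lookup w j) * Poly_Mapping.lookup f w when w - ?e = u))"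
    by (simp add: pd_def lookup_sum lookup_single)
  also have "\<dots> = (\<Sum>w\<in>Poly_Mapping.keys f.
      if w = u + ?e then of_nat (Poly_Mapping.lookup w j) * Poly_Mapping.lookup f w else 0)"
  proof (rule sum.cong)
    fix w
    show "(of_nat (Poly_Mapping.lookup w j) * Poly_Mapping.lookup f w when w - ?e = u) =
      (if w = u + ?e then of_nat (Poly_Mapping.lookup w j) * Poly_Mapping.lookup f w else 0)"
      using shift[of w] by (cases "Poly_Mapping.lookup w j = 0") (auto simp: when_def)
  qed simp
  also have "\<dots> = of_nat (Suc (Poly_Mapping.lookup u j)) * Poly_Mapping.lookup f (u + ?e)"
    by (auto simp: lookup_add in_keys_iff)
  finally show ?thesis .
qed

lemma pd_commute: "pd i \<circ> pd j = pd j \<circ> pd i"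
proof (cases "i = j")
  case False
  show ?thesis
  proof (intro ext poly_mapping_eqI)
    fix f u
    show "Poly_Mapping.lookup ((pd i \<circ> pd j) f) u = Poly_Mapping.lookup ((pd j \<circ> pd i) f) u"
      using False
      by (simp add: lookup_pd lookup_add lookup_single when_def ac_simps del: of_nat_Suc)
  qed
qed simp

lemma comp_fun_commute_pd: "comp_fun_commute (\<lambda>j P. (pd j ^^ v j) \<circ> P)"
proof
  have 1: "(pd i ^^ m) \<circ> pd j = pd j \<circ> (pd i ^^ m)" for i j :: 'a and m
  proof (induction m)
    case (Suc m)
    have "pd i ^^ Suc m \<circ> pd j = pd i \<circ> (pd i ^^ m \<circ> pd j)" by (simp add: comp_assoc)
    also have "\<dots> = (pd i \<circ> pd j) \<circ> pd i ^^ m" by (simp only: Suc.IH comp_assoc)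
    also have "\<dots> = pd j \<circ> pd i ^^ Suc m" by (simp only: pd_commute[of i j] funpow.simps comp_assoc)
    finally show ?case .
  qed simp
  have 2: "(pd i ^^ m) \<circ> (pd j ^^ k) = (pd j ^^ k) \<circ> (pd i ^^ m)" for i j :: 'a and m k
  proof (induction k)
    case (Suc k)
    have "pd i ^^ m \<circ> pd j ^^ Suc k = (pd i ^^ m \<circ> pd j) \<circ> pd j ^^ k"
      by (simp only: funpow.simps comp_assoc)
    also have "\<dots> = pd j \<circ> (pd i ^^ m \<circ> pd j ^^ k)" by (simp only: 1 comp_assoc)
    also have "\<dots> = pd j ^^ Suc k \<circ> pd i ^^ m" by (simp only: Suc.IH funpow.simps comp_assoc)
    finally show ?case .
  qed simp
  show "(\<lambda>P. (pd j ^^ v j) \<circ> P) \<circ> (\<lambda>P. (pd i ^^ v i) \<circ> P) =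
    (\<lambda>P. (pd i ^^ v i) \<circ> P) \<circ> (\<lambda>P. (pd j ^^ v j) \<circ> P)" for i j
    by (rule ext) (simp only: comp_apply, simp only: comp_assoc[symmetric], subst 2, rule refl)
qed

end

theory Submission
  imports Defs "HOL-Analysis.Analysis" "Jordan_Normal_Form.Determinant"
begin

text \<open>
  Put \<open>J = I\<^sub>A + R\<^sub>A \<cdot> (A \<cdot> \<E> \<cdot> \<partial>)\<close>. Modulo \<open>H\<^sub>A(\<beta>)\<close> the linear forms \<open>A \<cdot> \<E> \<cdot> \<partial>\<close> lie in \<open>V\<^sup>0\<close>, so if \<open>J\<close>
  contains all monomials of degree \<open>k\<close>, then \<open>\<theta>(\<theta> - 1)\<cdots>(\<theta> - k + 1)\<close>, a combination of operators
  \<open>(x + p)\<^sup>u \<partial>\<^sup>v\<close> with \<open>|u| = |v| = k\<close>, lies in \<open>H\<^sub>A(\<beta>) + V\<^sup>1\<close>. It remains to find one \<open>p\<close> for which \<open>J\<close>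
  contains all monomials of some degree, and of degree \<open>d\<close> in the normal case: this is the
  nonvanishing of a determinant, hence an open condition. Take \<open>p\<^sub>j = s powr \<omega> j\<close> with \<open>\<omega>\<close> generic and
  let \<open>s \<rightarrow> 0\<close>; then \<open>J\<close> degenerates, and it suffices to reduce monomials by leading terms.

  In the normal case the heights \<open>\<omega>\<close> induce a regular triangulation of the cone over \<open>A\<close>, and in the
  limit \<open>\<partial>\<^sup>u \<partial>\<^sup>w\<close> survives only if \<open>A u\<close> and \<open>A w\<close> lie in a common cell. Every lattice point of the cone
  has a monomial. A point of degree \<open>d\<close> with a coordinate greater than 1 can be moved to larger
  faces; the remaining points are sums of the vertices of a cell, and these are moved from cell to
  adjacent cell along a fixed direction until they leave the cone.
\<close>

section \<open>Polynomials and toric ideals\<close>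

text \<open>No Groebner basis of \<open>J\<close> is computed and no rewriting has to terminate. For
  each monomial of the given degree one element of \<open>J\<close> is picked, a binomial or a
  multiple of a linear form, in which this monomial dominates on the curve. After rescaling, the
  square matrix of these elements tends to an invertible diagonal matrix as s tends to 0. Exchanges
  inside one cell produce ties between the weights; a second, natural-number weight that must
  increase breaks them. Degree d enters because a cell has d vertices and the coordinates of a point
  of degree m sum to m: in degree d, if none exceeds 1, all equal 1. Normality enters through c -
  a_j, a lattice point of the cone which has to be the degree of a monomial, so that some monomial
  of degree c is divisible by \<partial>_j. Without normality a large degree N is reached instead;
  it only shows that the nonzero degrees are bounded, and k is then read off separately at each p.
  The same heights \<omega> serve for both degrees, so both determinants are nonzero at a common
  point of the curve.\<close>

abbreviation mon :: "('n \<Rightarrow>\<^sub>0 nat) \<Rightarrow> 'n mpoly" where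
  "mon u \<equiv> Poly_Mapping.single u 1"

abbreviation unit_exp :: "'n \<Rightarrow> 'n \<Rightarrow>\<^sub>0 nat" where
  "unit_exp j \<equiv> Poly_Mapping.single j 1"

definition mdeg :: "('n::finite \<Rightarrow>\<^sub>0 nat) \<Rightarrow> nat" where
  "mdeg u = (\<Sum>j\<in>UNIV. Poly_Mapping.lookup u j)"

lemma mdeg_add: "mdeg (u + w) = mdeg u + mdeg w"
  by (simp add: mdeg_def lookup_add sum.distrib)

lemma mdeg_zero [simp]: "mdeg 0 = 0"
  by (simp add: mdeg_def)

lemma mdeg_single [simp]: "mdeg (Poly_Mapping.single j k) = k"
  by (simp add: mdeg_def lookup_single when_def)

lemma mdeg_eq_0_iff: "mdeg u = 0 \<longleftrightarrow> u = 0"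
proof
  assume "mdeg u = 0"
  then show "u = 0" by (intro poly_mapping_eqI) (simp add: mdeg_def)
qed simp

lemma exp_split:
  assumes "Poly_Mapping.lookup u j > 0"
  obtains w where "u = w + unit_exp j"
proof
  show "u = (u - unit_exp j) + unit_exp j"
    using assms by (intro poly_mapping_eqI) (auto simp: lookup_add lookup_minus lookup_single when_def)
qed

lemma finite_mdeg: "finite {u :: 'n::finite \<Rightarrow>\<^sub>0 nat. mdeg u = N}" (is "finite ?X")
proof -
  have inj: "inj_on Poly_Mapping.lookup ?X"
    by (rule inj_onI) (simp add: poly_mapping_eqI)
  have bound: "Poly_Mapping.lookup u j \<le> mdeg u" for u :: "'n \<Rightarrow>\<^sub>0 nat" and j
    unfolding mdeg_def by (rule member_le_sum) simp_all
  have "Poly_Mapping.lookup ` ?X \<subseteq> Pi\<^sub>E UNIV (\<lambda>_. {..N})"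
  proof (rule image_subsetI)
    fix u :: "'n \<Rightarrow>\<^sub>0 nat" assume "u \<in> ?X"
    then show "Poly_Mapping.lookup u \<in> Pi\<^sub>E UNIV (\<lambda>_. {..N})"
      using bound[of u] by (simp add: PiE_UNIV_domain)
  qed
  moreover have "finite (Pi\<^sub>E (UNIV :: 'n set) (\<lambda>_. {..N}))"
    by (rule finite_PiE) simp_all
  ultimately have "finite (Poly_Mapping.lookup ` ?X)"
    by (rule finite_subset)
  from finite_imageD[OF this inj] show ?thesis .
qed

lemma mpoly_expansion:
  fixes f :: "'n mpoly"
  shows "f = (\<Sum>u\<in>Poly_Mapping.keys f. Poly_Mapping.single u (Poly_Mapping.lookup f u))"
proof (rule poly_mapping_eqI)
  fix w
  show "Poly_Mapping.lookup f w =
    Poly_Mapping.lookup (\<Sum>u\<in>Poly_Mapping.keys f. Poly_Mapping.single u (Poly_Mapping.lookup f u)) w"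
    by (simp add: lookup_sum lookup_single when_def sum.delta in_keys_iff)
qed

lemma mpoly_induct [case_names single add]:
  fixes f :: "'n mpoly"
  assumes "\<And>u c. P (Poly_Mapping.single u c)" "\<And>f g. P f \<Longrightarrow> P g \<Longrightarrow> P (f + g)"
  shows "P f"
proof -
  have "P 0" using assms(1)[of 0 0] by simp
  have "P (\<Sum>u\<in>S. Poly_Mapping.single u (Poly_Mapping.lookup f u))" if "finite S" for S
    using that by (induction S rule: finite_induct) (auto simp: \<open>P 0\<close> assms)
  from this[OF finite_keys[of f]] show ?thesis by (simp only: mpoly_expansion[of f, symmetric])
qed

lemma Const_add: "Const (a + b) = Const a + Const b"
  by (simp add: Const_def single_add)

lemma Const_mult: "Const (a * b) = Const a * Const b"
  by (simp add: Const_def mult_single)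

lemma Const_0 [simp]: "Const 0 = 0" and Const_1 [simp]: "Const 1 = 1"
  by (simp_all add: Const_def)

lemma Const_uminus: "Const (- a) = - Const a"
  by (simp add: Const_def single_uminus)

lemma Const_of_int: "Const (of_int k) = of_int k"
  by (simp add: Const_def)

lemma Const_of_nat: "Const (of_nat k) = of_nat k"
  by (simp add: Const_def)

lemma Const_sum: "Const (sum f S) = (\<Sum>x\<in>S. Const (f x))"
  by (induction S rule: infinite_finite_induct) (auto simp: Const_add)

lemma Const_mult_single: "Const c * Poly_Mapping.single u a = Poly_Mapping.single u (c * a)"
  by (simp add: Const_def mult_single)

lemma Var_power: "Var j ^ k = mon (Poly_Mapping.single j k)"
  by (induction k) (auto simp: Var_def mult_single simp flip: single_add)

lemma prod_mon: "(\<Prod>j\<in>S. mon (g j)) = mon (\<Sum>j\<in>S. g j)"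
  by (induction S rule: infinite_finite_induct) (auto simp: mult_single)

lemma sum_unit_exp: "(\<Sum>j\<in>UNIV. Poly_Mapping.single j (e j)) = Abs_poly_mapping (e :: 'n::finite \<Rightarrow> nat)"
  by (rule poly_mapping_eqI) (simp add: lookup_sum lookup_single when_def)

lemma prod_Var_power: "(\<Prod>j\<in>UNIV. Var j ^ e j) = mon (Abs_poly_mapping (e :: 'n::finite \<Rightarrow> nat))"
  by (simp add: Var_power prod_mon sum_unit_exp)

section \<open>Evaluation of polynomials at a point\<close>

lemma peval_superset:
  assumes "finite S" "Poly_Mapping.keys f \<subseteq> S"
  shows "peval f p = (\<Sum>u\<in>S. Poly_Mapping.lookup f u * (\<Prod>j\<in>UNIV. (p $ j) ^ Poly_Mapping.lookup u j))"
  unfolding peval_def by (rule sum.mono_neutral_left) (use assms in \<open>auto simp: in_keys_iff\<close>)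

lemma peval_add: "peval (f + g) p = peval f p + peval g p"
proof -
  let ?S = "Poly_Mapping.keys f \<union> Poly_Mapping.keys g"
  have "Poly_Mapping.keys (f + g) \<subseteq> ?S" by (rule keys_add)
  then show ?thesis
    by (simp add: peval_superset[of ?S] lookup_add sum.distrib ring_distribs)
qed

lemma peval_single: "peval (Poly_Mapping.single u c) p = c * (\<Prod>j\<in>UNIV. (p $ j) ^ Poly_Mapping.lookup u j)"
  by (subst peval_superset[of "{u}"]) auto

lemma peval_mult: "peval (f * g) p = peval f p * peval g p"
proof (induction f rule: mpoly_induct)
  case (single u c)
  show ?case
    by (induction g rule: mpoly_induct)
      (simp_all add: mult_single peval_single lookup_add power_add prod.distrib peval_add ring_distribs)
qed (simp add: peval_add ring_distribs)

interpretation peval_hom: comm_ring_hom "\<lambda>f. peval f p" for p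
  by unfold_locales (simp_all add: peval_add peval_mult peval_single[of 0 1, simplified] peval_single[of 0 0, simplified])

lemma peval_Const [simp]: "peval (Const c) p = c"
  by (simp add: Const_def peval_single)

lemma peval_Var [simp]: "peval (Var j) p = p $ j"
proof -
  have "(\<Prod>k\<in>UNIV. p $ k ^ Poly_Mapping.lookup (unit_exp j) k) = (\<Prod>k\<in>UNIV. if j = k then p $ k else 1)"
    by (rule prod.cong) (auto simp: lookup_single when_def)
  then show ?thesis by (simp add: Var_def peval_single)
qed

lemma zariski_open_peval_neq_0: "zariski_open {p. peval f p \<noteq> 0}"
  unfolding zariski_open_def zariski_closed_def by (rule exI[of _ "{f}"]) auto

text \<open>The degree of a monomial in the Z^d-grading of R_A. The ideal \<open>I_A\<close> is
  spanned by the differences of monomials of equal \<open>A_deg\<close>.\<close>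

definition A_deg :: "int ^ 'n ^ 'd \<Rightarrow> ('n::finite \<Rightarrow>\<^sub>0 nat) \<Rightarrow> int ^ 'd" where
  "A_deg A u = A *v (\<chi> j. int (Poly_Mapping.lookup u j))"

lemma A_deg_add: "A_deg A (u + w) = A_deg A u + A_deg A w"
  unfolding A_deg_def by (simp add: lookup_add Finite_Cartesian_Product.vec_eq_iff matrix_vector_mult_def ring_distribs sum.distrib)

section \<open>Elements of the toric ideal\<close>

lemma cring_R_A: "cring R_A"
  by (rule cringI, rule abelian_groupI, unfold R_A_def)
    (auto intro: exI[of _ "- x" for x] simp: algebra_simps monoid.defs comm_monoid_def
      comm_monoid_axioms_def monoid_def)

lemma R_A_simps [simp]: "carrier R_A = UNIV" "mult R_A = (*)" "one R_A = 1" "zero R_A = 0" "add R_A = (+)"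
  by (simp_all add: R_A_def)

lemma R_A_uminus [simp]: "\<ominus>\<^bsub>R_A\<^esub> f = - f"
  by (rule abelian_group.minus_equality[OF ring.is_abelian_group[OF cring.axioms(1)[OF cring_R_A]]]) auto

lemma ideal_R_A_iff:
  "ideal I R_A \<longleftrightarrow> 0 \<in> I \<and> (\<forall>f\<in>I. \<forall>g\<in>I. f + g \<in> I) \<and> (\<forall>r. \<forall>f\<in>I. r * f \<in> I)"
proof
  assume "ideal I R_A"
  then interpret ideal I R_A .
  show "0 \<in> I \<and> (\<forall>f\<in>I. \<forall>g\<in>I. f + g \<in> I) \<and> (\<forall>r. \<forall>f\<in>I. r * f \<in> I)"
    using additive_subgroup.zero_closed[OF additive_subgroup_axioms] additive_subgroup.a_closed[OF additive_subgroup_axioms] I_l_closed by auto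
next
  assume *: "0 \<in> I \<and> (\<forall>f\<in>I. \<forall>g\<in>I. f + g \<in> I) \<and> (\<forall>r. \<forall>f\<in>I. r * f \<in> I)"
  have "- f \<in> I" if "f \<in> I" for f
    using *[THEN conjunct2, THEN conjunct2, rule_format, OF that, of "- 1"] by simp
  moreover have "f * r \<in> I" if "f \<in> I" for f r
    using * that by (subst mult.commute) blast
  ultimately show "ideal I R_A"
    using *
    by (intro idealI[OF cring.axioms(1)[OF cring_R_A]] group.subgroupI
        abelian_group.a_group[OF ring.is_abelian_group[OF cring.axioms(1)[OF cring_R_A]]])
      (auto simp: R_A_uminus[unfolded a_inv_def, simplified])
qed

lemma ideal_I_A: "ideal (I_A A) R_A"
  unfolding I_A_def by (rule ring.genideal_ideal[OF cring.axioms(1)[OF cring_R_A]]) simp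

lemma
  shows I_A_zero: "0 \<in> I_A A"
    and I_A_add: "f \<in> I_A A \<Longrightarrow> g \<in> I_A A \<Longrightarrow> f + g \<in> I_A A"
    and I_A_mult: "f \<in> I_A A \<Longrightarrow> r * f \<in> I_A A"
  using ideal_I_A[of A] unfolding ideal_R_A_iff by blast+

text \<open>The greatest common divisor \<open>m\<close> of the two monomials is split off; what
  remains has disjoint supports, as in the generators of \<open>I_A\<close>.\<close>

lemma exp_pos_neg_parts:
  fixes u w :: "'n::finite \<Rightarrow>\<^sub>0 nat"
  defines "v \<equiv> \<chi> j. int (Poly_Mapping.lookup u j) - int (Poly_Mapping.lookup w j)"
  obtains m where "u = m + Abs_poly_mapping (\<lambda>j. nat (v $ j))"
    and "w = m + Abs_poly_mapping (\<lambda>j. nat (- (v $ j)))"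
proof
  define m where "m = Abs_poly_mapping (\<lambda>j. min (Poly_Mapping.lookup u j) (Poly_Mapping.lookup w j))"
  show "u = m + Abs_poly_mapping (\<lambda>j. nat (v $ j))" "w = m + Abs_poly_mapping (\<lambda>j. nat (- (v $ j)))"
    by (auto intro!: poly_mapping_eqI simp: lookup_add m_def v_def)
qed

lemma I_A_binomial:
  assumes "A_deg A u = A_deg A w"
  shows "mon u - mon w \<in> I_A A"
proof -
  define v where "v = (\<chi> j. int (Poly_Mapping.lookup u j) - int (Poly_Mapping.lookup w j))"
  obtain m where m: "u = m + Abs_poly_mapping (\<lambda>j. nat (v $ j))"
    "w = m + Abs_poly_mapping (\<lambda>j. nat (- (v $ j)))"
    using exp_pos_neg_parts unfolding v_def by blast
  have "A *v v = 0"
    using assms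
    by (simp add: v_def A_deg_def Finite_Cartesian_Product.vec_eq_iff matrix_vector_mult_def ring_distribs sum_subtractf)
  then have "(\<Prod>j\<in>UNIV. Var j ^ nat (v $ j)) - (\<Prod>j\<in>UNIV. Var j ^ nat (- (v $ j))) \<in> I_A A"
    unfolding I_A_def
    by (intro set_mp[OF ring.genideal_self[OF cring.axioms(1)[OF cring_R_A]]]) auto
  then have "mon m * (mon (Abs_poly_mapping (\<lambda>j. nat (v $ j))) - mon (Abs_poly_mapping (\<lambda>j. nat (- (v $ j))))) \<in> I_A A"
    by (intro I_A_mult) (simp add: prod_Var_power)
  then show ?thesis by (simp add: right_diff_distrib mult_single flip: m)
qed

text \<open>A monomial times a generator is again a difference of two monomials of equal degree, so
  \<open>I_A\<close> is the linear span of such differences.\<close>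

lemma I_A_induct [consumes 1, case_names zero add binomial]:
  assumes "f \<in> I_A A"
    and "P 0" "\<And>f g. P f \<Longrightarrow> P g \<Longrightarrow> P (f + g)"
    and "\<And>c u w. A_deg A u = A_deg A w \<Longrightarrow> P (Poly_Mapping.single u c - Poly_Mapping.single w c)"
  shows "P f"
proof -
  let ?G = "{(\<Prod>j\<in>UNIV. Var j ^ nat (v $ j)) - (\<Prod>j\<in>UNIV. Var j ^ nat (- (v $ j))) | v. A *v v = 0}"
  \<comment> \<open>Quantifying over all multiples makes \<open>K\<close> an ideal, although
    \<open>P\<close> is closed under addition only.\<close>
  define K where "K = {f. \<forall>r. P (r * f)}"
  have "ideal K R_A"
    unfolding ideal_R_A_iff K_def
    by (auto simp: assms(2,3) ring_distribs mult.assoc[symmetric])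
  moreover have "?G \<subseteq> K"
  proof
    fix g assume "g \<in> ?G"
    then obtain v where v: "A *v v = 0"
      and g: "g = mon (Abs_poly_mapping (\<lambda>j. nat (v $ j))) - mon (Abs_poly_mapping (\<lambda>j. nat (- (v $ j))))"
      by (auto simp: prod_Var_power)
    have split: "(a + b) - (a' + b') = (a - a') + (b - b')" for a b a' b' :: "'a mpoly" by simp
    have "A_deg A (Abs_poly_mapping (\<lambda>j. nat (v $ j))) - A_deg A (Abs_poly_mapping (\<lambda>j. nat (- (v $ j))))
      = A *v v"
      unfolding A_deg_def
      by (simp add: Finite_Cartesian_Product.vec_eq_iff matrix_vector_mult_def flip: sum_subtractf right_diff_distrib)
        (auto intro!: sum.cong)
    then have "P (r * g)" for r
      unfolding g
      by (induction r rule: mpoly_induct)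
        (simp_all add: right_diff_distrib mult_single v A_deg_add assms distrib_right split)
    then show "g \<in> K" by (simp add: K_def)
  qed
  ultimately have "I_A A \<subseteq> K"
    unfolding I_A_def by (rule ring.genideal_minimal[OF cring.axioms(1)[OF cring_R_A]])
  with assms(1) have "P (1 * f)" unfolding K_def by blast
  then show ?thesis by simp
qed

text \<open>Coefficients that witness membership in \<open>J_A\<close> need not be homogeneous;
  taking homogeneous components repairs this.\<close>

definition hcomp :: "nat \<Rightarrow> 'n::finite mpoly \<Rightarrow> 'n mpoly" where
  "hcomp m f = Poly_Mapping.mapp (\<lambda>u c. c when mdeg u = m) f"

lemma lookup_hcomp: "Poly_Mapping.lookup (hcomp m f) u = (Poly_Mapping.lookup f u when mdeg u = m)"
  by (auto simp: hcomp_def lookup_mapp when_def in_keys_iff)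

lemma hcomp_add: "hcomp m (f + g) = hcomp m f + hcomp m g"
  by (rule poly_mapping_eqI) (simp add: lookup_hcomp lookup_add when_add_distrib)

lemma hcomp_zero [simp]: "hcomp m 0 = 0"
  by (rule poly_mapping_eqI) (simp add: lookup_hcomp)

lemma hcomp_sum: "hcomp m (sum f S) = (\<Sum>x\<in>S. hcomp m (f x))"
  by (induction S rule: infinite_finite_induct) (auto simp: hcomp_add)

lemma hcomp_diff: "hcomp m (f - g) = hcomp m f - hcomp m g"
  by (rule poly_mapping_eqI) (simp add: lookup_hcomp lookup_minus when_def)

lemma hcomp_single: "hcomp m (Poly_Mapping.single u c) = (Poly_Mapping.single u c when mdeg u = m)"
  by (rule poly_mapping_eqI) (auto simp: lookup_hcomp lookup_single when_def)

lemma homogeneous_hcomp: "homogeneous_poly m (hcomp m f)"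
  unfolding homogeneous_poly_def
  by (auto simp: in_keys_iff lookup_hcomp mdeg_def[symmetric])

lemma hcomp_mult_Var: "hcomp (Suc m) (f * Var j) = hcomp m f * Var j"
  by (induction f rule: mpoly_induct)
    (auto simp: Var_def mult_single hcomp_single mdeg_add distrib_right hcomp_add when_def)

lemma hcomp_Const_mult: "hcomp m (Const c * f) = Const c * hcomp m f"
  by (induction f rule: mpoly_induct)
    (auto simp: Const_mult_single hcomp_single distrib_left hcomp_add when_def)

text \<open>The preimage in R_A of the ideal of S_A generated by the forms, written with explicit
  coefficients so that a member can be taken apart.\<close>

definition J_A :: "int ^ 'n ^ 'd::finite \<Rightarrow> complex ^ 'n \<Rightarrow> 'n::finite mpoly set" where
  "J_A A p = {h + (\<Sum>i\<in>UNIV. c i * AE_form A p i) | h c. h \<in> I_A A}"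

lemma J_A_I: "h \<in> I_A A \<Longrightarrow> h + (\<Sum>i\<in>UNIV. c i * AE_form A p i) \<in> J_A A p"
  unfolding J_A_def by blast

lemma ideal_J_A: "ideal (J_A A p) R_A"
  unfolding ideal_R_A_iff
proof (intro conjI ballI allI)
  show "0 \<in> J_A A p"
    using J_A_I[OF I_A_zero, where c = "\<lambda>_. 0"] by simp
next
  fix f g assume "f \<in> J_A A p" "g \<in> J_A A p"
  then obtain h c h' c' where f: "f = h + (\<Sum>i\<in>UNIV. c i * AE_form A p i)" "h \<in> I_A A"
    and g: "g = h' + (\<Sum>i\<in>UNIV. c' i * AE_form A p i)" "h' \<in> I_A A" unfolding J_A_def by blast
  have "f + g = (h + h') + (\<Sum>i\<in>UNIV. (c i + c' i) * AE_form A p i)"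
    by (simp add: f g distrib_right sum.distrib)
  then show "f + g \<in> J_A A p" using J_A_I[OF I_A_add[OF f(2) g(2)]] by simp
next
  fix r f assume "f \<in> J_A A p"
  then obtain h c where f: "f = h + (\<Sum>i\<in>UNIV. c i * AE_form A p i)" "h \<in> I_A A" unfolding J_A_def by blast
  have "r * f = r * h + (\<Sum>i\<in>UNIV. (r * c i) * AE_form A p i)"
    by (simp add: f distrib_left sum_distrib_left mult.assoc)
  then show "r * f \<in> J_A A p" using J_A_I[OF I_A_mult[OF f(2)]] by simp
qed

lemma
  shows J_A_zero: "0 \<in> J_A A p"
    and J_A_add: "f \<in> J_A A p \<Longrightarrow> g \<in> J_A A p \<Longrightarrow> f + g \<in> J_A A p"
    and J_A_mult: "f \<in> J_A A p \<Longrightarrow> r * f \<in> J_A A p"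
  using ideal_J_A[of A p] unfolding ideal_R_A_iff by blast+

lemma J_A_sum: "(\<And>x. x \<in> S \<Longrightarrow> f x \<in> J_A A p) \<Longrightarrow> sum f S \<in> J_A A p"
  by (induction S rule: infinite_finite_induct) (auto simp: J_A_zero J_A_add)

lemma I_A_in_J_A: "f \<in> I_A A \<Longrightarrow> f \<in> J_A A p"
  using J_A_I[where c = "\<lambda>_. 0"] by simp

lemma AE_form_in_J_A: "AE_form A p i \<in> J_A A p"
proof -
  have "(\<Sum>k\<in>UNIV. (if k = i then 1 else 0) * AE_form A p k) = AE_form A p i"
    by (subst sum.cong[OF refl, of _ _ "\<lambda>k. if k = i then AE_form A p k else 0"]) auto
  then show ?thesis
    using J_A_I[OF I_A_zero[of A], where c = "\<lambda>k. if k = i then 1 else 0" and p = p]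
    by (simp only: add_0_left)
qed

lemma coset_I_A_eq_iff: "I_A A +>\<^bsub>R_A\<^esub> f = I_A A +>\<^bsub>R_A\<^esub> g \<longleftrightarrow> f - g \<in> I_A A"
proof -
  have "f - g = f \<ominus>\<^bsub>R_A\<^esub> g" by (simp add: a_minus_def)
  then show ?thesis
    using ring.quotient_eq_iff_same_a_r_cos[OF cring.axioms(1)[OF cring_R_A] ideal_I_A[of A], of f g]
    by simp
qed

lemma carrier_S_A: "carrier (S_A A) = range (\<lambda>f. I_A A +>\<^bsub>R_A\<^esub> f)"
  by (auto simp: S_A_def FactRing_def A_RCOSETS_def')

lemma S_A_mult: "(I_A A +>\<^bsub>R_A\<^esub> f) \<otimes>\<^bsub>S_A A\<^esub> (I_A A +>\<^bsub>R_A\<^esub> g) = I_A A +>\<^bsub>R_A\<^esub> (f * g)"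
  using ideal.rcoset_mult_add[OF ideal_I_A, of f g A] by (simp add: S_A_def FactRing_def)

lemma S_A_add: "(I_A A +>\<^bsub>R_A\<^esub> f) \<oplus>\<^bsub>S_A A\<^esub> (I_A A +>\<^bsub>R_A\<^esub> g) = I_A A +>\<^bsub>R_A\<^esub> (f + g)"
  using abelian_subgroup.a_rcos_sum[OF abelian_subgroupI3[OF ideal.axioms(1)[OF ideal_I_A]
    ring.is_abelian_group[OF cring.axioms(1)[OF cring_R_A]]], of f g A]
  by (simp add: S_A_def FactRing_def)

lemma S_A_zero: "\<zero>\<^bsub>S_A A\<^esub> = I_A A +>\<^bsub>R_A\<^esub> 0"
  by (simp add: S_A_def FactRing_def a_r_coset_def')

lemma S_A_one: "\<one>\<^bsub>S_A A\<^esub> = I_A A +>\<^bsub>R_A\<^esub> 1"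
  by (simp add: S_A_def FactRing_def)

lemma cring_S_A: "cring (S_A A)"
  unfolding S_A_def by (rule ideal.quotient_is_cring[OF ideal_I_A cring_R_A])

text \<open>The image of \<open>J_A\<close> is an ideal of S_A containing the generators, hence
  contains the generated ideal. Since \<open>I_A\<close> lies in \<open>J_A\<close>, membership does
  not depend on the representative of the coset.\<close>

lemma coset_in_genideal_iff:
  "I_A A +>\<^bsub>R_A\<^esub> f \<in> Idl\<^bsub>S_A A\<^esub> (range (\<lambda>i. I_A A +>\<^bsub>R_A\<^esub> AE_form A p i)) \<longleftrightarrow> f \<in> J_A A p"
    (is "?q f \<in> ?Idl \<longleftrightarrow> _")
proof
  have ring: "ring (S_A A)" using cring_S_A cring.axioms(1) by blast
  have inv: "\<ominus>\<^bsub>S_A A\<^esub> ?q g = ?q (- g)" for g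
    by (rule abelian_group.minus_equality[OF ring.is_abelian_group[OF ring]])
      (auto simp: S_A_add carrier_S_A S_A_zero)
  have "ideal (?q ` J_A A p) (S_A A)"
  proof (rule idealI[OF ring])
    show "subgroup (?q ` J_A A p) (add_monoid (S_A A))"
    proof (rule group.subgroupI[OF abelian_group.a_group[OF ring.is_abelian_group[OF ring]]])
      show "?q ` J_A A p \<noteq> {}" using J_A_zero[of A p] by blast
      show "?q ` J_A A p \<subseteq> carrier (add_monoid (S_A A))" by (auto simp: carrier_S_A)
      fix a b assume "a \<in> ?q ` J_A A p" "b \<in> ?q ` J_A A p"
      then show "a \<otimes>\<^bsub>add_monoid (S_A A)\<^esub> b \<in> ?q ` J_A A p"
        by (auto simp: S_A_add J_A_add)
    next
      fix a assume "a \<in> ?q ` J_A A p"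
      then obtain g where "a = ?q g" "g \<in> J_A A p" by blast
      then show "inv\<^bsub>add_monoid (S_A A)\<^esub> a \<in> ?q ` J_A A p"
        using J_A_mult[of g A p "-1"] unfolding a_inv_def[symmetric] by (auto simp: inv)
    qed
  next
    fix a x assume "a \<in> ?q ` J_A A p" "x \<in> carrier (S_A A)"
    then obtain g r where "a = ?q g" "g \<in> J_A A p" "x = ?q r" by (auto simp: carrier_S_A)
    then show "x \<otimes>\<^bsub>S_A A\<^esub> a \<in> ?q ` J_A A p" "a \<otimes>\<^bsub>S_A A\<^esub> x \<in> ?q ` J_A A p"
      using J_A_mult[of g A p r] by (simp_all add: S_A_mult mult.commute)
  qed
  then have "?Idl \<subseteq> ?q ` J_A A p"
    by (rule ring.genideal_minimal[OF ring]) (auto simp: AE_form_in_J_A)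
  moreover assume "?q f \<in> ?Idl"
  ultimately obtain g where "?q f = ?q g" "g \<in> J_A A p" by blast
  then have "(f - g) + g \<in> J_A A p"
    by (intro J_A_add[OF I_A_in_J_A]) (auto simp: coset_I_A_eq_iff)
  then show "f \<in> J_A A p" by simp
next
  have ring: "ring (S_A A)" using cring_S_A cring.axioms(1) by blast
  have car: "range (\<lambda>i. ?q (AE_form A p i)) \<subseteq> carrier (S_A A)" by (auto simp: carrier_S_A)
  interpret Idl: ideal ?Idl "S_A A" by (rule ring.genideal_ideal[OF ring car])
  assume "f \<in> J_A A p"
  then obtain h c where f: "f = h + (\<Sum>i\<in>UNIV. c i * AE_form A p i)" and h: "h \<in> I_A A"
    unfolding J_A_def by blast
  have zero: "?q 0 \<in> ?Idl" using additive_subgroup.zero_closed[OF Idl.additive_subgroup_axioms] by (simp add: S_A_zero)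
  have add: "?q (a + b) \<in> ?Idl" if "?q a \<in> ?Idl" "?q b \<in> ?Idl" for a b
    using additive_subgroup.a_closed[OF Idl.additive_subgroup_axioms that] by (simp add: S_A_add)
  have mult: "?q (c i * AE_form A p i) \<in> ?Idl" for i
  proof -
    have "?q (AE_form A p i) \<in> ?Idl" using ring.genideal_self[OF ring car] by blast
    then have "?q (c i) \<otimes>\<^bsub>S_A A\<^esub> ?q (AE_form A p i) \<in> ?Idl"
      by (rule Idl.I_l_closed) (simp add: carrier_S_A)
    then show ?thesis by (simp add: S_A_mult)
  qed
  have "?q (\<Sum>i\<in>S. c i * AE_form A p i) \<in> ?Idl" for S
    by (induction S rule: infinite_finite_induct) (auto simp: zero add mult)
  moreover have "?q f = ?q (\<Sum>i\<in>UNIV. c i * AE_form A p i)"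
    using h by (simp add: coset_I_A_eq_iff f)
  ultimately show "?q f \<in> ?Idl" by simp
qed

text \<open>A homogeneous polynomial outside the ideal has a monomial outside it, so only the
  finitely many monomials of each degree matter.\<close>

lemma nonzero_degrees_iff:
  "m \<in> nonzero_degrees A p \<longleftrightarrow> (\<exists>u. mdeg u = m \<and> mon u \<notin> J_A A p)"
proof -
  have "m \<in> nonzero_degrees A p \<longleftrightarrow> (\<exists>f. homogeneous_poly m f \<and> f \<notin> J_A A p)"
    by (simp add: nonzero_degrees_def coset_in_genideal_iff)
  also have "\<dots> \<longleftrightarrow> (\<exists>u. mdeg u = m \<and> mon u \<notin> J_A A p)"
  proof
    assume "\<exists>f. homogeneous_poly m f \<and> f \<notin> J_A A p"
    then obtain f where f: "homogeneous_poly m f" "f \<notin> J_A A p" by blast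
    have "f = (\<Sum>u\<in>Poly_Mapping.keys f. Const (Poly_Mapping.lookup f u) * mon u)"
      by (subst mpoly_expansion[of f]) (simp add: Const_mult_single)
    with f(2) have "\<not> (\<forall>u\<in>Poly_Mapping.keys f. Const (Poly_Mapping.lookup f u) * mon u \<in> J_A A p)"
      using J_A_sum[of "Poly_Mapping.keys f" "\<lambda>u. Const (Poly_Mapping.lookup f u) * mon u" A p] by auto
    then obtain u where "u \<in> Poly_Mapping.keys f" "Const (Poly_Mapping.lookup f u) * mon u \<notin> J_A A p"
      by blast
    then show "\<exists>u. mdeg u = m \<and> mon u \<notin> J_A A p"
      using f(1) J_A_mult[of "mon u" A p "Const (Poly_Mapping.lookup f u)"] by (intro exI[of _ u]) (auto simp: homogeneous_poly_def mdeg_def)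
  next
    assume "\<exists>u. mdeg u = m \<and> mon u \<notin> J_A A p"
    then obtain u where "mdeg u = m" "mon u \<notin> J_A A p" by blast
    then show "\<exists>f. homogeneous_poly m f \<and> f \<notin> J_A A p"
      by (intro exI[of _ "mon u"]) (auto simp: homogeneous_poly_def mdeg_def)
  qed
  finally show ?thesis .
qed

section \<open>Generic coefficients via degeneration\<close>

text \<open>\<open>D\<close> is the determinant of \<open>B\<close>.\<close>

lemma generic_spanning:
  fixes A :: "int ^ 'n::finite ^ 'd::finite" and B :: "('n \<Rightarrow>\<^sub>0 nat) \<Rightarrow> ('n \<Rightarrow>\<^sub>0 nat) \<Rightarrow> 'n mpoly"
  assumes "finite X"
    and rows: "\<And>p u. u \<in> X \<Longrightarrow> (\<Sum>w\<in>X. Poly_Mapping.single w (peval (B u w) p)) \<in> J_A A p"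
  obtains D where "\<And>p w. peval D p \<noteq> 0 \<Longrightarrow> w \<in> X \<Longrightarrow> mon w \<in> J_A A p"
    and "\<And>p. \<forall>x. (\<forall>u\<in>X. (\<Sum>w\<in>X. peval (B u w) p * x w) = 0) \<longrightarrow> (\<forall>w\<in>X. x w = 0) \<Longrightarrow> peval D p \<noteq> 0"
proof -
  define n where "n = card X"
  obtain f where f: "bij_betw f {0..<n} X"
    using ex_bij_betw_nat_finite[OF assms(1)] unfolding n_def by blast
  define M where "M = Matrix.mat n n (\<lambda>(i, j). B (f i) (f j))"
  define D where "D = Determinant.det M"
  have sum_X: "(\<Sum>w\<in>X. g w) = (\<Sum>i=0..<n. g (f i))" for g :: "_ \<Rightarrow> 'c::comm_monoid_add"
    by (rule sum.reindex_bij_betw[OF f, symmetric])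
  have fX: "f i \<in> X" if "i < n" for i using f that by (auto simp: bij_betw_def)
  define N where "N = (\<lambda>p. map_mat (\<lambda>g. peval g p) M)"
  have N: "N p \<in> carrier_mat n n" "\<And>i j. i < n \<Longrightarrow> j < n \<Longrightarrow> N p $$ (i, j) = peval (B (f i) (f j)) p"
    "Determinant.det (N p) = peval D p" for p
    by (auto simp: N_def M_def D_def)
  show ?thesis
  proof (rule that)
    fix p w assume D: "peval D p \<noteq> 0" and w: "w \<in> X"
    obtain j0 where j0: "j0 < n" "w = f j0" using f w by (auto simp: bij_betw_def)
    \<comment> \<open>Row \<open>j0\<close> of the inverse \<open>C\<close> writes the unit vector
      at \<open>w\<close> as a combination of the rows, and thus \<open>mon w\<close> as a
      combination of elements of \<open>J_A\<close>.\<close>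
    have "N p \<in> Units (ring_mat TYPE(complex) n ())"
      using D N by (intro det_non_zero_imp_unit) auto
    then obtain C where C: "C \<in> carrier_mat n n" "C * N p = 1\<^sub>m n"
      unfolding Units_def ring_mat_def by auto
    have CN: "(\<Sum>i=0..<n. C $$ (j0, i) * peval (B (f i) (f j)) p) = (if j = j0 then 1 else 0)" if "j < n" for j
    proof -
      have "(C * N p) $$ (j0, j) = (\<Sum>i=0..<n. C $$ (j0, i) * peval (B (f i) (f j)) p)"
        using that j0(1) C(1) N(1)[of p] N(2)[of _ j p] by (auto simp: scalar_prod_def intro!: sum.cong)
      then show ?thesis using that j0(1) by (auto simp: C(2))
    qed
    have "(\<Sum>i=0..<n. Const (C $$ (j0, i)) * (\<Sum>w\<in>X. Poly_Mapping.single w (peval (B (f i) w) p)))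
      = (\<Sum>i=0..<n. \<Sum>j=0..<n. Poly_Mapping.single (f j) (C $$ (j0, i) * peval (B (f i) (f j)) p))"
      by (simp add: sum_X sum_distrib_left Const_mult_single)
    also have "\<dots> = (\<Sum>j=0..<n. Poly_Mapping.single (f j) (\<Sum>i=0..<n. C $$ (j0, i) * peval (B (f i) (f j)) p))"
      by (subst sum.swap) (rule sum.cong, simp, rule poly_mapping_eqI, simp add: lookup_sum lookup_single when_def)
    also have "\<dots> = (\<Sum>j=0..<n. if j = j0 then mon (f j) else 0)"
      by (rule sum.cong) (auto simp: CN)
    also have "\<dots> = mon w" using j0 by simp
    finally have "mon w = (\<Sum>i=0..<n. Const (C $$ (j0, i)) * (\<Sum>w\<in>X. Poly_Mapping.single w (peval (B (f i) w) p)))"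
      by (rule sym)
    then show "mon w \<in> J_A A p"
      using fX by (auto intro!: J_A_sum J_A_mult rows)
  next
    fix p
    assume ker: "\<forall>x. (\<forall>u\<in>X. (\<Sum>w\<in>X. peval (B u w) p * x w) = 0) \<longrightarrow> (\<forall>w\<in>X. x w = 0)"
    show "peval D p \<noteq> 0"
    proof
      assume "peval D p = 0"
      then obtain v where v: "v \<in> carrier_vec n" "v \<noteq> 0\<^sub>v n" "N p *\<^sub>v v = 0\<^sub>v n"
        using det_0_iff_vec_prod_zero_field[OF N(1)] N(3) by metis
      define x where "x = (\<lambda>w. vec_index v (the_inv_into {0..<n} f w))"
      have xf: "x (f i) = vec_index v i" if "i < n" for i
        using f that by (simp add: x_def the_inv_into_f_f bij_betw_def)
      have "(\<Sum>w\<in>X. peval (B u w) p * x w) = 0" if u: "u \<in> X" for u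
      proof -
        obtain i where i: "i < n" "u = f i" using f u by (auto simp: bij_betw_def)
        have "0 = vec_index (N p *\<^sub>v v) i" using v i by simp
        also have "\<dots> = (\<Sum>j=0..<n. peval (B (f i) (f j)) p * vec_index v j)"
          using v(1) i N(1)[of p] N(2)[of i _ p] by (auto simp: scalar_prod_def intro!: sum.cong)
        also have "\<dots> = (\<Sum>w\<in>X. peval (B u w) p * x w)"
          by (simp add: sum_X xf i)
        finally show ?thesis by simp
      qed
      then have "\<forall>w\<in>X. x w = 0" using ker by blast
      then have "vec_index v i = 0" if "i < n" for i
        using that by (simp add: xf[OF that, symmetric] fX)
      then have "v = 0\<^sub>v n" using v(1) by (intro eq_vecI) auto
      with v(2) show False ..
    qed
  qed
qed

hide_const (open) Matrix.rows Matrix.row Matrix.orthogonal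
no_notation vec_index (infixl "$" 100)
no_notation scalar_prod (infix "\<bullet>" 70)

text \<open>Look at the equation of an index \<open>u\<close> where \<open>norm (z u)\<close> is
  maximal: the deviations from the diagonal matrix add up to at most the fraction
  \<open>card X / (card X + 1)\<close> of \<open>norm (c u * z u)\<close>, which forces
  \<open>z u = 0\<close>.\<close>

lemma diagonally_dominant_kernel:
  fixes E :: "'x \<Rightarrow> 'x \<Rightarrow> complex"
  assumes X: "finite X"
    and dom: "\<And>u w. u \<in> X \<Longrightarrow> w \<in> X \<Longrightarrow> norm (E u w - (if w = u then c u else 0)) * (card X + 1) < norm (c u)"
    and ker: "\<And>u. u \<in> X \<Longrightarrow> (\<Sum>w\<in>X. E u w * z w) = 0"
    and "w \<in> X"
  shows "z w = 0"
proof -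
  have "X \<noteq> {}" using \<open>w \<in> X\<close> by blast
  then have "Max ((\<lambda>v. norm (z v)) ` X) \<in> (\<lambda>v. norm (z v)) ` X"
    using X by (intro Max_in) simp_all
  then obtain u where u: "u \<in> X" "Max ((\<lambda>v. norm (z v)) ` X) = norm (z u)"
    by blast
  have max: "norm (z v) \<le> norm (z u)" if "v \<in> X" for v
    unfolding u(2)[symmetric] using X that by (intro Max_ge) simp_all
  define F where "F = (\<lambda>v. E u v - (if v = u then c u else 0))"
  have F: "norm (F v) \<le> norm (c u) / (card X + 1)" if "v \<in> X" for v
    using dom[OF u(1) that] by (simp add: F_def field_simps)
  have "(\<Sum>v\<in>X. F v * z v) = (\<Sum>v\<in>X. E u v * z v - (if v = u then c u * z u else 0))"
    by (rule sum.cong) (auto simp: F_def left_diff_distrib)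
  also have "\<dots> = - (c u * z u)"
    using u(1) X ker by (simp add: sum_subtractf)
  finally have "norm (c u * z u) = norm (\<Sum>v\<in>X. F v * z v)" by simp
  also have "\<dots> \<le> (\<Sum>v\<in>X. norm (F v) * norm (z v))"
    by (rule order_trans[OF norm_sum]) (simp add: norm_mult)
  also have "\<dots> \<le> (\<Sum>v\<in>X. norm (c u) / (card X + 1) * norm (z u))"
    by (intro sum_mono mult_mono F max) auto
  also have "\<dots> = card X / (card X + 1) * (norm (c u) * norm (z u))"
    by simp
  finally have "norm (c u) * norm (z u) * (card X + 1) \<le> norm (c u) * norm (z u) * card X"
    by (simp add: norm_mult field_simps)
  moreover have "norm (c u) > 0"
  proof -
    have "0 \<le> norm (E u u - c u) * (card X + 1)" by simp
    then show ?thesis using dom[OF u(1) u(1)] by (simp only: simp_thms if_True)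
  qed
  ultimately have "norm (z u) = 0"
    by (simp add: distrib_left mult_le_0_iff)
  then show "z w = 0" using max[OF \<open>w \<in> X\<close>] by simp
qed

lemma powr_tendsto_0_at_right:
  assumes "a > (0::real)"
  shows "((\<lambda>s. s powr a) \<longlongrightarrow> 0) (at_right 0)"
proof -
  have "\<forall>\<^sub>F s in at_right 0. (0::real) \<le> s"
    using eventually_at_right_less[of "0::real"] by eventually_elim simp
  then have "((\<lambda>s::real. s powr a) \<longlongrightarrow> 0 powr a) (at_right 0)"
    using assms by (intro tendsto_powr' tendsto_ident_at tendsto_const) simp
  then show ?thesis by simp
qed

lemma single_sum: "Poly_Mapping.single u (\<Sum>i\<in>S. g i) = (\<Sum>i\<in>S. Poly_Mapping.single u (g i))"
  by (induction S rule: infinite_finite_induct) (simp_all add: single_add)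

definition acol :: "int ^ 'n ^ 'd \<Rightarrow> 'n \<Rightarrow> real ^ 'd" where
  "acol A i = (\<chi> r. real_of_int (A $ r $ i))"

definition curve :: "('n \<Rightarrow> real) \<Rightarrow> real \<Rightarrow> complex ^ 'n" where
  "curve \<omega> s = (\<chi> j. of_real (s powr \<omega> j))"

text \<open>This is the combination of the forms \<open>AE_form A p r\<close> with coefficients
  \<open>h $ r\<close>. A form with few terms thus comes from a functional \<open>h\<close>
  vanishing on many columns.\<close>

lemma linear_form_in_J_A:
  fixes A :: "int ^ 'n::finite ^ 'd::finite"
  shows "(\<Sum>i\<in>UNIV. Const (of_real (h \<bullet> acol A i) * p $ i) * Var i) \<in> J_A A p"
proof -
  have "(\<Sum>i\<in>UNIV. Const (of_real (h \<bullet> acol A i) * p $ i) * Var i)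
     = (\<Sum>i\<in>UNIV. \<Sum>r\<in>UNIV. Const (of_real (h $ r)) * (Const (of_int (A $ r $ i) * p $ i) * Var i))"
    by (intro sum.cong refl)
      (simp add: inner_vec_def acol_def sum_distrib_right Const_sum Const_mult mult.assoc)
  also have "\<dots> = (\<Sum>r\<in>UNIV. Const (of_real (h $ r)) * AE_form A p r)"
    unfolding AE_form_def by (subst sum.swap) (simp add: sum_distrib_left)
  finally show ?thesis by (auto intro!: J_A_sum J_A_mult AE_form_in_J_A)
qed

text \<open>
  The two alternatives stand for the elements \<open>\<partial>\<^sup>u - \<partial>\<^sup>w\<close> and \<open>\<partial>\<^sup>w (\<Sum>i. (h \<bullet> a\<^sub>i) p\<^sub>i \<partial>\<^sub>i)\<close> of \<open>J_A\<close>. On the curve \<open>p\<^sub>j = s powr \<omega> j\<close>, with the basis monomial \<open>\<partial>\<^sup>w\<close> rescaled by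
  \<open>s powr wt w\<close>, the term \<open>\<partial>\<^sup>u\<close> dominates as \<open>s \<rightarrow> 0\<close>.
\<close>

definition reducible ::
  "int ^ 'n::finite ^ 'd::finite \<Rightarrow> ('n \<Rightarrow> real) \<Rightarrow> (('n \<Rightarrow>\<^sub>0 nat) \<Rightarrow> real) \<Rightarrow> ('n \<Rightarrow>\<^sub>0 nat) \<Rightarrow> bool" where
  "reducible A \<omega> wt u \<longleftrightarrow>
    (\<exists>w. A_deg A w = A_deg A u \<and> wt w < wt u) \<or>
    (\<exists>w j h. u = w + unit_exp j \<and> h \<bullet> acol A j \<noteq> 0 \<and>
      (\<forall>i. i \<noteq> j \<longrightarrow> h \<bullet> acol A i \<noteq> 0 \<longrightarrow> \<omega> j - wt u < \<omega> i - wt (w + unit_exp i)))"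

text \<open>The row of the matrix belonging to \<open>u\<close>. Scaled by
  \<open>s powr \<alpha>\<close>, with column \<open>w\<close> scaled by
  \<open>s powr (- wt w)\<close>, it tends to \<open>c\<close> times the unit vector at
  \<open>u\<close>.\<close>

lemma reducible_row:
  fixes A :: "int ^ 'n::finite ^ 'd::finite"
  assumes hom: "\<And>u w. A_deg A u = A_deg A w \<Longrightarrow> mdeg u = mdeg w"
    and red: "reducible A \<omega> wt u" and u: "mdeg u = N"
  shows "\<exists>b \<alpha> c. c \<noteq> 0 \<and> (\<forall>p. (\<Sum>w | mdeg w = N. Poly_Mapping.single w (peval (b w) p)) \<in> J_A A p) \<and>
    (\<forall>w. ((\<lambda>s. of_real (s powr (\<alpha> - wt w)) * peval (b w) (curve \<omega> s)) \<longlongrightarrow> (if w = u then c else 0)) (at_right 0))"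
  using red unfolding reducible_def
proof (elim disjE exE conjE)
  fix w assume w: "A_deg A w = A_deg A u" "wt w < wt u"
  define b where "b = (\<lambda>v. if v = u then 1 else if v = w then - 1 else 0 :: 'n mpoly)"
  have "w \<noteq> u" using w by auto
  have "mdeg w = N" using hom[OF w(1)] u by simp
  have "(\<Sum>v | mdeg v = N. Poly_Mapping.single v (peval (b v) p)) = mon u - mon w" for p
  proof -
    have "(\<Sum>v | mdeg v = N. Poly_Mapping.single v (peval (b v) p))
       = (\<Sum>v | mdeg v = N. (if v = u then mon u else 0) - (if v = w then mon w else 0))"
      by (rule sum.cong) (use \<open>w \<noteq> u\<close> in \<open>auto simp: b_def single_uminus peval_hom.hom_uminus\<close>)
    also have "\<dots> = mon u - mon w"
      using u \<open>mdeg w = N\<close> by (simp add: sum_subtractf finite_mdeg)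
    finally show ?thesis .
  qed
  moreover have "((\<lambda>s. of_real (s powr (wt u - wt v)) * peval (b v) (curve \<omega> s)) \<longlongrightarrow> (if v = u then 1 else 0 :: complex)) (at_right 0)" for v
  proof -
    consider "v = u" | "v = w" | "v \<noteq> u" "v \<noteq> w" by blast
    then show ?thesis
    proof cases
      \<comment> \<open>\<open>s powr 0\<close> is 1 only for nonzero \<open>s\<close>, so the
        function is constant eventually but not identically.\<close>
      case 1
      have "\<forall>\<^sub>F s in at_right 0. of_real (s powr 0) * 1 = (1::complex)"
        using eventually_at_right_less[of "0::real"] by eventually_elim simp
      then show ?thesis unfolding 1 b_def by (simp add: tendsto_eventually)
    next
      case 2
      have "((\<lambda>s. - complex_of_real (s powr (wt u - wt w))) \<longlongrightarrow> - of_real 0) (at_right 0)"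
        by (intro tendsto_minus tendsto_of_real powr_tendsto_0_at_right) (use w in simp)
      then show ?thesis using \<open>w \<noteq> u\<close> by (simp add: 2 b_def peval_hom.hom_uminus)
    qed (simp add: b_def)
  qed
  ultimately show ?thesis
    using I_A_in_J_A[OF I_A_binomial[OF w(1)[symmetric]]]
    by (intro exI[of _ b] exI[of _ "wt u"] exI[of _ 1]) simp
next
  fix w j h
  assume uw: "u = w + unit_exp j" and hj: "h \<bullet> acol A j \<noteq> 0"
    and less: "\<forall>i. i \<noteq> j \<longrightarrow> h \<bullet> acol A i \<noteq> 0 \<longrightarrow> \<omega> j - wt u < \<omega> i - wt (w + unit_exp i)"
  \<comment> \<open>\<open>b v\<close> collects the terms of the multiplied form that land on
    \<open>v\<close>; by \<open>inj\<close> below there is at most one.\<close>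
  define b where "b = (\<lambda>v. \<Sum>i\<in>UNIV. if v = w + unit_exp i then Const (of_real (h \<bullet> acol A i)) * Var i else 0)"
  have inj: "w + unit_exp i = w + unit_exp k \<longleftrightarrow> i = k" for i k
  proof -
    have "Poly_Mapping.lookup (unit_exp i) k \<noteq> Poly_Mapping.lookup (unit_exp k) k" if "i \<noteq> k"
      using that by (simp add: lookup_single)
    then show ?thesis by (metis add_left_cancel)
  qed
  have peb: "peval (b v) p = (\<Sum>i\<in>UNIV. if v = w + unit_exp i then of_real (h \<bullet> acol A i) * p $ i else 0)" for v p
    unfolding b_def peval_hom.hom_sum by (intro sum.cong refl) (simp add: peval_mult)
  have N: "mdeg w + 1 = N"
    using u uw by (simp add: mdeg_add)
  have "(\<Sum>v | mdeg v = N. Poly_Mapping.single v (peval (b v) p))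
     = mon w * (\<Sum>i\<in>UNIV. Const (of_real (h \<bullet> acol A i) * p $ i) * Var i)" for p
  proof -
    have "(\<Sum>v | mdeg v = N. Poly_Mapping.single v (peval (b v) p))
       = (\<Sum>v | mdeg v = N. \<Sum>i\<in>UNIV. if v = w + unit_exp i then Poly_Mapping.single v (of_real (h \<bullet> acol A i) * p $ i) else 0)"
      unfolding peb single_sum by (intro sum.cong refl) simp
    also have "\<dots> = (\<Sum>i\<in>UNIV. Poly_Mapping.single (w + unit_exp i) (of_real (h \<bullet> acol A i) * p $ i))"
      using N by (subst sum.swap) (intro sum.cong refl, simp add: finite_mdeg mdeg_add)
    also have "\<dots> = mon w * (\<Sum>i\<in>UNIV. Const (of_real (h \<bullet> acol A i) * p $ i) * Var i)"
      by (simp add: sum_distrib_left Var_def Const_mult_single mult_single)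
    finally show ?thesis .
  qed
  then have J: "(\<Sum>v | mdeg v = N. Poly_Mapping.single v (peval (b v) p)) \<in> J_A A p" for p
    by (simp add: J_A_mult linear_form_in_J_A)
  define c where "c = complex_of_real (h \<bullet> acol A j)"
  \<comment> \<open>The entry at \<open>u\<close> has order \<open>\<omega> j\<close>, which the
    exponent \<open>\<alpha> = wt u - \<omega> j\<close> cancels against \<open>wt u\<close>; at
    \<open>w + unit_exp i\<close> the remaining exponent is positive by \<open>less\<close>.\<close>
  have lim: "((\<lambda>s. of_real (s powr (wt u - \<omega> j - wt v)) * peval (b v) (curve \<omega> s)) \<longlongrightarrow> (if v = u then c else 0)) (at_right 0)" for v
  proof -
    have ev: "\<forall>\<^sub>F s in at_right 0. of_real (s powr (wt u - \<omega> j - wt v)) * peval (b v) (curve \<omega> s)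
      = (\<Sum>i\<in>UNIV. if v = w + unit_exp i then of_real (h \<bullet> acol A i) * of_real (s powr (wt u - \<omega> j - wt v + \<omega> i)) else 0)"
      unfolding peb sum_distrib_left curve_def
      using eventually_at_right_less[of "0::real"]
      by eventually_elim (auto intro!: sum.cong simp: powr_add)
    have "((\<lambda>s. if v = w + unit_exp i then complex_of_real (h \<bullet> acol A i) * of_real (s powr (wt u - \<omega> j - wt v + \<omega> i)) else 0)
      \<longlongrightarrow> (if i = j \<and> v = u then c else 0)) (at_right 0)" for i
    proof -
      consider "v \<noteq> w + unit_exp i" | "v = w + unit_exp i" "i = j"
        | "v = w + unit_exp i" "i \<noteq> j" "h \<bullet> acol A i = 0" | "v = w + unit_exp i" "i \<noteq> j" "h \<bullet> acol A i \<noteq> 0" by blast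
      then show ?thesis
      proof cases
        case 2
        have "\<forall>\<^sub>F s in at_right 0. complex_of_real (h \<bullet> acol A j) * of_real (s powr 0) = c"
          using eventually_at_right_less[of "0::real"] by eventually_elim (simp add: c_def)
        then show ?thesis using 2 uw by (simp add: tendsto_eventually)
      next
        case 4
        have "((\<lambda>s. complex_of_real (h \<bullet> acol A i) * of_real (s powr (wt u - \<omega> j - wt v + \<omega> i))) \<longlongrightarrow> of_real (h \<bullet> acol A i) * of_real 0) (at_right 0)"
          by (intro tendsto_mult tendsto_const tendsto_of_real powr_tendsto_0_at_right)
            (use less[rule_format, OF 4(2,3)] 4(1) in simp)
        then show ?thesis using 4 by simp
      qed (use uw in auto)
    qed
    then have "((\<lambda>s. \<Sum>i\<in>UNIV. if v = w + unit_exp i then complex_of_real (h \<bullet> acol A i) * of_real (s powr (wt u - \<omega> j - wt v + \<omega> i)) else 0)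
      \<longlongrightarrow> (\<Sum>i\<in>UNIV. if i = j \<and> v = u then c else 0)) (at_right 0)"
      by (intro tendsto_sum)
    also have "(\<Sum>i\<in>UNIV. if i = j \<and> v = u then c else 0) = (if v = u then c else 0)"
      by (cases "v = u") simp_all
    finally show ?thesis
      using tendsto_cong[OF ev] by simp
  qed
  show ?thesis
    using J lim hj by (intro exI[of _ b] exI[of _ "wt u - \<omega> j"] exI[of _ c]) (simp add: c_def)
qed

text \<open>Scaling rows and columns by positive powers of \<open>s\<close> does not affect whether
  the kernel vanishes, and the scaled matrix is diagonally dominant near its diagonal limit.\<close>

lemma reducible_imp_generic_strict:
  fixes A :: "int ^ 'n::finite ^ 'd::finite"
  assumes hom: "\<And>u w. A_deg A u = A_deg A w \<Longrightarrow> mdeg u = mdeg w"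
    and red: "\<And>u. mdeg u = N \<Longrightarrow> reducible A \<omega> wt u"
  obtains D where "\<And>p u. peval D p \<noteq> 0 \<Longrightarrow> mdeg u = N \<Longrightarrow> mon u \<in> J_A A p"
    and "\<forall>\<^sub>F s in at_right 0. peval D (curve \<omega> s) \<noteq> 0"
proof -
  define X where "X = {u :: 'n \<Rightarrow>\<^sub>0 nat. mdeg u = N}"
  have X: "finite X" by (simp add: X_def finite_mdeg)
  define Q where "Q u b \<alpha> c \<longleftrightarrow> c \<noteq> 0 \<and> (\<forall>p. (\<Sum>w\<in>X. Poly_Mapping.single w (peval (b w) p)) \<in> J_A A p) \<and>
    (\<forall>w. ((\<lambda>s. of_real (s powr (\<alpha> - wt w)) * peval (b w) (curve \<omega> s)) \<longlongrightarrow> (if w = u then c else 0)) (at_right 0))"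
    for u b \<alpha> c
  have "\<forall>u\<in>X. \<exists>b \<alpha> c. Q u b \<alpha> c"
    unfolding Q_def using reducible_row[OF hom red] unfolding X_def by blast
  then obtain B \<alpha> c where Q: "\<And>u. u \<in> X \<Longrightarrow> Q u (B u) (\<alpha> u) (c u)"
    by metis
  have Bc: "\<And>u. u \<in> X \<Longrightarrow> c u \<noteq> 0"
    and BJ: "\<And>u p. u \<in> X \<Longrightarrow> (\<Sum>w\<in>X. Poly_Mapping.single w (peval (B u w) p)) \<in> J_A A p"
    and Blim: "\<And>u w. u \<in> X \<Longrightarrow> ((\<lambda>s. of_real (s powr (\<alpha> u - wt w)) * peval (B u w) (curve \<omega> s)) \<longlongrightarrow> (if w = u then c u else 0)) (at_right 0)"
    using Q unfolding Q_def by blast+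
  obtain D where D: "\<And>p w. peval D p \<noteq> 0 \<Longrightarrow> w \<in> X \<Longrightarrow> mon w \<in> J_A A p"
    and ker: "\<And>p. \<forall>x. (\<forall>u\<in>X. (\<Sum>w\<in>X. peval (B u w) p * x w) = 0) \<longrightarrow> (\<forall>w\<in>X. x w = 0) \<Longrightarrow> peval D p \<noteq> 0"
    using BJ generic_spanning[OF X, of B A] by blast
  define E where "E = (\<lambda>s u w. complex_of_real (s powr (\<alpha> u - wt w)) * peval (B u w) (curve \<omega> s))"
  have "\<forall>\<^sub>F s in at_right 0. \<forall>u\<in>X. \<forall>w\<in>X. norm (E s u w - (if w = u then c u else 0)) < norm (c u) / (card X + 1)"
  proof (intro eventually_ball_finite ballI X)
    fix u w assume "u \<in> X"
    then have "norm (c u) / (card X + 1) > 0" using Bc by simp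
    from tendstoD[OF Blim[OF \<open>u \<in> X\<close>, of w] this]
    show "\<forall>\<^sub>F s in at_right 0. norm (E s u w - (if w = u then c u else 0)) < norm (c u) / (card X + 1)"
      by (simp add: E_def dist_norm)
  qed
  then have "\<forall>\<^sub>F s in at_right 0. peval D (curve \<omega> s) \<noteq> 0"
    using eventually_at_right_less[of "0::real"]
  proof eventually_elim
    case (elim s)
    show ?case
    proof (intro ker allI impI ballI)
      fix x w assume x: "\<forall>u\<in>X. (\<Sum>w\<in>X. peval (B u w) (curve \<omega> s) * x w) = 0" and w: "w \<in> X"
      \<comment> \<open>The column scaling is moved into the unknowns.\<close>
      have "of_real (s powr wt w) * x w = 0"
      proof (rule diagonally_dominant_kernel[OF X _ _ w, of "E s" c])
        fix u w assume "u \<in> X" "w \<in> X"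
        then show "norm (E s u w - (if w = u then c u else 0)) * (card X + 1) < norm (c u)"
          using elim by (simp add: field_simps)
      next
        fix u assume u: "u \<in> X"
        have "(\<Sum>w\<in>X. E s u w * (of_real (s powr wt w) * x w))
           = of_real (s powr \<alpha> u) * (\<Sum>w\<in>X. peval (B u w) (curve \<omega> s) * x w)"
          unfolding sum_distrib_left E_def using elim(2) by (intro sum.cong refl) (simp add: powr_diff)
        then show "(\<Sum>w\<in>X. E s u w * (of_real (s powr wt w) * x w)) = 0" using x u by simp
      qed
      then show "x w = 0" using elim(2) by simp
    qed
  qed
  with D show ?thesis using that unfolding X_def by blast
qed

text \<open>Lexicographic weights: subtracting a small multiple of \<open>ms\<close> from \<open>wt\<close> makes all inequalities strict.\<close>

definition lex_reducible ::
  "int ^ 'n::finite ^ 'd::finite \<Rightarrow> ('n \<Rightarrow> real) \<Rightarrow> (('n \<Rightarrow>\<^sub>0 nat) \<Rightarrow> real) \<Rightarrow> (('n \<Rightarrow>\<^sub>0 nat) \<Rightarrow> nat) \<Rightarrow> ('n \<Rightarrow>\<^sub>0 nat) \<Rightarrow> bool" where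
  "lex_reducible A \<omega> wt ms u \<longleftrightarrow>
    (\<exists>w. A_deg A w = A_deg A u \<and> (wt w < wt u \<or> wt w = wt u \<and> ms u < ms w)) \<or>
    (\<exists>w j h. u = w + unit_exp j \<and> h \<bullet> acol A j \<noteq> 0 \<and>
      (\<forall>i. i \<noteq> j \<longrightarrow> h \<bullet> acol A i \<noteq> 0 \<longrightarrow> \<omega> j - wt u < \<omega> i - wt (w + unit_exp i) \<or>
         \<omega> j - wt u = \<omega> i - wt (w + unit_exp i) \<and> ms u < ms (w + unit_exp i)))"

lemma eventually_lex_pos:
  assumes "x > 0 \<or> x = 0 \<and> y > (0::real)"
  shows "\<forall>\<^sub>F e in at_right 0. x + e * y > (0::real)"
proof (cases "x > 0")
  case True
  have "((\<lambda>e. x + e * y) \<longlongrightarrow> x + 0 * y) (at_right 0)" by (intro tendsto_intros)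
  then show ?thesis using True order_tendstoD(1)[of _ x _ 0] by simp
next
  case False
  then show ?thesis using assms eventually_at_right_less[of "0::real"]
    by (auto elim: eventually_mono)
qed

text \<open>There are finitely many monomials and inequalities, so one small \<open>e\<close> serves
  them all. Only \<open>wt\<close> is perturbed: \<open>\<omega>\<close>, and with it the curve,
  stays the same, so that determinants for different weights can be compared.\<close>

lemma reducible_imp_generic:
  fixes A :: "int ^ 'n::finite ^ 'd::finite"
  assumes hom: "\<And>u w. A_deg A u = A_deg A w \<Longrightarrow> mdeg u = mdeg w"
    and red: "\<And>u. mdeg u = N \<Longrightarrow> lex_reducible A \<omega> wt ms u"
  shows "\<exists>D. (\<forall>p u. peval D p \<noteq> 0 \<longrightarrow> mdeg u = N \<longrightarrow> mon u \<in> J_A A p) \<and>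
    (\<forall>\<^sub>F s in at_right 0. peval D (curve \<omega> s) \<noteq> 0)"
proof -
  have ev: "\<forall>\<^sub>F e in at_right (0::real). reducible A \<omega> (\<lambda>u. wt u - e * real (ms u)) u" if "mdeg u = N" for u
    using red[OF that] unfolding lex_reducible_def
  proof (elim disjE[where P = "\<exists>w. A_deg A w = A_deg A u \<and> _ w"] exE conjE)
    fix w assume w: "A_deg A w = A_deg A u" "wt w < wt u \<or> wt w = wt u \<and> ms u < ms w"
    have "\<forall>\<^sub>F e in at_right 0. (wt u - wt w) + e * (real (ms w) - real (ms u)) > 0"
      by (rule eventually_lex_pos) (use w in auto)
    then show ?thesis
      by eventually_elim (unfold reducible_def, rule disjI1, rule exI[of _ w], use w in \<open>simp add: algebra_simps\<close>)
  next
    fix w j h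
    assume w: "u = w + unit_exp j" "h \<bullet> acol A j \<noteq> 0"
      "\<forall>i. i \<noteq> j \<longrightarrow> h \<bullet> acol A i \<noteq> 0 \<longrightarrow> \<omega> j - wt u < \<omega> i - wt (w + unit_exp i) \<or>
         \<omega> j - wt u = \<omega> i - wt (w + unit_exp i) \<and> ms u < ms (w + unit_exp i)"
    have "\<forall>\<^sub>F e in at_right 0. \<forall>i\<in>{i. i \<noteq> j \<and> h \<bullet> acol A i \<noteq> 0}.
      (\<omega> i - wt (w + unit_exp i) - (\<omega> j - wt u)) + e * (real (ms (w + unit_exp i)) - real (ms u)) > 0"
      by (intro eventually_ball_finite ballI eventually_lex_pos) (use w(3) in auto)
    then show ?thesis
    proof eventually_elim
      case (elim e)
      show ?case unfolding reducible_def
        by (rule disjI2, intro exI[of _ w] exI[of _ j] exI[of _ h]) (use w(1,2) elim in \<open>auto simp: algebra_simps\<close>)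
    qed
  qed
  have "\<forall>\<^sub>F e in at_right (0::real). \<forall>u\<in>{u. mdeg u = N}. reducible A \<omega> (\<lambda>u. wt u - e * real (ms u)) u"
    by (intro eventually_ball_finite ballI finite_mdeg) (simp add: ev)
  then obtain e where "\<And>u. mdeg u = N \<Longrightarrow> reducible A \<omega> (\<lambda>u. wt u - e * real (ms u)) u"
    using eventually_happens'[OF trivial_limit_at_right_real] by blast
  from reducible_imp_generic_strict[OF hom this] show ?thesis by metis
qed

section \<open>Integer relations and vanishing in large degrees\<close>

definition rvec :: "int ^ 'd \<Rightarrow> real ^ 'd" where
  "rvec c = (\<chi> r. real_of_int (c $ r))"

lemma rvec_inject: "rvec c = rvec c' \<longleftrightarrow> c = c'"
  by (simp add: rvec_def Finite_Cartesian_Product.vec_eq_iff)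

lemma rvec_matrix_vector: "rvec (A *v v) = (\<Sum>j\<in>UNIV. real_of_int (v $ j) *\<^sub>R acol A j)"
  by (simp add: rvec_def acol_def Finite_Cartesian_Product.vec_eq_iff matrix_vector_mult_def mult.commute)

lemma rvec_A_deg: "rvec (A_deg A u) = (\<Sum>j\<in>UNIV. real (Poly_Mapping.lookup u j) *\<^sub>R acol A j)"
  by (simp add: A_deg_def rvec_matrix_vector)

text \<open>The coefficients that express (1,...,1) through the rows are the coordinates of
  \<open>g\<close>; homogeneity places all columns on one affine hyperplane.\<close>

lemma grading_functional:
  fixes A :: "int ^ 'n::finite ^ 'd::finite"
  assumes "1 \<in> span (rows (\<chi> i j. real_of_int (A $ i $ j)))"
  obtains g where "\<And>i. g \<bullet> acol A i = 1"
proof -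
  have "\<exists>g. \<forall>i. (1 :: real ^ 'n) $ i = g \<bullet> acol A i"
    using assms
  proof (induction rule: span_induct)
    case base
    show ?case
    proof (rule subspaceI, goal_cases)
      case 1
      show ?case by (auto intro!: exI[of _ 0])
    next
      case (2 x y)
      then obtain g g' where "\<forall>i. x $ i = g \<bullet> acol A i" "\<forall>i. y $ i = g' \<bullet> acol A i" by blast
      then show ?case by (auto intro!: exI[of _ "g + g'"] simp: inner_add_left)
    next
      case (3 c x)
      then obtain g where "\<forall>i. x $ i = g \<bullet> acol A i" by blast
      then show ?case by (auto intro!: exI[of _ "c *\<^sub>R g"])
    qed
  next
    case (step x)
    then obtain r where x: "x = row r (\<chi> i j. real_of_int (A $ i $ j))"
      unfolding Finite_Cartesian_Product.rows_def by blast
    show ?case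
      by (intro exI[of _ "Finite_Cartesian_Product.axis r 1"]) (simp add: x Finite_Cartesian_Product.row_def inner_axis' acol_def)
  qed
  then show ?thesis using that by auto
qed

lemma graded_mdeg:
  assumes "\<And>i. g \<bullet> acol A i = 1"
  shows "g \<bullet> rvec (A_deg A u) = real (mdeg u)"
  by (simp add: rvec_A_deg inner_sum_right assms mdeg_def)

lemma graded_A_deg_eq:
  assumes "\<And>i. g \<bullet> acol A i = 1" "A_deg A u = A_deg A w"
  shows "mdeg u = mdeg w"
  using graded_mdeg[OF assms(1), of u] graded_mdeg[OF assms(1), of w] assms(2) by simp

text \<open>
  The lattice points \<open>k c - \<Sum>j. \<lfloor>k x j\<rfloor> a\<^sub>j\<close>, \<open>k \<in> \<nat>\<close>, stay in a bounded set, so two of them agree.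
\<close>

lemma integer_relation:
  fixes A :: "int ^ 'n::finite ^ 'd::finite"
  assumes c: "rvec c = (\<Sum>j\<in>UNIV. x j *\<^sub>R acol A j)"
  shows "\<exists>m y. m > 0 \<and> A *v (\<chi> j. y j) = int m *s c \<and>
    (\<forall>j. (x j = 0 \<longrightarrow> y j = 0) \<and> (x j \<ge> 0 \<longrightarrow> y j \<ge> 0) \<and> (x j \<ge> 1 \<longrightarrow> y j \<ge> 1))"
proof -
  define F where "F = (\<lambda>k::nat. \<chi> j. \<lfloor>real k * x j\<rfloor>)"
  define R where "R = (\<lambda>k. int k *s c - A *v F k)"
  define M where "M = (\<Sum>j\<in>UNIV. norm (acol A j))"
  have bound: "norm (rvec (R k)) \<le> M" for k
  proof -
    have "rvec (R k) = real k *\<^sub>R rvec c - rvec (A *v F k)"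
      by (simp add: R_def rvec_def Finite_Cartesian_Product.vec_eq_iff)
    also have "\<dots> = (\<Sum>j\<in>UNIV. (real k * x j - of_int \<lfloor>real k * x j\<rfloor>) *\<^sub>R acol A j)"
      by (simp add: c rvec_matrix_vector F_def scaleR_sum_right scaleR_diff_left sum_subtractf)
    also have "norm \<dots> \<le> (\<Sum>j\<in>UNIV. norm ((real k * x j - of_int \<lfloor>real k * x j\<rfloor>) *\<^sub>R acol A j))"
      by (rule norm_sum)
    also have "\<dots> \<le> M"
      unfolding M_def
    proof (rule sum_mono)
      fix j
      have "\<bar>real k * x j - of_int \<lfloor>real k * x j\<rfloor>\<bar> \<le> 1" by linarith
      then show "norm ((real k * x j - of_int \<lfloor>real k * x j\<rfloor>) *\<^sub>R acol A j) \<le> norm (acol A j)"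
        using mult_right_mono[OF _ norm_ge_zero, of _ 1 "acol A j"] by simp
    qed
    finally show ?thesis .
  qed
  define box where "box = {z :: int ^ 'd. \<forall>r. z $ r \<in> {- \<lceil>M\<rceil> .. \<lceil>M\<rceil>}}"
  have "R k \<in> box" for k
  proof -
    have "\<bar>real_of_int (R k $ r)\<bar> \<le> M" for r
      using component_le_norm_cart[of "rvec (R k)" r] bound[of k] by (simp add: rvec_def)
    then have "real_of_int \<bar>R k $ r\<bar> \<le> of_int \<lceil>M\<rceil>" for r
      using order_trans[OF _ le_of_int_ceiling, of _ M] by simp
    then show ?thesis unfolding box_def of_int_le_iff by (simp add: abs_le_iff minus_le_iff)
  qed
  then have "range R \<subseteq> box" by blast
  moreover have "finite box"
  proof -
    have "box \<subseteq> vec_lambda ` (Pi\<^sub>E UNIV (\<lambda>_. {- \<lceil>M\<rceil> .. \<lceil>M\<rceil>}))"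
    proof
      fix z assume "z \<in> box"
      then have "vec_nth z \<in> Pi\<^sub>E UNIV (\<lambda>_. {- \<lceil>M\<rceil> .. \<lceil>M\<rceil>})" by (simp add: box_def PiE_UNIV_domain)
      then show "z \<in> vec_lambda ` (Pi\<^sub>E UNIV (\<lambda>_. {- \<lceil>M\<rceil> .. \<lceil>M\<rceil>}))"
        by (rule rev_image_eqI) simp
    qed
    moreover have "finite (Pi\<^sub>E (UNIV :: 'd set) (\<lambda>_. {- \<lceil>M\<rceil> .. \<lceil>M\<rceil>}))"
      by (rule finite_PiE) simp_all
    ultimately show ?thesis using finite_subset finite_imageI by blast
  qed
  ultimately have "\<not> inj R" using finite_subset finite_imageD infinite_UNIV_nat by blast
  then obtain k k' where k: "k < k'" "R k = R k'"
    using linorder_injI[of R] by metis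
  \<comment> \<open>Since \<open>R k = R k'\<close>, these differences of floors map to a multiple
    of \<open>c\<close>. Floors are monotone, so signs survive; \<open>x j \<ge> 1\<close> forces an
    increase by at least 1, which guarantees that a relation obtained with \<open>c = 0\<close> is
    not trivial.\<close>
  define y where "y = (\<lambda>j. \<lfloor>real k' * x j\<rfloor> - \<lfloor>real k * x j\<rfloor>)"
  show ?thesis
  proof (intro exI[of _ "k' - k"] exI[of _ y] conjI allI impI)
    show "0 < k' - k" using k by simp
    have "A *v (\<chi> j. y j) = A *v F k' - A *v F k"
      by (simp add: y_def F_def Finite_Cartesian_Product.vec_eq_iff matrix_vector_mult_def right_diff_distrib sum_subtractf)
    also have "\<dots> = int k' *s c - int k *s c"
      using k(2) unfolding R_def by (simp add: algebra_simps)
    also have "\<dots> = int (k' - k) *s c"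
      using k(1) by (simp add: Finite_Cartesian_Product.vec_eq_iff algebra_simps of_nat_diff)
    finally show "A *v (\<chi> j. y j) = int (k' - k) *s c" .
  next
    fix j assume "x j = 0"
    then show "y j = 0" by (simp add: y_def)
  next
    fix j assume "x j \<ge> 0"
    then have "real k * x j \<le> real k' * x j" using k(1) by (intro mult_right_mono) simp_all
    then show "y j \<ge> 0" unfolding y_def using floor_mono by simp
  next
    fix j assume "x j \<ge> 1"
    then have "real k' * x j \<ge> real k * x j + 1"
      using mult_mono[of 1 "real k' - real k" 1 "x j"] k(1) by (simp add: algebra_simps)
    then show "y j \<ge> 1" unfolding y_def by linarith
  qed
qed

text \<open>Independence of the family, not of the set of its values: two equal columns in
  \<open>T\<close> count as dependent.\<close>

definition indep_cols :: "int ^ 'n ^ 'd::finite \<Rightarrow> 'n set \<Rightarrow> bool" where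
  "indep_cols A T \<longleftrightarrow> (\<forall>j\<in>T. acol A j \<notin> span (acol A ` (T - {j})))"

lemma span_image_sum:
  fixes f :: "'i \<Rightarrow> 'v::real_vector"
  assumes "finite T" "x \<in> span (f ` T)"
  obtains c where "x = (\<Sum>i\<in>T. c i *\<^sub>R f i)"
proof -
  have "\<exists>c. x = (\<Sum>i\<in>T. c i *\<^sub>R f i)"
    using assms(2)
  proof (induction rule: span_induct)
    case base
    show ?case
    proof (rule subspaceI, goal_cases)
      case 1
      show ?case by (auto intro!: exI[of _ "\<lambda>_. 0"])
    next
      case (2 x y)
      then obtain c c' where "x = (\<Sum>i\<in>T. c i *\<^sub>R f i)" "y = (\<Sum>i\<in>T. c' i *\<^sub>R f i)" by blast
      then show ?case by (auto intro!: exI[of _ "\<lambda>i. c i + c' i"] simp: scaleR_add_left sum.distrib)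
    next
      case (3 a x)
      then obtain c where "x = (\<Sum>i\<in>T. c i *\<^sub>R f i)" by blast
      then show ?case by (auto intro!: exI[of _ "\<lambda>i. a * c i"] simp: scaleR_sum_right)
    qed
  next
    case (step x)
    then obtain k where "k \<in> T" "x = f k" by blast
    moreover from this have "(\<Sum>i\<in>T. (if i = k then 1 else 0) *\<^sub>R f i) = f k"
      using assms(1) by (simp add: if_distrib[of "\<lambda>a. a *\<^sub>R _"] cong: if_cong)
    ultimately show ?case by metis
  qed
  then show ?thesis using that by blast
qed

text \<open>Take the component \<open>z\<close> of column \<open>j\<close> orthogonal to the span of
  the others, divided by its squared norm.\<close>

lemma dual_functional:
  assumes "indep_cols A T" "j \<in> T"
  obtains h where "h \<bullet> acol A j = 1" "\<And>i. i \<in> T \<Longrightarrow> i \<noteq> j \<Longrightarrow> h \<bullet> acol A i = 0"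
proof -
  obtain y z where y: "y \<in> span (acol A ` (T - {j}))"
    and z: "\<And>w. w \<in> span (acol A ` (T - {j})) \<Longrightarrow> orthogonal z w" and yz: "acol A j = y + z"
    using orthogonal_subspace_decomp_exists by blast
  have "z \<noteq> 0" using assms y yz by (auto simp: indep_cols_def)
  have "z \<bullet> y = 0" using z[OF y] by (simp add: Linear_Algebra.orthogonal_def)
  then have zj: "z \<bullet> acol A j = z \<bullet> z" by (simp add: yz inner_add_right)
  show ?thesis
  proof (rule that[of "(1 / (z \<bullet> z)) *\<^sub>R z"])
    show "((1 / (z \<bullet> z)) *\<^sub>R z) \<bullet> acol A j = 1" using \<open>z \<noteq> 0\<close> zj by simp
    fix i assume "i \<in> T" "i \<noteq> j"
    then have "acol A i \<in> span (acol A ` (T - {j}))" by (intro span_base) auto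
    then show "((1 / (z \<bullet> z)) *\<^sub>R z) \<bullet> acol A i = 0" using z by (simp add: Linear_Algebra.orthogonal_def)
  qed
qed

lemma dependent_cols_relation:
  fixes A :: "int ^ 'n::finite ^ 'd::finite"
  assumes "\<not> indep_cols A T"
  obtains v :: "int ^ 'n" where "v \<noteq> 0" "A *v v = 0" "\<And>j. j \<notin> T \<Longrightarrow> v $ j = 0"
proof -
  obtain j where j: "j \<in> T" "acol A j \<in> span (acol A ` (T - {j}))"
    using assms by (auto simp: indep_cols_def)
  obtain b where b: "acol A j = (\<Sum>i\<in>T - {j}. b i *\<^sub>R acol A i)"
    using span_image_sum[OF finite j(2)] by blast
  \<comment> \<open>The coefficient 1 at \<open>j\<close> makes the integer relation nonzero; the
    zeros outside \<open>T\<close> carry over to it.\<close>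
  define x where "x = (\<lambda>i. if i = j then 1 else if i \<in> T then - b i else 0)"
  have "(\<Sum>i\<in>UNIV. x i *\<^sub>R acol A i) = (\<Sum>i\<in>T. x i *\<^sub>R acol A i)"
    using j(1) by (intro sum.mono_neutral_right) (auto simp: x_def)
  also have "\<dots> = acol A j + (\<Sum>i\<in>T - {j}. x i *\<^sub>R acol A i)"
    using j(1) by (simp add: sum.remove x_def)
  also have "(\<Sum>i\<in>T - {j}. x i *\<^sub>R acol A i) = - (\<Sum>i\<in>T - {j}. b i *\<^sub>R acol A i)"
    unfolding sum_negf[symmetric] by (rule sum.cong) (auto simp: x_def)
  finally have "rvec 0 = (\<Sum>i\<in>UNIV. x i *\<^sub>R acol A i)"
    using b by (simp add: rvec_def Finite_Cartesian_Product.vec_eq_iff)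
  from integer_relation[OF this] obtain m y where y: "A *v (\<chi> j. y j) = int m *s 0"
    "\<forall>j. (x j = 0 \<longrightarrow> y j = 0) \<and> (x j \<ge> 0 \<longrightarrow> y j \<ge> 0) \<and> (x j \<ge> 1 \<longrightarrow> y j \<ge> 1)"
    by blast
  show ?thesis
  proof (rule that[of "\<chi> j. y j"])
    have "y j \<ge> 1" using y(2)[rule_format, of j] by (simp add: x_def)
    then show "(\<chi> j. y j) \<noteq> 0" by (auto simp: Finite_Cartesian_Product.vec_eq_iff intro!: exI[of _ j])
    show "A *v (\<chi> j. y j) = 0" using y(1) by simp
    show "(\<chi> j. y j) $ i = 0" if "i \<notin> T" for i
    proof -
      have "x i = 0" using that j(1) by (auto simp: x_def)
      then show ?thesis using y(2) by simp
    qed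
  qed
qed

text \<open>
  Let \<open>T = {i. u i \<ge> K}\<close>. If \<open>T\<close> is dependent, the relation \<open>V T\<close> lowers the weight of \<open>\<partial>\<^sup>u\<close>. If not, a linear
  form trades a factor \<open>\<partial>\<^sub>j\<close> with \<open>u j > K\<close> for factors \<open>\<partial>\<^sub>i\<close> with \<open>i \<notin> T\<close>, which raises \<open>\<Sum>i. min (u i) K\<close>.
\<close>

lemma vanishing_large_degree:
  fixes A :: "int ^ 'n::finite ^ 'd::finite"
  assumes graded: "\<And>i. g \<bullet> acol A i = 1"
    and V: "\<And>T. \<not> indep_cols A T \<Longrightarrow> A *v V T = 0"
      "\<And>T j. \<not> indep_cols A T \<Longrightarrow> j \<notin> T \<Longrightarrow> V T $ j = 0"
      "\<And>T. \<not> indep_cols A T \<Longrightarrow> (\<Sum>j\<in>UNIV. \<omega> j * of_int (V T $ j)) > 0"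
  shows "\<exists>N D. (\<forall>p u. peval D p \<noteq> 0 \<longrightarrow> mdeg u = N \<longrightarrow> mon u \<in> J_A A p) \<and>
    (\<forall>\<^sub>F s in at_right 0. peval D (curve \<omega> s) \<noteq> 0)"
proof -
  \<comment> \<open>\<open>K\<close> bounds every entry of every relation \<open>V T\<close>, so
    \<open>V T\<close> can be subtracted from any \<open>u\<close> whose entries on \<open>T\<close>
    are at least \<open>K\<close>.\<close>
  define K where "K = nat (\<Sum>T\<in>UNIV. \<Sum>j\<in>UNIV. \<bar>V T $ j\<bar>) + 1"
  have K: "\<bar>V T $ j\<bar> \<le> int K" for T j
  proof -
    have "\<bar>V T $ j\<bar> \<le> (\<Sum>j\<in>UNIV. \<bar>V T $ j\<bar>)" by (rule member_le_sum) auto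
    also have "\<dots> \<le> (\<Sum>T\<in>UNIV. \<Sum>j\<in>UNIV. \<bar>V T $ j\<bar>)"
      by (rule member_le_sum[of T UNIV "\<lambda>T. \<Sum>j\<in>UNIV. \<bar>V T $ j\<bar>"]) (auto intro: sum_nonneg)
    also have "\<dots> \<le> int K" by (simp add: K_def)
    finally show ?thesis .
  qed
  \<comment> \<open>By the pigeonhole principle some exponent exceeds \<open>K\<close>,
    strictly.\<close>
  define N where "N = CARD('n) * K + 1"
  \<comment> \<open>This weight is linear, so in an exchange by a linear form it cancels
    \<open>\<omega>\<close> exactly and leaves the decision to \<open>ms\<close>.\<close>
  define wt where "wt = (\<lambda>u :: 'n \<Rightarrow>\<^sub>0 nat. \<Sum>j\<in>UNIV. \<omega> j * real (Poly_Mapping.lookup u j))"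
  define ms where "ms = (\<lambda>u :: 'n \<Rightarrow>\<^sub>0 nat. \<Sum>j\<in>UNIV. min (Poly_Mapping.lookup u j) K)"
  have wt_unit: "wt (w + unit_exp i) = wt w + \<omega> i" for w i
  proof -
    have "wt (w + unit_exp i) = (\<Sum>j\<in>UNIV. \<omega> j * real (Poly_Mapping.lookup w j) + (if j = i then \<omega> i else 0))"
      unfolding wt_def by (intro sum.cong refl) (auto simp: lookup_add lookup_single distrib_left)
    then show ?thesis by (simp add: sum.distrib wt_def)
  qed
  have "lex_reducible A \<omega> wt ms u" if u: "mdeg u = N" for u
  proof -
    define T where "T = {i. Poly_Mapping.lookup u i \<ge> K}"
    show ?thesis
    proof (cases "indep_cols A T")
      case False
      define w where "w = Abs_poly_mapping (\<lambda>j. nat (int (Poly_Mapping.lookup u j) - V T $ j))"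
      have "V T $ j \<le> int (Poly_Mapping.lookup u j)" for j
        using K[of T j] V(2)[OF False, of j] by (cases "j \<in> T") (auto simp: T_def)
      then have w: "int (Poly_Mapping.lookup w j) = int (Poly_Mapping.lookup u j) - V T $ j" for j
        by (simp add: w_def)
      have "(\<chi> j. int (Poly_Mapping.lookup w j)) = (\<chi> j. int (Poly_Mapping.lookup u j)) - V T"
        by (simp add: w Finite_Cartesian_Product.vec_eq_iff)
      then have "A_deg A w = A_deg A u"
        using V(1)[OF False] by (simp add: A_deg_def matrix_vector_mult_diff_distrib)
      moreover have "wt w < wt u"
      proof -
        have "real (Poly_Mapping.lookup w j) = real (Poly_Mapping.lookup u j) - of_int (V T $ j)" for j
          using w[of j] by linarith
        then show ?thesis using V(3)[OF False]
          by (simp add: wt_def right_diff_distrib sum_subtractf)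
      qed
      ultimately show ?thesis unfolding lex_reducible_def
        by (intro disjI1 exI[of _ w] conjI)
    next
      case True
      have "\<exists>j. Poly_Mapping.lookup u j > K"
      proof (rule ccontr)
        assume "\<not> ?thesis"
        then have "Poly_Mapping.lookup u j \<le> K" for j by (simp add: not_less)
        then have "mdeg u \<le> CARD('n) * K"
          unfolding mdeg_def using sum_bounded_above[of UNIV "Poly_Mapping.lookup u" K] by simp
        then show False using u by (simp add: N_def)
      qed
      then obtain j where j: "Poly_Mapping.lookup u j > K" ..
      then have "j \<in> T" by (simp add: T_def)
      obtain h where h: "h \<bullet> acol A j = 1" "\<And>i. i \<in> T \<Longrightarrow> i \<noteq> j \<Longrightarrow> h \<bullet> acol A i = 0"
        using dual_functional[OF True \<open>j \<in> T\<close>] by blast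
      obtain w where w: "u = w + unit_exp j"
        using exp_split[of u j] j by auto
      have "\<omega> j - wt u = \<omega> i - wt (w + unit_exp i) \<and> ms u < ms (w + unit_exp i)"
        if i: "i \<noteq> j" "h \<bullet> acol A i \<noteq> 0" for i
      proof
        show "\<omega> j - wt u = \<omega> i - wt (w + unit_exp i)" unfolding w wt_unit by simp
        have "i \<notin> T" using h(2) i by blast
        then have "Poly_Mapping.lookup u i < K" by (simp add: T_def)
        then show "ms u < ms (w + unit_exp i)"
          unfolding ms_def
        proof (intro sum_strict_mono_ex1 ballI bexI[of _ i])
          fix k
          \<comment> \<open>Position \<open>j\<close> exceeded \<open>K\<close>, so losing one
            factor does not lower its capped exponent.\<close>
          have "Poly_Mapping.lookup u k \<le> Poly_Mapping.lookup (w + unit_exp i) k \<or>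
              K \<le> Poly_Mapping.lookup (w + unit_exp i) k"
            using j by (cases "k = j") (auto simp: w lookup_add lookup_single)
          then show "min (Poly_Mapping.lookup u k) K \<le> min (Poly_Mapping.lookup (w + unit_exp i) k) K"
            by linarith
        next
          assume "Poly_Mapping.lookup u i < K"
          then show "min (Poly_Mapping.lookup u i) K < min (Poly_Mapping.lookup (w + unit_exp i) i) K"
            using i(1) by (simp add: w lookup_add lookup_single)
        qed simp_all
      qed
      then show ?thesis
        unfolding lex_reducible_def using w h(1)
        by (intro disjI2 exI[of _ w] exI[of _ j] exI[of _ h] conjI) simp_all
    qed
  qed
  note red = this
  show ?thesis
    by (rule exI[of _ N], rule reducible_imp_generic[OF graded_A_deg_eq[OF graded] red])
qed

section \<open>Regular triangulations\<close>

text \<open>The cardinality makes the columns in \<sigma> a basis of the whole space, with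
  \<open>h j\<close> reading off the coordinate at \<open>j\<close>.\<close>

definition dual_basis :: "int ^ 'n::finite ^ 'd::finite \<Rightarrow> 'n set \<Rightarrow> ('n \<Rightarrow> real ^ 'd) \<Rightarrow> bool" where
  "dual_basis A \<sigma> h \<longleftrightarrow> card \<sigma> = CARD('d) \<and>
    (\<forall>j\<in>\<sigma>. \<forall>i\<in>\<sigma>. h j \<bullet> acol A i = (if i = j then 1 else 0))"

lemma dual_basis_nth: "dual_basis A \<sigma> h \<Longrightarrow> j \<in> \<sigma> \<Longrightarrow> i \<in> \<sigma> \<Longrightarrow> h j \<bullet> acol A i = (if i = j then 1 else 0)"
  unfolding dual_basis_def by blast

lemma inner_sum_dual_basis:
  assumes "dual_basis A \<sigma> h" "k \<in> \<sigma>"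
  shows "h k \<bullet> (\<Sum>j\<in>\<sigma>. x j *\<^sub>R acol A j) = x k"
proof -
  have "h k \<bullet> (\<Sum>j\<in>\<sigma>. x j *\<^sub>R acol A j) = (\<Sum>j\<in>\<sigma>. if j = k then x j else 0)"
    unfolding inner_sum_right by (rule sum.cong) (auto simp: dual_basis_nth[OF assms])
  also have "\<dots> = x k" using assms(2) by simp
  finally show ?thesis .
qed

text \<open>The functionals force the columns in \<sigma> to be distinct and independent, and as
  many independent vectors as the dimension span the space.\<close>

lemma dual_basis_expansion:
  assumes "dual_basis A \<sigma> h"
  shows "c = (\<Sum>j\<in>\<sigma>. (h j \<bullet> c) *\<^sub>R acol A j)"
proof -
  have inj: "inj_on (acol A) \<sigma>"
  proof (rule inj_onI)
    fix i k assume "i \<in> \<sigma>" "k \<in> \<sigma>" "acol A i = acol A k"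
    then have "h i \<bullet> acol A k = 1"
      using dual_basis_nth[OF assms, of i i] by simp
    then show "i = k"
      using dual_basis_nth[OF assms \<open>i \<in> \<sigma>\<close> \<open>k \<in> \<sigma>\<close>] by (cases "k = i") simp_all
  qed
  have "independent (acol A ` \<sigma>)"
    unfolding dependent_def
  proof (rule notI, elim bexE imageE)
    fix a j assume aj: "a \<in> span (acol A ` \<sigma> - {a})" "a = acol A j" "j \<in> \<sigma>"
    note j = aj(3) aj(1)[unfolded aj(2)]
    have "acol A ` \<sigma> - {acol A j} = acol A ` (\<sigma> - {j})"
      using inj_on_image_set_diff[OF inj, of \<sigma> "{j}"] j(1) by simp
    from span_image_sum[OF finite j(2)[unfolded this]]
    obtain b where "acol A j = (\<Sum>i\<in>\<sigma> - {j}. b i *\<^sub>R acol A i)"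
      by blast
    then have "h j \<bullet> acol A j = h j \<bullet> (\<Sum>i\<in>\<sigma> - {j}. b i *\<^sub>R acol A i)" by (rule arg_cong)
    also have "\<dots> = 0"
      unfolding inner_sum_right using dual_basis_nth[OF assms j(1)] by (intro sum.neutral) auto
    finally show False using dual_basis_nth[OF assms j(1) j(1)] by simp
  qed
  moreover have "card (acol A ` \<sigma>) = DIM(real ^ 'b)"
    using assms inj by (simp add: card_image dual_basis_def)
  ultimately have "UNIV \<subseteq> span (acol A ` \<sigma>)"
    by (intro card_ge_dim_independent) auto
  then have "c \<in> span (acol A ` \<sigma>)" by blast
  from span_image_sum[OF finite this]
  obtain x where c: "c = (\<Sum>j\<in>\<sigma>. x j *\<^sub>R acol A j)"
    by blast
  have "h j \<bullet> c = x j" if "j \<in> \<sigma>" for j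
    unfolding c by (rule inner_sum_dual_basis[OF assms that])
  then have "(\<Sum>j\<in>\<sigma>. (h j \<bullet> c) *\<^sub>R acol A j) = (\<Sum>j\<in>\<sigma>. x j *\<^sub>R acol A j)" by simp
  then show ?thesis using c by simp
qed

lemma dual_basis_inner:
  assumes "dual_basis A \<sigma> h"
  shows "\<psi> \<bullet> c = (\<Sum>j\<in>\<sigma>. (h j \<bullet> c) * (\<psi> \<bullet> acol A j))"
  by (subst dual_basis_expansion[OF assms, of c]) (simp add: inner_sum_right)

text \<open>A Gaussian pivot on the nonzero entry \<open>h j \<bullet> acol A i\<close>: the
  rescaled \<open>h j\<close> becomes the functional of \<open>i\<close> and clears column
  \<open>i\<close> from the others.\<close>

lemma dual_basis_exchange:
  assumes "dual_basis A \<sigma> h" "j \<in> \<sigma>" "i \<notin> \<sigma>" "h j \<bullet> acol A i \<noteq> 0"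
  shows "\<exists>h'. dual_basis A (insert i (\<sigma> - {j})) h'"
proof -
  define t where "t = h j \<bullet> acol A i"
  define h' where "h' = (\<lambda>k. if k = i then (1 / t) *\<^sub>R h j else h k - ((h k \<bullet> acol A i) / t) *\<^sub>R h j)"
  have "finite \<sigma>" by simp
  then have "card (insert i (\<sigma> - {j})) = CARD('b)"
    using assms by (simp add: card_insert_if card_Diff_singleton dual_basis_def card_gt_0_iff)
  moreover have "h' k \<bullet> acol A l = (if l = k then 1 else 0)"
    if "k \<in> insert i (\<sigma> - {j})" "l \<in> insert i (\<sigma> - {j})" for k l
  proof -
    have "i \<noteq> j" using assms(2,3) by blast
    have hj: "h j \<bullet> acol A l = 0" if "l \<noteq> i" "l \<in> insert i (\<sigma> - {j})" for l
      using dual_basis_nth[OF assms(1,2)] that by simp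
    show ?thesis
    proof (cases "k = i")
      case True
      then show ?thesis using hj[OF _ that(2)] assms(4) by (cases "l = i") (simp_all add: h'_def t_def)
    next
      case False
      then have k: "k \<in> \<sigma>" "k \<noteq> i" using that by auto
      show ?thesis
      proof (cases "l = i")
        case True
        then show ?thesis using k assms(4) by (simp add: h'_def t_def inner_diff_left)
      next
        case False
        then have "l \<in> \<sigma>" using that by auto
        then show ?thesis using k hj[OF False that(2)] dual_basis_nth[OF assms(1) k(1)]
          by (simp add: h'_def inner_diff_left)
      qed
    qed
  qed
  ultimately show ?thesis unfolding dual_basis_def by blast
qed

text \<open>Surjectivity over the integers puts the unit vectors into the real span of the columns,
  so a basis can be selected among the columns.\<close>

lemma dual_basis_exists:
  fixes A :: "int ^ 'n::finite ^ 'd::finite"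
  assumes "range ((*v) A) = UNIV"
  obtains \<sigma> h where "dual_basis A \<sigma> h"
proof -
  have "span (range (acol A)) = UNIV"
  proof -
    have "Finite_Cartesian_Product.axis r (1::real) \<in> span (range (acol A))" for r
    proof -
      obtain v where "A *v v = Finite_Cartesian_Product.axis r 1" using assms by (metis surjD)
      then have "rvec (Finite_Cartesian_Product.axis r 1) = (\<Sum>j\<in>UNIV. real_of_int (v $ j) *\<^sub>R acol A j)"
        by (metis rvec_matrix_vector)
      moreover have "rvec (Finite_Cartesian_Product.axis r 1 :: int ^ 'd) = Finite_Cartesian_Product.axis r 1"
        by (simp add: rvec_def Finite_Cartesian_Product.vec_eq_iff Finite_Cartesian_Product.axis_def)
      ultimately show ?thesis by (auto intro!: span_sum span_scale intro: span_base)
    qed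
    then have "Basis \<subseteq> span (range (acol A))" by (auto simp: Basis_vec_def)
    then have "span Basis \<subseteq> span (range (acol A))" by (rule span_minimal) simp
    then show ?thesis by auto
  qed
  then obtain B where B: "B \<subseteq> range (acol A)" "independent B" "UNIV \<subseteq> span B" "card B = dim (UNIV :: (real ^ 'd) set)"
    using basis_exists[of "range (acol A)"] by (metis dim_span span_mono span_span top.extremum_uniqueI)
  obtain \<sigma> where \<sigma>: "inj_on (acol A) \<sigma>" "B = acol A ` \<sigma>"
    using B(1) by (metis subset_image_inj)
  have card: "card \<sigma> = CARD('d)" using B(4) \<sigma> by (simp add: card_image)
  have "indep_cols A \<sigma>"
    unfolding indep_cols_def
  proof
    fix j assume "j \<in> \<sigma>"
    then have "B - {acol A j} = acol A ` (\<sigma> - {j})"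
      using \<sigma> by (auto simp: inj_on_def)
    then show "acol A j \<notin> span (acol A ` (\<sigma> - {j}))"
      using B(2) \<open>j \<in> \<sigma>\<close> \<sigma>(2) unfolding dependent_def by (metis image_eqI)
  qed
  then have "\<forall>j\<in>\<sigma>. \<exists>h. h \<bullet> acol A j = 1 \<and> (\<forall>i\<in>\<sigma>. i \<noteq> j \<longrightarrow> h \<bullet> acol A i = 0)"
    by (metis dual_functional)
  then obtain h where "\<forall>j\<in>\<sigma>. h j \<bullet> acol A j = 1 \<and> (\<forall>i\<in>\<sigma>. i \<noteq> j \<longrightarrow> h j \<bullet> acol A i = 0)"
    by metis
  then have "dual_basis A \<sigma> h" using card by (simp add: dual_basis_def)
  then show ?thesis by (rule that)
qed

text \<open>Maximal simplices of the triangulation induced by the heights \<open>\<omega>\<close>, with supporting functional \<open>\<psi>\<close>.\<close>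

definition cell :: "int ^ 'n::finite ^ 'd::finite \<Rightarrow> ('n \<Rightarrow> real) \<Rightarrow> 'n set \<Rightarrow> ('n \<Rightarrow> real ^ 'd) \<Rightarrow> real ^ 'd \<Rightarrow> bool" where
  "cell A \<omega> \<sigma> h \<psi> \<longleftrightarrow> dual_basis A \<sigma> h \<and> (\<forall>j\<in>\<sigma>. \<psi> \<bullet> acol A j = \<omega> j) \<and> (\<forall>i. i \<notin> \<sigma> \<longrightarrow> \<psi> \<bullet> acol A i < \<omega> i)"

text \<open>No functional interpolates \<omega> on a basis of columns and at one further column. The
  subdivision induced by \<omega> then has simplicial cells and pivots are never degenerate.\<close>

definition generic_heights :: "int ^ 'n::finite ^ 'd::finite \<Rightarrow> ('n \<Rightarrow> real) \<Rightarrow> bool" where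
  "generic_heights A \<omega> \<longleftrightarrow> (\<forall>\<sigma> h \<psi> i. dual_basis A \<sigma> h \<longrightarrow> (\<forall>j\<in>\<sigma>. \<psi> \<bullet> acol A j = \<omega> j) \<longrightarrow> i \<notin> \<sigma> \<longrightarrow>
     \<psi> \<bullet> acol A i \<noteq> \<omega> i)"

text \<open>A pivot step of the simplex method for maximising \<open>\<psi> \<bullet> c\<close> subject to \<open>\<psi> \<bullet> a\<^sub>i \<le> \<omega> i\<close>.\<close>

lemma pivot:
  assumes gen: "generic_heights A \<omega>" and cell: "cell A \<omega> \<sigma> h \<psi>"
    and c: "c = (\<Sum>i\<in>UNIV. u i *\<^sub>R acol A i)" "\<And>i. u i \<ge> 0"
    and j: "j \<in> \<sigma>" "h j \<bullet> c < 0"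
  shows "\<exists>\<sigma>' h' \<psi>'. cell A \<omega> \<sigma>' h' \<psi>' \<and> \<psi> \<bullet> c < \<psi>' \<bullet> c"
proof -
  have db: "dual_basis A \<sigma> h" and eq: "\<And>j. j \<in> \<sigma> \<Longrightarrow> \<psi> \<bullet> acol A j = \<omega> j"
    and lt: "\<And>i. i \<notin> \<sigma> \<Longrightarrow> \<psi> \<bullet> acol A i < \<omega> i"
    using cell unfolding cell_def by blast+
  define I where "I = {i. h j \<bullet> acol A i < 0}"
  \<comment> \<open>Here \<open>c\<close> must lie in the cone over the columns; without a blocking
    constraint the objective would be unbounded.\<close>
  have "I \<noteq> {}"
  proof
    assume "I = {}"
    then have "h j \<bullet> acol A i \<ge> 0" for i by (auto simp: I_def not_less)
    then have "h j \<bullet> c \<ge> 0" unfolding c(1) inner_sum_right using c(2) by (intro sum_nonneg) simp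
    with j(2) show False by simp
  qed
  have I\<sigma>: "i \<notin> \<sigma>" if "i \<in> I" for i
  proof
    assume "i \<in> \<sigma>"
    then have "h j \<bullet> acol A i \<ge> 0" using dual_basis_nth[OF db j(1)] by simp
    then show False using that by (simp add: I_def)
  qed
  \<comment> \<open>The ratio test: subtracting a multiple of \<open>h j\<close> from \<psi> keeps
    the equalities on the rest of \<sigma>, and constraint \<open>i\<close> becomes tight at the
    multiple \<open>t i\<close>.\<close>
  define t where "t = (\<lambda>i. (\<omega> i - \<psi> \<bullet> acol A i) / (- (h j \<bullet> acol A i)))"
  have "finite (t ` I)" "t ` I \<noteq> {}" using \<open>I \<noteq> {}\<close> by simp_all
  then have "Min (t ` I) \<in> t ` I" by (rule Min_in)
  then obtain i where i: "i \<in> I" "t i = Min (t ` I)" by auto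
  have t_min: "t i \<le> t k" if "k \<in> I" for k
    unfolding i(2) using that by (intro Min_le) simp_all
  have hi: "h j \<bullet> acol A i < 0" using i(1) by (simp add: I_def)
  have t_pos: "t i > 0"
    unfolding t_def using hi lt[OF I\<sigma>[OF i(1)]] by (intro divide_pos_pos) simp_all
  define \<psi>' where "\<psi>' = \<psi> - t i *\<^sub>R h j"
  define \<sigma>' where "\<sigma>' = insert i (\<sigma> - {j})"
  have \<psi>': "\<psi>' \<bullet> acol A k = \<psi> \<bullet> acol A k - t i * (h j \<bullet> acol A k)" for k
    by (simp add: \<psi>'_def inner_diff_left)
  obtain h' where h': "dual_basis A \<sigma>' h'"
    using dual_basis_exchange[OF db j(1) I\<sigma>[OF i(1)]] hi unfolding \<sigma>'_def by auto
  have eq': "\<psi>' \<bullet> acol A k = \<omega> k" if "k \<in> \<sigma>'" for k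
  proof (cases "k = i")
    case True
    have "t i * (- (h j \<bullet> acol A i)) = \<omega> i - \<psi> \<bullet> acol A i"
      unfolding t_def using hi by simp
    then show ?thesis using True by (simp add: \<psi>')
  next
    case False
    then have "k \<in> \<sigma>" "k \<noteq> j" using that by (auto simp: \<sigma>'_def)
    then show ?thesis using eq dual_basis_nth[OF db j(1), of k] by (simp add: \<psi>')
  qed
  have lt': "\<psi>' \<bullet> acol A k < \<omega> k" if k: "k \<notin> \<sigma>'" for k
  proof -
    have "\<psi>' \<bullet> acol A k \<le> \<omega> k"
    proof (cases "k \<in> \<sigma>")
      case True
      then have "k = j" using k by (auto simp: \<sigma>'_def)
      then show ?thesis using eq[OF j(1)] dual_basis_nth[OF db j(1) j(1)] t_pos by (simp add: \<psi>')
    next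
      case False
      show ?thesis
      proof (cases "k \<in> I")
        case True
        then have hk: "- (h j \<bullet> acol A k) > 0" by (simp add: I_def)
        have "t i * (- (h j \<bullet> acol A k)) \<le> t k * (- (h j \<bullet> acol A k))"
          using t_min[OF True] hk by (intro mult_right_mono) simp_all
        also have "\<dots> = \<omega> k - \<psi> \<bullet> acol A k" unfolding t_def using hk by simp
        finally show ?thesis by (simp add: \<psi>')
      next
        case kI: False
        then have "t i * (h j \<bullet> acol A k) \<ge> 0" using t_pos by (simp add: I_def)
        then show ?thesis using lt[OF False] by (simp add: \<psi>')
      qed
    qed
    \<comment> \<open>Genericity rules out a second constraint becoming tight at the same
      time.\<close>
    moreover have "\<psi>' \<bullet> acol A k \<noteq> \<omega> k"
      using gen h' eq' k unfolding generic_heights_def by blast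
    ultimately show ?thesis by simp
  qed
  have "\<psi>' \<bullet> c = \<psi> \<bullet> c - t i * (h j \<bullet> c)" by (simp add: \<psi>'_def inner_diff_left)
  then have "\<psi> \<bullet> c < \<psi>' \<bullet> c" using t_pos j(2) by (simp add: mult_pos_neg)
  moreover have "cell A \<omega> \<sigma>' h' \<psi>'" unfolding cell_def using h' eq' lt' by blast
  ultimately show ?thesis by blast
qed

text \<open>The semigroup NA, given as the range of \<open>A_deg A\<close>, contains every lattice
  point that has a positive multiple in it.\<close>

definition saturated :: "int ^ 'n::finite ^ 'd \<Rightarrow> bool" where
  "saturated A \<longleftrightarrow> (\<forall>c m w. m > 0 \<longrightarrow> A_deg A w = int m *s c \<longrightarrow> (\<exists>u. A_deg A u = c))"

section \<open>The convex height function and its cells\<close>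

locale triangulation =
  fixes A :: "int ^ 'n::finite ^ 'd::finite" and \<omega> :: "'n \<Rightarrow> real" and g :: "real ^ 'd"
  assumes graded: "\<And>i. g \<bullet> acol A i = 1"
    and generic: "generic_heights A \<omega>"
    and ex_cell: "\<exists>\<sigma> h \<psi>. cell A \<omega> \<sigma> h \<psi>"
begin

definition cells :: "'n set set" where
  "cells = {\<sigma>. \<exists>h \<psi>. cell A \<omega> \<sigma> h \<psi>}"

definition dual :: "'n set \<Rightarrow> 'n \<Rightarrow> real ^ 'd" where
  "dual \<sigma> = (SOME h. \<exists>\<psi>. cell A \<omega> \<sigma> h \<psi>)"

definition supp :: "'n set \<Rightarrow> real ^ 'd" where
  "supp \<sigma> = (SOME \<psi>. cell A \<omega> \<sigma> (dual \<sigma>) \<psi>)"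

lemma cell_supp:
  assumes "\<sigma> \<in> cells"
  shows "cell A \<omega> \<sigma> (dual \<sigma>) (supp \<sigma>)"
proof -
  have "\<exists>h \<psi>. cell A \<omega> \<sigma> h \<psi>" using assms by (simp add: cells_def)
  then have "\<exists>\<psi>. cell A \<omega> \<sigma> (dual \<sigma>) \<psi>" unfolding dual_def by (rule someI_ex)
  then show ?thesis unfolding supp_def by (rule someI_ex)
qed

lemma
  assumes "\<sigma> \<in> cells"
  shows dual_basis_dual: "dual_basis A \<sigma> (dual \<sigma>)"
    and supp_eq: "j \<in> \<sigma> \<Longrightarrow> supp \<sigma> \<bullet> acol A j = \<omega> j"
    and supp_less: "i \<notin> \<sigma> \<Longrightarrow> supp \<sigma> \<bullet> acol A i < \<omega> i"
  using cell_supp[OF assms] unfolding cell_def by blast+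

lemma supp_le: "\<sigma> \<in> cells \<Longrightarrow> supp \<sigma> \<bullet> acol A i \<le> \<omega> i"
  using supp_eq supp_less by (cases "i \<in> \<sigma>") (auto intro: less_imp_le)

lemma card_cell: "\<sigma> \<in> cells \<Longrightarrow> card \<sigma> = CARD('d)"
  using dual_basis_dual unfolding dual_basis_def by blast

text \<open>Values at the columns of a cell determine a functional, so the choices in
  \<open>dual\<close> and \<open>supp\<close> are immaterial.\<close>

lemma supp_unique:
  assumes "cell A \<omega> \<sigma> h \<psi>"
  shows "\<sigma> \<in> cells" "\<psi> \<bullet> c = supp \<sigma> \<bullet> c"
proof -
  show \<sigma>: "\<sigma> \<in> cells" using assms by (auto simp: cells_def)
  have "\<psi> \<bullet> acol A j = supp \<sigma> \<bullet> acol A j" if "j \<in> \<sigma>" for j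
    using assms that supp_eq[OF \<sigma> that] unfolding cell_def by simp
  then show "\<psi> \<bullet> c = supp \<sigma> \<bullet> c"
    using dual_basis_inner[OF dual_basis_dual[OF \<sigma>], of \<psi> c]
      dual_basis_inner[OF dual_basis_dual[OF \<sigma>], of "supp \<sigma>" c] by simp
qed

text \<open>Selecting the cell by maximality makes \<open>best\<close> total; that its cone contains
  \<open>c\<close> when \<open>c\<close> is in the cone over the columns is then
  \<open>coord_nonneg\<close>.\<close>

definition best :: "real ^ 'd \<Rightarrow> 'n set" where
  "best c = (SOME \<sigma>. \<sigma> \<in> cells \<and> (\<forall>\<tau>\<in>cells. supp \<tau> \<bullet> c \<le> supp \<sigma> \<bullet> c))"

lemma best: "best c \<in> cells" "\<tau> \<in> cells \<Longrightarrow> supp \<tau> \<bullet> c \<le> supp (best c) \<bullet> c"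
proof -
  have "finite ((\<lambda>\<tau>. supp \<tau> \<bullet> c) ` cells)" "(\<lambda>\<tau>. supp \<tau> \<bullet> c) ` cells \<noteq> {}"
    using ex_cell by (auto simp: cells_def)
  then have "Max ((\<lambda>\<tau>. supp \<tau> \<bullet> c) ` cells) \<in> (\<lambda>\<tau>. supp \<tau> \<bullet> c) ` cells" by (rule Max_in)
  then obtain \<sigma> where \<sigma>: "\<sigma> \<in> cells" "supp \<sigma> \<bullet> c = Max ((\<lambda>\<tau>. supp \<tau> \<bullet> c) ` cells)" by auto
  have "\<exists>\<sigma>. \<sigma> \<in> cells \<and> (\<forall>\<tau>\<in>cells. supp \<tau> \<bullet> c \<le> supp \<sigma> \<bullet> c)"
  proof (intro exI[of _ \<sigma>] conjI ballI)
    fix \<tau> assume "\<tau> \<in> cells"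
    then show "supp \<tau> \<bullet> c \<le> supp \<sigma> \<bullet> c" unfolding \<sigma>(2) by (intro Max_ge) simp_all
  qed (rule \<sigma>(1))
  then have *: "best c \<in> cells \<and> (\<forall>\<tau>\<in>cells. supp \<tau> \<bullet> c \<le> supp (best c) \<bullet> c)"
    unfolding best_def by (rule someI_ex)
  show "best c \<in> cells" using * by blast
  show "\<tau> \<in> cells \<Longrightarrow> supp \<tau> \<bullet> c \<le> supp (best c) \<bullet> c" using * by blast
qed

text \<open>A maximum of finitely many linear functions, hence convex and linear on the cone over
  each cell.\<close>

definition height :: "real ^ 'd \<Rightarrow> real" where
  "height c = supp (best c) \<bullet> c"

definition coord :: "real ^ 'd \<Rightarrow> 'n \<Rightarrow> real" where
  "coord c j = dual (best c) j \<bullet> c"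

text \<open>For \<open>c\<close> in the cone, the vertices of the smallest face of the triangulation
  whose cone contains \<open>c\<close>.\<close>

definition face :: "real ^ 'd \<Rightarrow> 'n set" where
  "face c = {j \<in> best c. coord c j \<noteq> 0}"

text \<open>A negative coordinate would permit a pivot to a cell whose functional is larger at
  \<open>c\<close>, contradicting maximality.\<close>

lemma coord_nonneg:
  assumes "c = (\<Sum>i\<in>UNIV. u i *\<^sub>R acol A i)" "\<And>i. u i \<ge> 0" "j \<in> best c"
  shows "coord c j \<ge> 0"
proof (rule ccontr)
  assume "\<not> ?thesis"
  then have "dual (best c) j \<bullet> c < 0" by (simp add: coord_def)
  with pivot[OF generic cell_supp[OF best(1)] assms(1,2,3)]
  obtain \<sigma>' h' \<psi>' where *: "cell A \<omega> \<sigma>' h' \<psi>'" "supp (best c) \<bullet> c < \<psi>' \<bullet> c" by blast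
  then show False using best(2)[OF supp_unique(1)[OF *(1)], of c] supp_unique(2)[OF *(1), of c] by simp
qed

lemma coord_expansion: "c = (\<Sum>j\<in>best c. coord c j *\<^sub>R acol A j)"
  unfolding coord_def by (rule dual_basis_expansion[OF dual_basis_dual[OF best(1)]])

lemma sum_coord: "(\<Sum>j\<in>best c. coord c j) = g \<bullet> c"
  using dual_basis_inner[OF dual_basis_dual[OF best(1)], of g c c] by (simp add: graded coord_def)

lemma height_sum: "height c = (\<Sum>j\<in>best c. coord c j * \<omega> j)"
  unfolding height_def dual_basis_inner[OF dual_basis_dual[OF best(1)], of "supp (best c)" c c] coord_def
  by (intro sum.cong refl) (simp add: supp_eq[OF best(1)])

text \<open>\<open>F\<close> is the support of \<open>c - acol A j\<close>. Convexity gives an upper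
  bound for the height of the sum of \<open>c - acol A j\<close> and \<open>acol A i\<close>; it is
  attained only if \<open>F\<close> and \<open>i\<close> fit into one cell, and then the coordinates
  simply add.\<close>

lemma exchange_step:
  assumes c: "c = (\<Sum>k\<in>UNIV. u k *\<^sub>R acol A k)" "\<And>k. u k \<ge> 0"
    and j: "j \<in> best c" "coord c j \<ge> 1"
    and i: "i \<noteq> j" "dual (best c) j \<bullet> acol A i \<noteq> 0"
    and c'': "c'' = c - acol A j + acol A i"
    and F: "F = {k \<in> best c. (if k = j then coord c k - 1 else coord c k) \<noteq> 0}"
  shows "i \<notin> best c"
    and "height c'' < height c - \<omega> j + \<omega> i \<or>
      height c'' = height c - \<omega> j + \<omega> i \<and> insert i F \<subseteq> best c'' \<and> face c'' = insert i F"
proof -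
  let ?\<sigma> = "best c" and ?\<rho> = "best c''"
  note db = dual_basis_dual[OF best(1)]
  show i\<sigma>: "i \<notin> ?\<sigma>"
    using dual_basis_nth[OF db j(1), of i] i by auto
  define x where "x = (\<lambda>k. if k = j then coord c k - 1 else coord c k)"
  have x: "x k \<ge> 0" if "k \<in> ?\<sigma>" for k
    using that j coord_nonneg[OF c that] by (simp add: x_def)
  have F': "F = {k \<in> ?\<sigma>. x k \<noteq> 0}" by (simp add: F x_def)
  have exp: "c - acol A j = (\<Sum>k\<in>?\<sigma>. x k *\<^sub>R acol A k)"
  proof -
    have "(\<Sum>k\<in>?\<sigma>. x k *\<^sub>R acol A k) = (\<Sum>k\<in>?\<sigma>. coord c k *\<^sub>R acol A k - (if k = j then acol A k else 0))"
      by (rule sum.cong) (simp_all add: x_def scaleR_diff_left)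
    also have "\<dots> = c - acol A j"
      using j(1) coord_expansion[of c] by (simp add: sum_subtractf)
    finally show ?thesis by simp
  qed
  have h1: "height c - \<omega> j = (\<Sum>k\<in>?\<sigma>. x k * \<omega> k)"
  proof -
    have "(\<Sum>k\<in>?\<sigma>. x k * \<omega> k) = (\<Sum>k\<in>?\<sigma>. coord c k * \<omega> k - (if k = j then \<omega> k else 0))"
      by (rule sum.cong) (simp_all add: x_def left_diff_distrib)
    also have "\<dots> = height c - \<omega> j"
      using j(1) height_sum[of c] by (simp add: sum_subtractf)
    finally show ?thesis by simp
  qed
  have h2: "height c'' = (\<Sum>k\<in>?\<sigma>. x k * (supp ?\<rho> \<bullet> acol A k)) + supp ?\<rho> \<bullet> acol A i"
    unfolding height_def c'' exp by (simp add: inner_add_right inner_sum_right)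
  have le: "x k * (supp ?\<rho> \<bullet> acol A k) \<le> x k * \<omega> k" if "k \<in> ?\<sigma>" for k
    using x[OF that] supp_le[OF best(1)] by (intro mult_left_mono)
  have h3: "(\<Sum>k\<in>?\<sigma>. x k * (supp ?\<rho> \<bullet> acol A k)) \<le> height c - \<omega> j"
    unfolding h1 by (rule sum_mono) (rule le)
  show "height c'' < height c - \<omega> j + \<omega> i \<or>
      height c'' = height c - \<omega> j + \<omega> i \<and> insert i F \<subseteq> best c'' \<and> face c'' = insert i F"
  proof (cases "insert i F \<subseteq> ?\<rho>")
    case False
    then consider "i \<notin> ?\<rho>" | k where "k \<in> F" "k \<notin> ?\<rho>" by blast
    then have "height c'' < height c - \<omega> j + \<omega> i"
    proof cases
      case 1
      then show ?thesis using h2 h3 supp_less[OF best(1) 1] by simp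
    next
      case 2
      then have k: "k \<in> ?\<sigma>" "x k > 0" using x[of k] by (auto simp: F')
      have "(\<Sum>k\<in>?\<sigma>. x k * (supp ?\<rho> \<bullet> acol A k)) < height c - \<omega> j"
        unfolding h1
      proof (rule sum_strict_mono_ex1)
        show "\<exists>k\<in>?\<sigma>. x k * (supp ?\<rho> \<bullet> acol A k) < x k * \<omega> k"
          using k supp_less[OF best(1) 2(2)] by (intro bexI[of _ k]) simp_all
      qed (use le in simp_all)
      then show ?thesis using h2 supp_le[OF best(1), of c'' i] by simp
    qed
    then show ?thesis ..
  next
    case True
    have eq: "supp ?\<rho> \<bullet> acol A i = \<omega> i" using True supp_eq[OF best(1)] by blast
    have "(\<Sum>k\<in>?\<sigma>. x k * (supp ?\<rho> \<bullet> acol A k)) = (\<Sum>k\<in>?\<sigma>. x k * \<omega> k)"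
    proof (rule sum.cong[OF refl])
      fix k assume "k \<in> ?\<sigma>"
      then have "x k = 0 \<or> k \<in> ?\<rho>" using True by (auto simp: F')
      then show "x k * (supp ?\<rho> \<bullet> acol A k) = x k * \<omega> k" using supp_eq[OF best(1)] by auto
    qed
    then have ht: "height c'' = height c - \<omega> j + \<omega> i" using h1 h2 eq by simp
    \<comment> \<open>The coordinates of \<open>c''\<close> in its own cell: those of
      \<open>c - acol A j\<close> on \<open>F\<close>, and 1 at the new vertex.\<close>
    define z where "z = (\<lambda>k. if k = i then 1 else if k \<in> F then x k else 0)"
    have "i \<notin> F" using i\<sigma> by (simp add: F')
    have "(\<Sum>k\<in>?\<rho>. z k *\<^sub>R acol A k) = (\<Sum>k\<in>insert i F. z k *\<^sub>R acol A k)"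
      using True by (intro sum.mono_neutral_right) (auto simp: z_def)
    also have "\<dots> = acol A i + (\<Sum>k\<in>F. x k *\<^sub>R acol A k)"
    proof -
      have "(\<Sum>k\<in>F. z k *\<^sub>R acol A k) = (\<Sum>k\<in>F. x k *\<^sub>R acol A k)"
        using \<open>i \<notin> F\<close> by (intro sum.cong refl) (auto simp: z_def)
      then show ?thesis using \<open>i \<notin> F\<close> by (simp add: z_def)
    qed
    also have "(\<Sum>k\<in>F. x k *\<^sub>R acol A k) = (\<Sum>k\<in>?\<sigma>. x k *\<^sub>R acol A k)"
      by (rule sum.mono_neutral_left) (auto simp: F')
    finally have "c'' = (\<Sum>k\<in>?\<rho>. z k *\<^sub>R acol A k)" by (simp add: c'' exp)
    then have "coord c'' k = z k" if "k \<in> ?\<rho>" for k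
      unfolding coord_def using inner_sum_dual_basis[OF dual_basis_dual[OF best(1)] that] by metis
    then have "face c'' = insert i F"
      unfolding face_def using True by (auto simp: z_def F' split: if_splits)
    then show ?thesis using ht True by blast
  qed
qed

text \<open>\<open>supp \<sigma> \<bullet> (- g)\<close> is the slope of the height on \<sigma> in
  direction \<open>- g\<close>; by convexity it grows along the ray. Counting the cells of smaller
  slope turns it into a natural number.\<close>

definition rank :: "'n set \<Rightarrow> nat" where
  "rank \<sigma> = card {\<tau> \<in> cells. supp \<tau> \<bullet> (- g) < supp \<sigma> \<bullet> (- g)}"

lemma rank_le: "rank \<sigma> \<le> card cells"
  unfolding rank_def by (rule card_mono) auto

lemma rank_less:
  assumes "\<sigma> \<in> cells" "supp \<sigma> \<bullet> (- g) < supp \<rho> \<bullet> (- g)"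
  shows "rank \<sigma> < rank \<rho>"
  unfolding rank_def by (rule psubset_card_mono) (use assms in auto)

text \<open>Encodes the lexicographic pair of face size and rank; the factor exceeds every
  rank.\<close>

definition level :: "real ^ 'd \<Rightarrow> nat" where
  "level c = card (face c) * (card cells + 1) + rank (best c)"

lemma level_less_card:
  assumes "card (face c) < card (face c')"
  shows "level c < level c'"
proof -
  have "level c < (card (face c) + 1) * (card cells + 1)"
    unfolding level_def using rank_le[of "best c"] by (simp add: algebra_simps)
  also have "\<dots> \<le> card (face c') * (card cells + 1)"
    using assms by (intro mult_le_mono1) simp
  also have "\<dots> \<le> level c'" by (simp add: level_def)
  finally show ?thesis .
qed

text \<open>
  If some coordinate of \<open>c\<close> exceeds 1, subtracting \<open>a\<^sub>j\<close> keeps the face, and adding \<open>a\<^sub>i\<close> enlarges it.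
  Otherwise \<open>c\<close> is the sum of the vertices of a cell; then \<open>j\<close> is chosen by the ray in direction
  \<open>- g\<close>, which leaves the cone, so that flipping to an adjacent cell moves forward along that ray.
\<close>

lemma ex_decreasing_exchange:
  assumes c: "c = (\<Sum>k\<in>UNIV. u k *\<^sub>R acol A k)" "\<And>k. u k \<ge> 0"
    and deg: "g \<bullet> c = real (CARD('d))"
  shows "\<exists>j\<in>best c. coord c j \<ge> 1 \<and> (\<forall>i. i \<noteq> j \<longrightarrow> dual (best c) j \<bullet> acol A i \<noteq> 0 \<longrightarrow>
    height (c - acol A j + acol A i) < height c - \<omega> j + \<omega> i \<or>
    height (c - acol A j + acol A i) = height c - \<omega> j + \<omega> i \<and> level c < level (c - acol A j + acol A i))"
proof (cases "\<exists>j\<in>best c. coord c j > 1")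
  case True
  then obtain j where j: "j \<in> best c" "coord c j > 1" by blast
  show ?thesis
  proof (intro bexI[of _ j] conjI allI impI)
    fix i assume i: "i \<noteq> j" "dual (best c) j \<bullet> acol A i \<noteq> 0"
    define F where "F = {k \<in> best c. (if k = j then coord c k - 1 else coord c k) \<noteq> 0}"
    have "F = face c" using j(2) by (auto simp: F_def face_def)
    note step = exchange_step[OF c j(1) less_imp_le[OF j(2)] i refl F_def]
    have "i \<notin> F" using step(1) by (simp add: F_def)
    then have "card (insert i F) = card (face c) + 1" by (simp add: \<open>F = face c\<close>)
    then show "height (c - acol A j + acol A i) < height c - \<omega> j + \<omega> i \<or>
      height (c - acol A j + acol A i) = height c - \<omega> j + \<omega> i \<and> level c < level (c - acol A j + acol A i)"
      using step(2) level_less_card[of c "c - acol A j + acol A i"] by auto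
  qed (use j in simp_all)
next
  case False
  let ?\<sigma> = "best c"
  have le1: "coord c k \<le> 1" if "k \<in> ?\<sigma>" for k using False that by (auto simp: not_less)
  \<comment> \<open>The only use of degree d: as many coordinates as the degree, none above 1, and
    with sum equal to the degree.\<close>
  have "(\<Sum>k\<in>?\<sigma>. 1 - coord c k) = 0"
    using sum_coord[of c] deg card_cell[OF best(1), of c] by (simp add: sum_subtractf)
  then have one: "coord c k = 1" if "k \<in> ?\<sigma>" for k
    using le1 that sum_nonneg_eq_0_iff[of ?\<sigma> "\<lambda>k. 1 - coord c k"] by simp
  note db = dual_basis_dual[OF best(1), of c]
  \<comment> \<open>On the cell, \<open>g\<close> is the sum of the dual functionals, because it
    takes the value 1 at every column; so one of them is negative at \<open>- g\<close>.\<close>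
  have "g \<bullet> (- g) < 0"
    using graded by (cases "g = 0") simp_all
  moreover have "g \<bullet> (- g) = (\<Sum>k\<in>?\<sigma>. dual ?\<sigma> k \<bullet> (- g))"
    using dual_basis_inner[OF db, of g "- g"] by (simp add: graded)
  ultimately have "(\<Sum>k\<in>?\<sigma>. dual ?\<sigma> k \<bullet> (- g)) < 0" by (simp only:)
  then have "\<not> (\<forall>k\<in>?\<sigma>. dual ?\<sigma> k \<bullet> (- g) \<ge> 0)"
    using sum_nonneg by (metis (mono_tags, lifting) not_less)
  then obtain j where j: "j \<in> ?\<sigma>" "dual ?\<sigma> j \<bullet> (- g) < 0"
    using not_less by blast
  show ?thesis
  proof (intro bexI[of _ j] conjI allI impI)
    show "1 \<le> coord c j" using one[OF j(1)] by simp
    fix i assume i: "i \<noteq> j" "dual ?\<sigma> j \<bullet> acol A i \<noteq> 0"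
    define F where "F = {k \<in> best c. (if k = j then coord c k - 1 else coord c k) \<noteq> 0}"
    define c'' where "c'' = c - acol A j + acol A i"
    have F: "F = ?\<sigma> - {j}" using one by (auto simp: F_def)
    note step = exchange_step[OF c j(1) \<open>1 \<le> coord c j\<close> i c''_def F_def]
    have "level c < level c''" if eq: "insert i F \<subseteq> best c''" "face c'' = insert i F"
    proof -
      have "card (insert i F) = Suc (card (?\<sigma> - {j}))"
        unfolding F using step(1) by (intro card_insert_disjoint) simp_all
      also have "\<dots> = card ?\<sigma>"
        by (rule card_Suc_Diff1[OF finite j(1)])
      finally have "card (insert i F) = card ?\<sigma>" .
      moreover have "face c = ?\<sigma>" using one by (auto simp: face_def)
      ultimately have card_eq: "card (face c'') = card (face c)" by (simp only: eq(2))
      have "insert i F = best c''"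
        using eq(1) \<open>card (insert i F) = card ?\<sigma>\<close> card_cell[OF best(1)] by (intro card_subset_eq) simp_all
      then have \<rho>: "best c'' = insert i (?\<sigma> - {j})" using F by simp
      have "j \<notin> best c''" using i(1) \<rho> by simp
      \<comment> \<open>The two cells share all vertices of the old one except \<open>j\<close>, so
        the difference of their functionals is a multiple of \<open>dual ?\<sigma> j\<close>; the
        product of two negative numbers remains.\<close>
      have "(supp (best c'') - supp ?\<sigma>) \<bullet> (- g)
          = (\<Sum>k\<in>?\<sigma>. (dual ?\<sigma> k \<bullet> (- g)) * ((supp (best c'') - supp ?\<sigma>) \<bullet> acol A k))"
        by (rule dual_basis_inner[OF db])
      also have "\<dots> = (\<Sum>k\<in>?\<sigma>. if k = j then (dual ?\<sigma> j \<bullet> (- g)) * (supp (best c'') \<bullet> acol A j - \<omega> j) else 0)"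
      proof (rule sum.cong[OF refl])
        fix k assume k: "k \<in> ?\<sigma>"
        have "supp ?\<sigma> \<bullet> acol A k = \<omega> k" using supp_eq[OF best(1) k] .
        moreover have "supp (best c'') \<bullet> acol A k = \<omega> k" if "k \<noteq> j"
          using supp_eq[OF best(1), of k c''] k that by (simp add: \<rho>)
        ultimately show "(dual ?\<sigma> k \<bullet> (- g)) * ((supp (best c'') - supp ?\<sigma>) \<bullet> acol A k) =
          (if k = j then (dual ?\<sigma> j \<bullet> (- g)) * (supp (best c'') \<bullet> acol A j - \<omega> j) else 0)"
          by (cases "k = j") (simp_all add: inner_diff_left)
      qed
      also have "\<dots> = (dual ?\<sigma> j \<bullet> (- g)) * (supp (best c'') \<bullet> acol A j - \<omega> j)"
        using j(1) by simp
      also have "\<dots> > 0"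
        using supp_less[OF best(1) \<open>j \<notin> best c''\<close>] j(2) by (intro mult_neg_neg) simp_all
      finally have "supp ?\<sigma> \<bullet> (- g) < supp (best c'') \<bullet> (- g)" by (simp add: inner_diff_left)
      then have "rank ?\<sigma> < rank (best c'')" by (rule rank_less[OF best(1)])
      then show ?thesis by (simp add: level_def card_eq)
    qed
    then show "height (c - acol A j + acol A i) < height c - \<omega> j + \<omega> i \<or>
      height (c - acol A j + acol A i) = height c - \<omega> j + \<omega> i \<and> level c < level (c - acol A j + acol A i)"
      using step(2) unfolding c''_def[symmetric] by blast
  qed (rule j(1))
qed

text \<open>In every degree class one monomial divisible by the chosen \<partial>_j serves as
  representative. The other monomials of the class reduce to it by a binomial, and the
  representative itself by the linear form of \<open>dual (best c) j\<close>.\<close>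

lemma vanishing_degree_dim:
  assumes sat: "saturated A"
  shows "\<exists>D. (\<forall>p u. peval D p \<noteq> 0 \<longrightarrow> mdeg u = CARD('d) \<longrightarrow> mon u \<in> J_A A p) \<and>
    (\<forall>\<^sub>F s in at_right 0. peval D (curve \<omega> s) \<noteq> 0)"
proof -
  define good where "good = (\<lambda>c w j. rvec (A_deg A (w + unit_exp j)) = c \<and>
    j \<in> best c \<and> (\<forall>i. i \<noteq> j \<longrightarrow> dual (best c) j \<bullet> acol A i \<noteq> 0 \<longrightarrow>
      height (c - acol A j + acol A i) < height c - \<omega> j + \<omega> i \<or>
      height (c - acol A j + acol A i) = height c - \<omega> j + \<omega> i \<and> level c < level (c - acol A j + acol A i)))"
  have rvec_unit: "rvec (A_deg A (w + unit_exp j)) = rvec (A_deg A w) + acol A j" for w j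
  proof -
    have "rvec (A_deg A (unit_exp j)) = (\<Sum>k\<in>UNIV. if k = j then acol A k else 0)"
      unfolding rvec_A_deg by (intro sum.cong refl) (simp add: lookup_single when_def)
    then have "rvec (A_deg A (unit_exp j)) = acol A j" by simp
    then show ?thesis by (simp add: A_deg_add rvec_def Finite_Cartesian_Product.vec_eq_iff)
  qed
  have ex: "\<exists>w j. good (rvec (A_deg A u)) w j" if u: "mdeg u = CARD('d)" for u
  proof -
    define c where "c = rvec (A_deg A u)"
    have c: "c = (\<Sum>k\<in>UNIV. real (Poly_Mapping.lookup u k) *\<^sub>R acol A k)"
      unfolding c_def by (rule rvec_A_deg)
    have "g \<bullet> c = real (CARD('d))" unfolding c_def graded_mdeg[OF graded] u ..
    from ex_decreasing_exchange[OF c _ this] obtain j where j: "j \<in> best c" "coord c j \<ge> 1"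
      and less: "\<forall>i. i \<noteq> j \<longrightarrow> dual (best c) j \<bullet> acol A i \<noteq> 0 \<longrightarrow>
        height (c - acol A j + acol A i) < height c - \<omega> j + \<omega> i \<or>
        height (c - acol A j + acol A i) = height c - \<omega> j + \<omega> i \<and> level c < level (c - acol A j + acol A i)"
      by auto
    \<comment> \<open>Nonnegative coordinates of c - a_j, using \<open>coord c j \<ge> 1\<close>:
      this point stays in the cone.\<close>
    define x where "x = (\<lambda>k. if k \<in> best c then (if k = j then coord c k - 1 else coord c k) else 0)"
    have x: "x k \<ge> 0" for k
      using j coord_nonneg[OF c, of k] by (simp add: x_def)
    define c' where "c' = A_deg A u - (\<chi> r. A $ r $ j)"
    have rc': "rvec c' = c - acol A j"
      by (simp add: c'_def c_def rvec_def acol_def Finite_Cartesian_Product.vec_eq_iff)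
    have "(\<Sum>k\<in>UNIV. x k *\<^sub>R acol A k) = (\<Sum>k\<in>best c. x k *\<^sub>R acol A k)"
      by (rule sum.mono_neutral_right) (simp_all add: x_def)
    also have "\<dots> = (\<Sum>k\<in>best c. coord c k *\<^sub>R acol A k - (if k = j then acol A k else 0))"
      by (rule sum.cong) (simp_all add: x_def scaleR_diff_left)
    also have "\<dots> = c - acol A j"
      using j(1) coord_expansion[of c] by (simp add: sum_subtractf)
    finally have "rvec c' = (\<Sum>k\<in>UNIV. x k *\<^sub>R acol A k)" using rc' by simp
    \<comment> \<open>A positive multiple of c - a_j lies in NA; saturation removes the
      factor.\<close>
    from integer_relation[OF this] obtain m y where m: "m > 0" "A *v (\<chi> k. y k) = int m *s c'"
      and y: "\<And>k. y k \<ge> 0" using x by blast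
    have "A_deg A (Abs_poly_mapping (\<lambda>k. nat (y k))) = int m *s c'"
      using m(2) by (simp add: A_deg_def y)
    from sat[unfolded saturated_def, rule_format, OF m(1) this] obtain w where w: "A_deg A w = c'" by blast
    have "rvec (A_deg A (w + unit_exp j)) = c" by (simp only: rvec_unit w rc') simp
    then have "good c w j" unfolding good_def using j(1) less by blast
    then show ?thesis unfolding c_def by blast
  qed
  define rep where "rep = (\<lambda>c. SOME u. \<exists>w j. u = w + unit_exp j \<and> good c w j)"
  have rep: "\<exists>w j. rep c = w + unit_exp j \<and> good c w j" if "\<exists>w j. good c w j" for c
    unfolding rep_def by (rule someI_ex) (use that in blast)
  define c where "c = (\<lambda>u. rvec (A_deg A u))"
  define wt where "wt = (\<lambda>u. height (c u))"
  \<comment> \<open>Doubling the level leaves room for the bonus of the representative: it decides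
    within a class but never outweighs an increase of the level.\<close>
  define ms where "ms = (\<lambda>u. 2 * level (c u) + (if u = rep (c u) then 1 else 0))"
  have red: "lex_reducible A \<omega> wt ms u" if u: "mdeg u = CARD('d)" for u
  proof -
    obtain w j where wj: "rep (c u) = w + unit_exp j" "good (c u) w j"
      using rep ex[OF u] unfolding c_def by blast
    have cr: "c (rep (c u)) = c u" using wj unfolding good_def c_def by simp
    show ?thesis
    proof (cases "u = rep (c u)")
      case False
      have "A_deg A (rep (c u)) = A_deg A u" using cr unfolding c_def by (simp add: rvec_inject)
      moreover have "wt (rep (c u)) = wt u" unfolding wt_def cr ..
      moreover have "ms u < ms (rep (c u))" using False unfolding ms_def cr by simp
      ultimately show ?thesis unfolding lex_reducible_def by (intro disjI1 exI[of _ "rep (c u)"]) simp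
    next
      case True
      then have uw: "u = w + unit_exp j" using wj(1) by simp
      have cw: "c (w + unit_exp i) = c u - acol A j + acol A i" for i
        unfolding uw c_def rvec_unit by simp
      have jb: "j \<in> best (c u)" using wj(2) unfolding good_def by blast
      have step: "\<omega> j - wt u < \<omega> i - wt (w + unit_exp i) \<or>
          \<omega> j - wt u = \<omega> i - wt (w + unit_exp i) \<and> ms u < ms (w + unit_exp i)"
        if "i \<noteq> j" "dual (best (c u)) j \<bullet> acol A i \<noteq> 0" for i
      proof -
        have "height (c (w + unit_exp i)) < height (c u) - \<omega> j + \<omega> i \<or>
          height (c (w + unit_exp i)) = height (c u) - \<omega> j + \<omega> i \<and> level (c u) < level (c (w + unit_exp i))"
          using wj(2) that unfolding good_def cw by blast
        moreover have "ms u < ms (w + unit_exp i)" if "level (c u) < level (c (w + unit_exp i))"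
          using that unfolding ms_def by simp
        ultimately show ?thesis unfolding wt_def by auto
      qed
      have "dual (best (c u)) j \<bullet> acol A j \<noteq> 0"
        using dual_basis_nth[OF dual_basis_dual[OF best(1)] jb jb] by simp
      then show ?thesis unfolding lex_reducible_def
        using uw step by (intro disjI2 exI[of _ w] exI[of _ j] exI[of _ "dual (best (c u)) j"] conjI) blast+
    qed
  qed
  show ?thesis
    by (rule reducible_imp_generic[OF graded_A_deg_eq[OF graded] red])
qed

end

section \<open>Generic heights\<close>

text \<open>Every requirement excludes a hyperplane of heights. Finitely many hyperplanes have
  measure zero, so they cannot cover the nonempty open set of heights for which a fixed basis is a
  cell.\<close>

lemma generic_heights_exist:
  fixes A :: "int ^ 'n::finite ^ 'd::finite" and V :: "'n set \<Rightarrow> int ^ 'n"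
  assumes surj: "range ((*v) A) = UNIV"
    and V: "\<And>T. T \<in> \<T> \<Longrightarrow> V T \<noteq> 0"
  obtains \<omega> where "generic_heights A \<omega>" "\<exists>\<sigma> h \<psi>. cell A \<omega> \<sigma> h \<psi>"
    "\<And>T. T \<in> \<T> \<Longrightarrow> (\<Sum>j\<in>UNIV. \<omega> j * of_int (V T $ j)) \<noteq> 0"
proof -
  define B where "B = {\<sigma>. \<exists>h. dual_basis A \<sigma> h}"
  define hs where "hs = (\<lambda>\<sigma>. SOME h. dual_basis A \<sigma> h)"
  have hs: "dual_basis A \<sigma> (hs \<sigma>)" if "\<sigma> \<in> B" for \<sigma>
  proof -
    have "\<exists>h. dual_basis A \<sigma> h" using that by (simp add: B_def)
    then show ?thesis unfolding hs_def by (rule someI_ex)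
  qed
  \<comment> \<open>\<open>\<nu> \<sigma> i \<bullet> w\<close> is the excess of the height
    \<open>w $ i\<close> over the functional that interpolates \<open>w\<close> on \<sigma>,
    evaluated at column \<open>i\<close>.\<close>
  define \<nu> :: "'n set \<Rightarrow> 'n \<Rightarrow> real ^ 'n" where
    "\<nu> = (\<lambda>\<sigma> i. \<chi> k. (if k = i then 1 else 0) - (if k \<in> \<sigma> then hs \<sigma> k \<bullet> acol A i else 0))"
  have \<nu>: "\<nu> \<sigma> i \<bullet> w = w $ i - (\<Sum>k\<in>\<sigma>. (hs \<sigma> k \<bullet> acol A i) * w $ k)" for \<sigma> i w
  proof -
    have "\<nu> \<sigma> i \<bullet> w = (\<Sum>k\<in>UNIV. (if k = i then w $ k else 0) - (if k \<in> \<sigma> then (hs \<sigma> k \<bullet> acol A i) * w $ k else 0))"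
      unfolding inner_vec_def \<nu>_def by (rule sum.cong) (simp_all add: left_diff_distrib)
    also have "\<dots> = w $ i - (\<Sum>k\<in>\<sigma>. (hs \<sigma> k \<bullet> acol A i) * w $ k)"
      by (simp add: sum_subtractf flip: sum.inter_restrict)
    finally show ?thesis .
  qed
  have \<nu>0: "\<nu> \<sigma> i \<noteq> 0" if "i \<notin> \<sigma>" for \<sigma> i
  proof
    assume "\<nu> \<sigma> i = 0"
    then have "\<nu> \<sigma> i $ i = 0" by simp
    then show False using that by (simp add: \<nu>_def)
  qed
  define \<mu> :: "'n set \<Rightarrow> real ^ 'n" where "\<mu> = (\<lambda>T. \<chi> j. of_int (V T $ j))"
  have \<mu>: "\<mu> T \<bullet> w = (\<Sum>j\<in>UNIV. w $ j * of_int (V T $ j))" for T w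
    by (simp add: \<mu>_def inner_vec_def mult.commute)
  define N where "N = (\<lambda>(\<sigma>, i). \<nu> \<sigma> i) ` {(\<sigma>, i). i \<notin> \<sigma>} \<union> \<mu> ` \<T>"
  have "finite N" unfolding N_def by simp
  have "v \<noteq> 0" if "v \<in> N" for v
    using that V \<nu>0 by (auto simp: N_def \<mu>_def Finite_Cartesian_Product.vec_eq_iff)
  then have "negligible (\<Union>v\<in>N. {w. v \<bullet> w = 0})"
    using \<open>finite N\<close> by (intro negligible_Union) (auto intro!: negligible_hyperplane)
  moreover obtain \<sigma>0 where \<sigma>0: "\<sigma>0 \<in> B"
    using dual_basis_exists[OF surj] unfolding B_def by blast
  \<comment> \<open>The heights for which \<open>\<sigma>0\<close> is a cell; height 0 on
    \<open>\<sigma>0\<close> and 1 elsewhere is an example.\<close>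
  define U where "U = (\<Inter>i\<in>- \<sigma>0. {w. \<nu> \<sigma>0 i \<bullet> w > 0})"
  have "open U" unfolding U_def by (intro open_INT ballI open_halfspace_gt) simp
  moreover have "(\<chi> k. if k \<in> \<sigma>0 then 0 else 1) \<in> U"
    unfolding U_def by (simp add: \<nu>)
  ultimately have "\<not> U \<subseteq> (\<Union>v\<in>N. {w. v \<bullet> w = 0})"
    using open_not_negligible negligible_subset by blast
  then obtain w where w: "w \<in> U" "\<And>v. v \<in> N \<Longrightarrow> v \<bullet> w \<noteq> 0" by blast
  have ext: "\<psi> \<bullet> acol A i = w $ i - \<nu> \<sigma> i \<bullet> w"
    if "\<sigma> \<in> B" "\<forall>j\<in>\<sigma>. \<psi> \<bullet> acol A j = w $ j" for \<sigma> \<psi> i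
    unfolding dual_basis_inner[OF hs[OF that(1)], of \<psi> "acol A i"] using that(2) by (simp add: \<nu>)
  show ?thesis
  proof (rule that[of "\<lambda>j. w $ j"])
    show "generic_heights A (\<lambda>j. w $ j)"
      unfolding generic_heights_def
    proof (intro allI impI)
      fix \<sigma> h \<psi> i assume a: "dual_basis A \<sigma> h" "\<forall>j\<in>\<sigma>. \<psi> \<bullet> acol A j = w $ j" "i \<notin> \<sigma>"
      have "\<sigma> \<in> B" using a(1) by (auto simp: B_def)
      moreover have "\<nu> \<sigma> i \<in> N" using a(3) by (auto simp: N_def)
      ultimately show "\<psi> \<bullet> acol A i \<noteq> w $ i" using ext[OF _ a(2), of i] w(2) by simp
    qed
    define \<psi> where "\<psi> = (\<Sum>k\<in>\<sigma>0. w $ k *\<^sub>R hs \<sigma>0 k)"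
    have \<psi>: "\<psi> \<bullet> acol A j = w $ j" if j: "j \<in> \<sigma>0" for j
    proof -
      have "\<psi> \<bullet> acol A j = (\<Sum>k\<in>\<sigma>0. if j = k then w $ k else 0)"
        unfolding \<psi>_def inner_sum_left
        by (rule sum.cong) (simp_all add: dual_basis_nth[OF hs[OF \<sigma>0] _ j])
      then show ?thesis using j by simp
    qed
    have "\<psi> \<bullet> acol A i < w $ i" if "i \<notin> \<sigma>0" for i
      using ext[OF \<sigma>0, of \<psi> i] \<psi> w(1) that unfolding U_def by simp
    then show "\<exists>\<sigma> h \<psi>. cell A (($) w) \<sigma> h \<psi>"
      unfolding cell_def using hs[OF \<sigma>0] \<psi> by blast
    show "(\<Sum>j\<in>UNIV. w $ j * of_int (V T $ j)) \<noteq> 0" if "T \<in> \<T>" for T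
      using w(2)[of "\<mu> T"] that by (simp add: N_def \<mu>)
  qed
qed

text \<open>Both determinants are nonzero on the same curve for all small \<open>s\<close>, so their
  product is not the zero function.\<close>

lemma generic_vanishing:
  fixes A :: "int ^ 'n::finite ^ 'd::finite"
  assumes surj: "range ((*v) A) = UNIV" and graded: "\<And>i. g \<bullet> acol A i = 1"
  shows "\<exists>D N. (\<exists>p. peval D p \<noteq> 0) \<and> (\<forall>p. peval D p \<noteq> 0 \<longrightarrow>
    (\<forall>u. mdeg u = N \<longrightarrow> mon u \<in> J_A A p) \<and>
    (saturated A \<longrightarrow> (\<forall>u. mdeg u = CARD('d) \<longrightarrow> mon u \<in> J_A A p)))"
proof -
  define \<T> where "\<T> = {T. \<not> indep_cols A T}"
  have "\<forall>T\<in>\<T>. \<exists>v. v \<noteq> 0 \<and> A *v v = 0 \<and> (\<forall>j. j \<notin> T \<longrightarrow> v $ j = 0)"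
  proof
    fix T assume "T \<in> \<T>"
    then have "\<not> indep_cols A T" by (simp add: \<T>_def)
    then obtain v where "v \<noteq> 0" "A *v v = 0" "\<And>j. j \<notin> T \<Longrightarrow> v $ j = 0"
      using dependent_cols_relation by blast
    then show "\<exists>v. v \<noteq> 0 \<and> A *v v = 0 \<and> (\<forall>j. j \<notin> T \<longrightarrow> v $ j = 0)" by blast
  qed
  from bchoice[OF this] obtain V0
    where V0: "\<forall>T\<in>\<T>. V0 T \<noteq> 0 \<and> A *v V0 T = 0 \<and> (\<forall>j. j \<notin> T \<longrightarrow> V0 T $ j = 0)" by blast
  obtain \<omega> where \<omega>: "generic_heights A \<omega>" "\<exists>\<sigma> h \<psi>. cell A \<omega> \<sigma> h \<psi>"
    and nz: "\<And>T. T \<in> \<T> \<Longrightarrow> (\<Sum>j\<in>UNIV. \<omega> j * of_int (V0 T $ j)) \<noteq> 0"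
    using generic_heights_exist[OF surj, of \<T> V0] V0 by blast
  \<comment> \<open>Flipping the sign where necessary makes every relation lower the weight when it
    is subtracted.\<close>
  define V where "V = (\<lambda>T. if (\<Sum>j\<in>UNIV. \<omega> j * of_int (V0 T $ j)) > 0 then V0 T else - V0 T)"
  have "A *v (- v) = - (A *v v)" for v
    by (simp add: matrix_vector_mult_def Finite_Cartesian_Product.vec_eq_iff sum_negf)
  then have V: "A *v V T = 0" "j \<notin> T \<Longrightarrow> V T $ j = 0" "(\<Sum>j\<in>UNIV. \<omega> j * of_int (V T $ j)) > 0"
    if "\<not> indep_cols A T" for T j
    using V0[rule_format, of T] nz[of T] that by (simp_all add: V_def \<T>_def sum_negf)
  obtain N D where D: "\<forall>p u. peval D p \<noteq> 0 \<longrightarrow> mdeg u = N \<longrightarrow> mon u \<in> J_A A p"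
    "\<forall>\<^sub>F s in at_right 0. peval D (curve \<omega> s) \<noteq> 0"
    using vanishing_large_degree[OF graded, of V \<omega>] V by blast
  have "\<exists>D'. (\<forall>p u. peval D' p \<noteq> 0 \<longrightarrow> saturated A \<longrightarrow> mdeg u = CARD('d) \<longrightarrow> mon u \<in> J_A A p) \<and>
    (\<forall>\<^sub>F s in at_right 0. peval D' (curve \<omega> s) \<noteq> 0)"
  proof (cases "saturated A")
    case True
    interpret triangulation A \<omega> g
      by unfold_locales (fact graded \<omega>)+
    from vanishing_degree_dim[OF True] show ?thesis by blast
  next
    case False
    then show ?thesis by (intro exI[of _ 1]) simp
  qed
  then obtain D' where D': "\<forall>p u. peval D' p \<noteq> 0 \<longrightarrow> saturated A \<longrightarrow> mdeg u = CARD('d) \<longrightarrow> mon u \<in> J_A A p"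
    "\<forall>\<^sub>F s in at_right 0. peval D' (curve \<omega> s) \<noteq> 0" by blast
  have "\<forall>\<^sub>F s in at_right 0. peval (D * D') (curve \<omega> s) \<noteq> 0"
    using D(2) D'(2) by eventually_elim (simp add: peval_mult)
  then have "\<exists>p. peval (D * D') p \<noteq> 0"
    using eventually_happens'[OF trivial_limit_at_right_real] by blast
  moreover have "peval D p \<noteq> 0" "peval D' p \<noteq> 0" if "peval (D * D') p \<noteq> 0" for p
    using that by (simp_all add: peval_mult)
  ultimately show ?thesis
    using D(1) D'(1) by (intro exI[of _ "D * D'"] exI[of _ N]) blast
qed

section \<open>Normality and saturation\<close>

text \<open>The linear functional on R_A with value \<open>\<phi> u\<close> at \<open>mon u\<close>.
  If \<phi> depends on \<open>A_deg\<close> only, it annihilates \<open>I_A\<close>, which serves to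
  refute membership.\<close>

definition lin :: "(('n \<Rightarrow>\<^sub>0 nat) \<Rightarrow> complex) \<Rightarrow> 'n mpoly \<Rightarrow> complex" where
  "lin \<phi> f = (\<Sum>u\<in>Poly_Mapping.keys f. Poly_Mapping.lookup f u * \<phi> u)"

lemma lin_superset:
  assumes "finite S" "Poly_Mapping.keys f \<subseteq> S"
  shows "lin \<phi> f = (\<Sum>u\<in>S. Poly_Mapping.lookup f u * \<phi> u)"
  unfolding lin_def by (rule sum.mono_neutral_left) (use assms in \<open>auto simp: in_keys_iff\<close>)

lemma lin_add: "lin \<phi> (f + g) = lin \<phi> f + lin \<phi> g"
proof -
  let ?S = "Poly_Mapping.keys f \<union> Poly_Mapping.keys g"
  have "Poly_Mapping.keys (f + g) \<subseteq> ?S" by (rule keys_add)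
  then show ?thesis
    by (simp add: lin_superset[of ?S] lookup_add sum.distrib ring_distribs)
qed

lemma lin_single: "lin \<phi> (Poly_Mapping.single u c) = c * \<phi> u"
  by (simp add: lin_def)

lemma lin_zero: "lin \<phi> 0 = 0"
  by (simp add: lin_def)

lemma lin_diff: "lin \<phi> (f - g) = lin \<phi> f - lin \<phi> g"
  using lin_add[of \<phi> "f - g" g] by simp

lemma lin_I_A:
  assumes "f \<in> I_A A" "\<And>u w. A_deg A u = A_deg A w \<Longrightarrow> \<phi> u = \<phi> w"
  shows "lin \<phi> f = 0"
  using assms(1)
proof (induction rule: I_A_induct)
  case (binomial c u w)
  then show ?case using assms(2)[of u w] by (simp add: lin_diff lin_single)
qed (simp_all add: lin_zero lin_add)

lemma lin_mult_mon: "lin \<phi> (f * mon b) = lin (\<lambda>u. \<phi> (u + b)) f"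
  by (induction f rule: mpoly_induct) (simp_all add: mult_single lin_single lin_add distrib_right)

text \<open>The sum of the coefficients vanishes on \<open>I_A\<close>.\<close>

lemma mon_notin_I_A: "mon b \<notin> I_A A"
  using lin_I_A[of "mon b" A "\<lambda>_. 1"] by (auto simp: lin_single)

section \<open>Arithmetic of fractions\<close>

context domain
begin

lemma fraction_eq_iff:
  assumes "a \<in> carrier R" "b \<in> carrier R - {\<zero>}" "c \<in> carrier R" "d \<in> carrier R - {\<zero>}"
  shows "fraction R a b = fraction R c d \<longleftrightarrow> a \<otimes> d = c \<otimes> b"
proof -
  have "fraction R a b = fraction R c d \<longleftrightarrow> ((a, b), (c, d)) \<in> fraction_rel R"
    unfolding fraction_def by (rule eq_equiv_class_iff[OF fraction_rel_equiv]) (use assms in auto)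
  then show ?thesis using assms by (simp add: fraction_rel_def)
qed

lemma fraction_carrier: "a \<in> carrier R \<Longrightarrow> b \<in> carrier R - {\<zero>} \<Longrightarrow> fraction R a b \<in> carrier (fraction_field R)"
  by (auto simp: fraction_field_def)

lemma fraction_cases:
  assumes "x \<in> carrier (fraction_field R)"
  obtains a b where "a \<in> carrier R" "b \<in> carrier R - {\<zero>}" "x = fraction R a b"
  using assms by (auto simp: fraction_field_def)

lemma fraction_one: "\<one>\<^bsub>fraction_field R\<^esub> = fraction R \<one> \<one>" and
  fraction_zero: "\<zero>\<^bsub>fraction_field R\<^esub> = fraction R \<zero> \<one>"
  by (simp_all add: fraction_field_def)

text \<open>The additive structure suffices to evaluate the finite sum in
  \<open>integral_over\<close>.\<close>

lemma fraction_field_abelian_monoid: "abelian_monoid (fraction_field R)"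
proof (rule abelian_monoidI)
  fix x y assume "x \<in> carrier (fraction_field R)" "y \<in> carrier (fraction_field R)"
  then obtain a b c d where "a \<in> carrier R" "b \<in> carrier R - {\<zero>}" "x = fraction R a b"
    "c \<in> carrier R" "d \<in> carrier R - {\<zero>}" "y = fraction R c d" by (metis fraction_cases)
  then show "x \<oplus>\<^bsub>fraction_field R\<^esub> y \<in> carrier (fraction_field R)"
    "x \<oplus>\<^bsub>fraction_field R\<^esub> y = y \<oplus>\<^bsub>fraction_field R\<^esub> x"
    by (simp_all add: fraction_add fraction_carrier integral_iff m_comm a_comm)
next
  fix x y z assume "x \<in> carrier (fraction_field R)" "y \<in> carrier (fraction_field R)" "z \<in> carrier (fraction_field R)"
  then obtain a b c d e f where "a \<in> carrier R" "b \<in> carrier R - {\<zero>}" "x = fraction R a b"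
    "c \<in> carrier R" "d \<in> carrier R - {\<zero>}" "y = fraction R c d"
    "e \<in> carrier R" "f \<in> carrier R - {\<zero>}" "z = fraction R e f" by (metis fraction_cases)
  then show "x \<oplus>\<^bsub>fraction_field R\<^esub> y \<oplus>\<^bsub>fraction_field R\<^esub> z = x \<oplus>\<^bsub>fraction_field R\<^esub> (y \<oplus>\<^bsub>fraction_field R\<^esub> z)"
    by (simp add: fraction_add integral_iff l_distr r_distr m_ac a_ac)
next
  fix x assume "x \<in> carrier (fraction_field R)"
  then obtain a b where "a \<in> carrier R" "b \<in> carrier R - {\<zero>}" "x = fraction R a b" by (metis fraction_cases)
  then show "\<zero>\<^bsub>fraction_field R\<^esub> \<oplus>\<^bsub>fraction_field R\<^esub> x = x"
    by (simp add: fraction_zero fraction_add)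
qed (simp add: fraction_zero fraction_carrier)

lemma fraction_pow:
  assumes "a \<in> carrier R" "b \<in> carrier R - {\<zero>}"
  shows "fraction R a b [^]\<^bsub>fraction_field R\<^esub> (m::nat) = fraction R (a [^] m) (b [^] m)"
    and "b [^] m \<in> carrier R - {\<zero>}"
proof -
  show b: "b [^] m \<in> carrier R - {\<zero>}" for m :: nat
    using assms(2) by (induction m) (auto simp: integral_iff)
  show "fraction R a b [^]\<^bsub>fraction_field R\<^esub> (m::nat) = fraction R (a [^] m) (b [^] m)"
  proof (induction m)
    case 0
    show ?case by (simp add: nat_pow_def fraction_one)
  next
    case (Suc m)
    have "fraction R a b [^]\<^bsub>fraction_field R\<^esub> Suc m = fraction R (a [^] m) (b [^] m) \<otimes>\<^bsub>fraction_field R\<^esub> fraction R a b"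
      using Suc by (simp add: nat_pow_def)
    also have "\<dots> = fraction R (a [^] m \<otimes> a) (b [^] m \<otimes> b)"
      using assms b by (intro fraction_mult) auto
    finally show ?case by simp
  qed
qed

text \<open>The fraction is a root of the monic polynomial X^m - r, whose coefficients are
  \<open>c\<close> below.\<close>

lemma integral_over_root:
  assumes a: "a \<in> carrier R" and b: "b \<in> carrier R - {\<zero>}" and r: "r \<in> carrier R" and "m > 0"
    and eq: "a [^] m = r \<otimes> b [^] (m::nat)"
  shows "integral_over R (fraction R a b)"
proof -
  let ?K = "fraction_field R" and ?x = "fraction R a b"
  interpret K: abelian_monoid ?K by (rule fraction_field_abelian_monoid)
  define c where "c = (\<lambda>i::nat. if i = 0 then \<ominus> r else \<zero>)"
  have c: "c i \<in> carrier R" for i using r by (simp add: c_def)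
  have coeff: "fraction R (c i) \<one> \<otimes>\<^bsub>?K\<^esub> ?x [^]\<^bsub>?K\<^esub> i = (if 0 = i then fraction R (\<ominus> r) \<one> else \<zero>\<^bsub>?K\<^esub>)" for i
  proof (cases "i = 0")
    case True
    then show ?thesis using r a b by (simp add: c_def fraction_one fraction_mult)
  next
    case False
    have "fraction R (c i) \<one> \<otimes>\<^bsub>?K\<^esub> ?x [^]\<^bsub>?K\<^esub> i = fraction R (\<zero> \<otimes> a [^] i) (\<one> \<otimes> b [^] i)"
      unfolding fraction_pow[OF a b] using False a fraction_pow(2)[OF a b, of i]
      by (subst fraction_mult) (simp_all add: c_def)
    also have "\<dots> = \<zero>\<^bsub>?K\<^esub>"
      unfolding fraction_zero using a fraction_pow(2)[OF a b, of i]
      by (subst fraction_eq_iff) simp_all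
    finally show ?thesis using False by simp
  qed
  have "(\<Oplus>\<^bsub>?K\<^esub>i\<in>{..<m}. fraction R (c i) \<one> \<otimes>\<^bsub>?K\<^esub> ?x [^]\<^bsub>?K\<^esub> i)
      = (\<Oplus>\<^bsub>?K\<^esub>i\<in>{..<m}. if 0 = i then fraction R (\<ominus> r) \<one> else \<zero>\<^bsub>?K\<^esub>)"
    using r by (intro K.finsum_cong') (auto simp: coeff fraction_carrier)
  also have "\<dots> = fraction R (\<ominus> r) \<one>"
    using K.finsum_singleton[of 0 "{..<m}" "\<lambda>_. fraction R (\<ominus> r) \<one>"] r \<open>m > 0\<close> by (simp add: fraction_carrier)
  finally have "?x [^]\<^bsub>?K\<^esub> m \<oplus>\<^bsub>?K\<^esub> (\<Oplus>\<^bsub>?K\<^esub>i\<in>{..<m}. fraction R (c i) \<one> \<otimes>\<^bsub>?K\<^esub> ?x [^]\<^bsub>?K\<^esub> i)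
    = fraction R (a [^] m \<otimes> \<one> \<oplus> (\<ominus> r) \<otimes> b [^] m) (b [^] m \<otimes> \<one>)"
    unfolding fraction_pow[OF a b] using a r fraction_pow(2)[OF a b, of m]
    by (simp add: fraction_add)
  also have "a [^] m \<otimes> \<one> \<oplus> (\<ominus> r) \<otimes> b [^] m = \<zero>"
    using r b fraction_pow(2)[OF a b, of m] by (simp add: eq l_minus r_neg)
  also have "fraction R \<zero> (b [^] m \<otimes> \<one>) = \<zero>\<^bsub>?K\<^esub>"
    unfolding fraction_zero using fraction_pow(2)[OF a b, of m] by (subst fraction_eq_iff) auto
  finally show ?thesis
    unfolding integral_over_def Let_def using c by (intro exI[of _ m] exI[of _ c]) auto
qed

end

lemma S_A_pow: "(I_A A +>\<^bsub>R_A\<^esub> f) [^]\<^bsub>S_A A\<^esub> (m::nat) = I_A A +>\<^bsub>R_A\<^esub> (f ^ m)"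
proof (induction m)
  case 0
  show ?case by (simp add: nat_pow_def S_A_one)
next
  case (Suc m)
  then show ?case by (simp add: nat_pow_def S_A_mult mult.commute)
qed

lemma mon_power: "mon u ^ m = mon (\<Sum>i<m. u)"
  by (induction m) (simp_all add: mult_single add.commute)

lemma A_deg_sum: "A_deg A (\<Sum>i<m. u) = int m *s A_deg A u"
proof (induction m)
  case 0
  show ?case by (simp add: A_deg_def matrix_vector_mult_def Finite_Cartesian_Product.vec_eq_iff)
next
  case (Suc m)
  then show ?case by (simp add: A_deg_add Finite_Cartesian_Product.vec_eq_iff ring_distribs)
qed

text \<open>Write \<open>c\<close> as a difference of degrees of two monomials. The m-th power of
  their quotient is the class of \<open>mon w\<close>, so the quotient is integral and lies in S_A
  by normality; comparing degrees yields a monomial of degree \<open>c\<close>.\<close>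

lemma normal_imp_saturated:
  fixes A :: "int ^ 'n::finite ^ 'd::finite"
  assumes surj: "range ((*v) A) = UNIV" and normal: "normal_domain (S_A A)"
  shows "saturated A"
  unfolding saturated_def
proof (intro allI impI)
  fix c :: "int ^ 'd" and m :: nat and w
  assume m: "m > 0" and w: "A_deg A w = int m *s c"
  interpret domain "S_A A" using normal unfolding normal_domain_def by blast
  let ?q = "\<lambda>f. I_A A +>\<^bsub>R_A\<^esub> f"
  obtain z where z: "A *v z = c" using surj by (metis surjD)
  define a where "a = Abs_poly_mapping (\<lambda>j. nat (z $ j))"
  define b where "b = Abs_poly_mapping (\<lambda>j. nat (- z $ j))"
  have "(\<chi> j. int (Poly_Mapping.lookup a j)) = z + (\<chi> j. int (Poly_Mapping.lookup b j))"
    by (simp add: a_def b_def Finite_Cartesian_Product.vec_eq_iff)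
  then have ab: "A_deg A a = c + A_deg A b"
    by (simp add: A_deg_def matrix_vector_right_distrib z)
  have car: "?q f \<in> carrier (S_A A)" for f by (simp add: carrier_S_A)
  have qb: "?q (mon b) \<in> carrier (S_A A) - {\<zero>\<^bsub>S_A A\<^esub>}"
    using car mon_notin_I_A[of b A] by (simp add: S_A_zero coset_I_A_eq_iff)
  have "A_deg A (\<Sum>i<m. a) = A_deg A (w + (\<Sum>i<m. b))"
    by (simp add: A_deg_sum A_deg_add ab w Finite_Cartesian_Product.vec_eq_iff algebra_simps)
  then have "mon (\<Sum>i<m. a) - mon (w + (\<Sum>i<m. b)) \<in> I_A A" by (rule I_A_binomial)
  then have "?q (mon a) [^]\<^bsub>S_A A\<^esub> m = ?q (mon w) \<otimes>\<^bsub>S_A A\<^esub> ?q (mon b) [^]\<^bsub>S_A A\<^esub> m"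
    by (simp add: S_A_pow S_A_mult coset_I_A_eq_iff mon_power mult_single)
  then have "integral_over (S_A A) (fraction (S_A A) (?q (mon a)) (?q (mon b)))"
    by (rule integral_over_root[OF car qb car m])
  then obtain r where r: "r \<in> carrier (S_A A)"
    "fraction (S_A A) (?q (mon a)) (?q (mon b)) = fraction (S_A A) r \<one>\<^bsub>S_A A\<^esub>"
    using normal fraction_carrier[OF car qb] unfolding normal_domain_def by blast
  obtain f where f: "r = ?q f" using r(1) by (auto simp: carrier_S_A)
  have "?q (mon a) \<otimes>\<^bsub>S_A A\<^esub> \<one>\<^bsub>S_A A\<^esub> = r \<otimes>\<^bsub>S_A A\<^esub> ?q (mon b)"
    using r fraction_eq_iff[OF car qb r(1), of "\<one>\<^bsub>S_A A\<^esub>"] by simp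
  then have I: "mon a - f * mon b \<in> I_A A"
    by (simp add: f S_A_one S_A_mult coset_I_A_eq_iff)
  \<comment> \<open>Extracts the part of degree \<open>A_deg A a\<close>, so some monomial of
    \<open>f\<close> must have degree \<open>c\<close>.\<close>
  define \<phi> where "\<phi> = (\<lambda>u. if A_deg A u = A_deg A a then 1 else 0 :: complex)"
  have "lin \<phi> (mon a - f * mon b) = 0" by (rule lin_I_A[OF I]) (simp add: \<phi>_def)
  then have "lin (\<lambda>u. \<phi> (u + b)) f = 1"
    by (simp add: lin_diff lin_single lin_mult_mon \<phi>_def)
  then have "\<exists>u\<in>Poly_Mapping.keys f. \<phi> (u + b) \<noteq> 0"
    unfolding lin_def by (metis (no_types, lifting) mult_zero_right sum.neutral zero_neq_one)
  then obtain u where "A_deg A (u + b) = A_deg A a" by (auto simp: \<phi>_def split: if_splits)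
  then show "\<exists>u. A_deg A u = c" by (intro exI[of _ u]) (simp add: A_deg_add ab)
qed

section \<open>The Weyl algebra and the V-filtration\<close>

lemma pd_add: "pd j (f + g) = pd j f + pd j g"
  by (rule poly_mapping_eqI) (simp add: lookup_pd lookup_add ring_distribs)

lemma pd_zero [simp]: "pd j 0 = 0"
  by (simp add: pd_def)

lemma pd_single: "pd j (Poly_Mapping.single u c) =
    Poly_Mapping.single (u - unit_exp j) (of_nat (Poly_Mapping.lookup u j) * c)"
  by (simp add: pd_def)

lemma pd_mult: "pd j (f * g) = pd j f * g + f * pd j g"
proof (induction f rule: mpoly_induct)
  case (single u c)
  show ?case
  proof (induction g rule: mpoly_induct)
    case (single w d)
    \<comment> \<open>Subtraction of exponents truncates at 0; where that happens, the coefficient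
      is 0 on both sides.\<close>
    have 1: "Poly_Mapping.single (u + w - unit_exp j) (of_nat (Poly_Mapping.lookup u j) * c * d)
      = Poly_Mapping.single (u - unit_exp j + w) (of_nat (Poly_Mapping.lookup u j) * c * d)"
    proof (cases "Poly_Mapping.lookup u j = 0")
      case False
      then have "u + w - unit_exp j = u - unit_exp j + w"
        by (intro poly_mapping_eqI) (auto simp: lookup_add lookup_minus lookup_single when_def)
      then show ?thesis by simp
    qed simp
    have 2: "Poly_Mapping.single (u + w - unit_exp j) (c * (of_nat (Poly_Mapping.lookup w j) * d))
      = Poly_Mapping.single (u + (w - unit_exp j)) (c * (of_nat (Poly_Mapping.lookup w j) * d))"
    proof (cases "Poly_Mapping.lookup w j = 0")
      case False
      then have "u + w - unit_exp j = u + (w - unit_exp j)"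
        by (intro poly_mapping_eqI) (auto simp: lookup_add lookup_minus lookup_single when_def)
      then show ?thesis by simp
    qed simp
    show ?case
      unfolding mult_single pd_single 1[symmetric] 2[symmetric] single_add[symmetric]
      by (simp add: lookup_add algebra_simps)
  qed (simp add: pd_add ring_distribs)
qed (simp add: pd_add ring_distribs)

lemma pd_Const_mult: "pd j (Const c * f) = Const c * pd j f"
  by (simp add: pd_mult Const_def pd_single)

lemma pd_one [simp]: "pd j 1 = 0"
  using pd_single[of j 0 1] by simp

definition coordinate :: "complex ^ 'n \<Rightarrow> 'n \<Rightarrow> 'n mpoly" where
  "coordinate p j = Var j + Const (p $ j)"

lemma pd_coordinate: "pd j (coordinate p k) = (if k = j then 1 else 0)"
  by (simp add: coordinate_def Var_def Const_def pd_add pd_single lookup_single)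

lemma pd_power: "pd j (f ^ m) = of_nat m * f ^ (m - 1) * pd j f"
proof (induction m)
  case (Suc m)
  then show ?case by (cases m) (simp_all add: pd_mult algebra_simps)
qed simp

lemma pd_prod_zero:
  assumes "\<And>k. k \<in> S \<Longrightarrow> pd j (f k) = 0"
  shows "pd j (\<Prod>k\<in>S. f k) = 0"
  using assms by (induction S rule: infinite_finite_induct) (simp_all add: pd_mult)

lemma xpow_remove: "xpow p u = coordinate p j ^ u j * (\<Prod>k\<in>UNIV - {j}. coordinate p k ^ u k)"
  unfolding xpow_def coordinate_def by (rule prod.remove) simp_all

lemma xpow_Suc: "xpow p (u(j := Suc (u j))) = coordinate p j * xpow p u"
proof -
  have "(\<Prod>k\<in>UNIV - {j}. coordinate p k ^ (u(j := Suc (u j))) k) = (\<Prod>k\<in>UNIV - {j}. coordinate p k ^ u k)"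
    by (rule prod.cong) simp_all
  then show ?thesis by (simp add: xpow_remove[of p _ j] mult.assoc)
qed

lemma xpow_zero [simp]: "xpow p (\<lambda>_. 0) = 1"
  by (simp add: xpow_def)

lemma pd_xpow: "pd j (xpow p u) = of_nat (u j) * xpow p (u(j := u j - 1))"
proof -
  have 0: "pd j (\<Prod>k\<in>UNIV - {j}. coordinate p k ^ u k) = 0"
    by (rule pd_prod_zero) (simp add: pd_power pd_coordinate)
  have "(\<Prod>k\<in>UNIV - {j}. coordinate p k ^ (u(j := u j - 1)) k) = (\<Prod>k\<in>UNIV - {j}. coordinate p k ^ u k)"
    by (rule prod.cong) simp_all
  then show ?thesis
    by (simp add: xpow_remove[of p _ j] pd_mult 0 pd_power pd_coordinate mult.assoc)
qed

lemma sum_fun_upd_Suc: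
  fixes v :: "'n::finite \<Rightarrow> nat"
  shows "(\<Sum>k\<in>UNIV. (v(j := Suc (v j))) k) = Suc (\<Sum>k\<in>UNIV. v k)"
proof -
  have "(\<Sum>k\<in>UNIV. (v(j := Suc (v j))) k) = (\<Sum>k\<in>UNIV. v k + (if k = j then 1 else 0))"
    by (rule sum.cong) simp_all
  then show ?thesis by (simp add: sum.distrib)
qed

lemma exp_fun_induct [case_names zero Suc]:
  fixes v :: "'n::finite \<Rightarrow> nat"
  assumes "P (\<lambda>_. 0)" "\<And>v j. P v \<Longrightarrow> P (v(j := Suc (v j)))"
  shows "P v"
proof (induction "\<Sum>j\<in>UNIV. v j" arbitrary: v)
  case 0
  then have "v = (\<lambda>_. 0)" by auto
  then show ?case using assms(1) by simp
next
  case (Suc m)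
  have "\<exists>j. v j \<noteq> 0"
  proof (rule ccontr)
    assume "\<not> ?thesis"
    then have "(\<Sum>j\<in>UNIV. v j) = 0" by simp
    then show False using Suc(2) by simp
  qed
  then obtain j where j: "v j \<noteq> 0" ..
  define w where "w = v(j := v j - 1)"
  have v: "v = w(j := Suc (w j))" using j by (auto simp: w_def)
  have "(\<Sum>k\<in>UNIV. v k) = Suc (\<Sum>k\<in>UNIV. w k)"
    using sum_fun_upd_Suc[of w j] v by simp
  then have "P w" using Suc by simp
  then show ?case using assms(2) by (subst v)
qed

text \<open>The factor of \<open>j\<close> is split off the fold; the remaining factors do not see
  the update at \<open>j\<close>.\<close>

lemma dpow_Suc: "dpow (v(j := Suc (v j))) f = pd j (dpow v f)"
proof -
  define F where "F = (\<lambda>v :: 'a \<Rightarrow> nat. Finite_Set.fold (\<lambda>j P. (pd j ^^ v j) \<circ> P) id (UNIV - {j}))"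
  have *: "dpow v = (pd j ^^ v j) \<circ> F v" for v :: "'a \<Rightarrow> nat"
  proof -
    interpret comp_fun_commute "\<lambda>j P. (pd j ^^ v j) \<circ> P" by (rule comp_fun_commute_pd)
    show ?thesis unfolding dpow_def F_def using fold_rec[of UNIV j id] by simp
  qed
  have "F (v(j := Suc (v j))) = F v"
    unfolding F_def
    by (rule Finite_Set.fold_cong[where S = UNIV])
      (simp_all add: comp_fun_commute_pd flip: comp_fun_commute_def')
  then show ?thesis by (simp add: *)
qed

lemma dpow_zero: "dpow (\<lambda>_. 0) f = f"
proof -
  interpret comp_fun_commute "\<lambda>(j :: 'a) (P :: 'a oper). P" by unfold_locales simp
  have "Finite_Set.fold (\<lambda>j P. P) id S = (id :: 'a oper)" for S :: "'a set"
  proof (induction S rule: infinite_finite_induct)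
    case (insert x S)
    then show ?case using fold_insert[OF insert(1,2), of id] by (simp only:)
  qed simp_all
  moreover have "(\<lambda>j P. (pd j ^^ 0) \<circ> P) = (\<lambda>(j :: 'a) (P :: 'a oper). P)" by (simp add: fun_eq_iff)
  ultimately show ?thesis unfolding dpow_def by (simp only: id_apply)
qed

lemma dpow_add: "dpow v (f + g) = dpow v f + dpow v g"
  by (induction v rule: exp_fun_induct) (simp_all add: dpow_zero dpow_Suc pd_add del: fun_upd_apply)

lemma dpow_Const_mult: "dpow v (Const c * f) = Const c * dpow v f"
  by (induction v rule: exp_fun_induct) (simp_all add: dpow_zero dpow_Suc pd_Const_mult del: fun_upd_apply)

lemma dpow_compose: "dpow (\<lambda>j. v j + w j) f = dpow v (dpow w f)"
proof (induction v rule: exp_fun_induct)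
  case (Suc v j)
  have eq: "(\<lambda>k. (v(j := Suc (v j))) k + w k) = (\<lambda>k. v k + w k)(j := Suc (v j + w j))" by auto
  show ?case by (simp only: eq dpow_Suc[of "\<lambda>k. v k + w k" j f] dpow_Suc[of v] Suc)
qed (simp add: dpow_zero)

lemma dop_superset:
  assumes "finite S" "Poly_Mapping.keys g \<subseteq> S"
  shows "dop g f = (\<Sum>v\<in>S. Const (Poly_Mapping.lookup g v) * dpow (Poly_Mapping.lookup v) f)"
  unfolding dop_def by (rule sum.mono_neutral_left) (use assms in \<open>auto simp: in_keys_iff\<close>)

lemma dop_plus: "dop (g + h) f = dop g f + dop h f"
proof -
  let ?S = "Poly_Mapping.keys g \<union> Poly_Mapping.keys h"
  have "Poly_Mapping.keys (g + h) \<subseteq> ?S" by (rule keys_add)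
  then show ?thesis
    by (simp add: dop_superset[of ?S] lookup_add sum.distrib ring_distribs Const_add)
qed

lemma dop_single: "dop (Poly_Mapping.single u c) f = Const c * dpow (Poly_Mapping.lookup u) f"
  by (subst dop_superset[of "{u}"]) auto

lemma dop_zero: "dop 0 f = 0"
  by (simp add: dop_def)

lemma dop_sum: "dop (sum g S) f = (\<Sum>x\<in>S. dop (g x) f)"
  by (induction S rule: infinite_finite_induct) (simp_all add: dop_plus dop_zero)

lemma dop_add: "dop g (f + h) = dop g f + dop g h"
  by (simp add: dop_def dpow_add ring_distribs sum.distrib)

lemma dop_diff: "dop g (f - h) = dop g f - dop g h"
  using dop_add[of g "f - h" h] by simp

lemma dop_mult: "dop (g * h) f = dop g (dop h f)"
proof (induction g rule: mpoly_induct)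
  case (single u c)
  show ?case
  proof (induction h rule: mpoly_induct)
    case (single w d)
    have "Poly_Mapping.lookup (u + w) = (\<lambda>j. Poly_Mapping.lookup u j + Poly_Mapping.lookup w j)"
      by (simp add: lookup_add fun_eq_iff)
    then show ?case
      by (simp add: mult_single dop_single dpow_compose dpow_Const_mult Const_mult mult.assoc)
  qed (simp add: distrib_left dop_plus dop_add)
qed (simp add: distrib_right dop_plus)

lemma dop_Const: "dop (Const c) f = Const c * f"
proof -
  have "Poly_Mapping.lookup 0 = (\<lambda>_ :: 'a. 0 :: nat)" by (simp add: fun_eq_iff)
  then show ?thesis by (simp add: Const_def dop_single dpow_zero)
qed

lemma dop_Var: "dop (Var j) f = pd j f"
proof -
  have "Poly_Mapping.lookup (unit_exp j) = (\<lambda>_. 0)(j := Suc 0)"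
    by (auto simp: lookup_single when_def)
  then have "dpow (Poly_Mapping.lookup (unit_exp j)) f = pd j f"
    using dpow_Suc[of "\<lambda>_. 0" j f] by (simp add: dpow_zero)
  then show ?thesis by (simp add: Var_def dop_single)
qed

lemma D_A_zero: "(\<lambda>_. 0) \<in> D_A"
proof -
  have "(\<lambda>f. Const 0 * f) = (\<lambda>_. 0)" by (simp add: fun_eq_iff)
  then show ?thesis using D_A.const[of 0] by (rule subst[where P = "\<lambda>P. P \<in> D_A"])
qed

lemma D_A_id: "(\<lambda>f. f) \<in> D_A"
proof -
  have "(\<lambda>f. Const 1 * f) = (\<lambda>f. f)" by (simp add: fun_eq_iff)
  then show ?thesis using D_A.const[of 1] by (rule subst[where P = "\<lambda>P. P \<in> D_A"])
qed

lemma D_A_sum: "(\<And>x. x \<in> S \<Longrightarrow> P x \<in> D_A) \<Longrightarrow> (\<lambda>f. \<Sum>x\<in>S. P x f) \<in> D_A"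
  by (induction S rule: infinite_finite_induct) (simp_all add: D_A_zero D_A.add)

lemma D_A_comp: "P \<in> D_A \<Longrightarrow> Q \<in> D_A \<Longrightarrow> (\<lambda>f. P (Q f)) \<in> D_A"
  using D_A.mult[of P Q] by (simp add: comp_def)

lemma D_A_poly_mult: "(\<lambda>f. (g :: 'n::finite mpoly) * f) \<in> D_A"
proof -
  define M where "M = {g :: 'n mpoly. (\<lambda>f. g * f) \<in> D_A}"
  have mult: "g * h \<in> M" if "g \<in> M" "h \<in> M" for g h
  proof -
    have "(\<lambda>f. g * h * f) = (\<lambda>f. g * (h * f))" by (simp add: mult.assoc)
    then show ?thesis using D_A_comp[of "\<lambda>f. g * f" "\<lambda>f. h * f"] that unfolding M_def by (simp only: mem_Collect_eq)
  qed
  have add: "g + h \<in> M" if "g \<in> M" "h \<in> M" for g h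
  proof -
    have "(\<lambda>f. (g + h) * f) = (\<lambda>f. g * f + h * f)" by (simp add: distrib_right)
    then show ?thesis using D_A.add[of "\<lambda>f. g * f" "\<lambda>f. h * f"] that unfolding M_def by (simp only: mem_Collect_eq)
  qed
  have one: "1 \<in> M" unfolding M_def mem_Collect_eq mult_1 by (rule D_A_id)
  have power: "Var j ^ m \<in> M" for j m
    by (induction m) (auto simp: one intro!: mult, simp add: M_def D_A.var)
  have "(\<Prod>j\<in>S. Var j ^ e j) \<in> M" for S and e :: "'n \<Rightarrow> nat"
    by (induction S rule: infinite_finite_induct) (auto simp: one intro!: mult power)
  then have "mon (Abs_poly_mapping (Poly_Mapping.lookup u)) \<in> M" for u
    by (metis prod_Var_power)
  then have "Const c * mon u \<in> M" for c u
    using D_A.const by (intro mult) (simp_all add: M_def lookup_inverse)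
  then have "g \<in> M"
    by (induction g rule: mpoly_induct) (auto simp: Const_mult_single intro: add)
  then show ?thesis by (simp add: M_def)
qed

lemma D_A_dpow: "dpow v \<in> D_A"
proof (induction v rule: exp_fun_induct)
  case zero
  then show ?case using D_A_id dpow_zero by (metis (no_types, lifting) ext)
next
  case (Suc v j)
  have "dpow (v(j := Suc (v j))) = (\<lambda>f. pd j (dpow v f))" by (rule ext) (rule dpow_Suc)
  then show ?case using D_A_comp[OF D_A.pd Suc] by (simp only:)
qed

lemma D_A_dop: "dop g \<in> D_A"
proof -
  have "dop g = (\<lambda>f. \<Sum>v\<in>Poly_Mapping.keys g. Const (Poly_Mapping.lookup g v) * dpow (Poly_Mapping.lookup v) f)"
    by (rule ext) (rule dop_def)
  also have "\<dots> \<in> D_A" by (intro D_A_sum D_A_comp[OF D_A.const D_A_dpow])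
  finally show ?thesis .
qed

lemma D_A_theta: "theta p \<in> D_A"
proof -
  have "theta p = (\<lambda>f. \<Sum>j\<in>UNIV. (Var j + Const (p $ j)) * pd j f)" by (rule ext) (rule theta_def)
  also have "\<dots> \<in> D_A" by (intro D_A_sum D_A_comp[OF D_A_poly_mult D_A.pd])
  finally show ?thesis .
qed

lemma left_ideal_D_A: "left_ideal D_A"
  unfolding left_ideal_def by (auto simp: D_A_zero intro: D_A.add D_A.mult)

lemma left_ideal_gen:
  assumes "S \<subseteq> D_A"
  shows "left_ideal (left_ideal_gen S)" "S \<subseteq> left_ideal_gen S"
proof -
  have "left_ideal_gen S \<subseteq> D_A"
    unfolding left_ideal_gen_def using left_ideal_D_A assms by blast
  then show "left_ideal (left_ideal_gen S)"
    unfolding left_ideal_def left_ideal_gen_def by blast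
  show "S \<subseteq> left_ideal_gen S" unfolding left_ideal_gen_def by blast
qed

lemma left_ideal_sum:
  assumes "left_ideal I" "\<And>x. x \<in> S \<Longrightarrow> P x \<in> I"
  shows "(\<lambda>f. \<Sum>x\<in>S. P x f) \<in> I"
  using assms(2)
proof (induction S rule: infinite_finite_induct)
  case (insert x S)
  then have "P x \<in> I" "(\<lambda>f. \<Sum>x\<in>S. P x f) \<in> I" by simp_all
  then show ?case using insert(1,2) assms(1) by (simp add: left_ideal_def)
qed (use assms(1) in \<open>simp_all add: left_ideal_def\<close>)

lemma left_ideal_comp: "left_ideal I \<Longrightarrow> P \<in> D_A \<Longrightarrow> Q \<in> I \<Longrightarrow> (\<lambda>f. P (Q f)) \<in> I"
  unfolding left_ideal_def comp_def by blast

lemma H_A: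
  fixes A :: "int ^ 'n::finite ^ 'd::finite"
  shows left_ideal_H_A: "left_ideal (H_A A \<beta>)"
    and dop_in_H_A: "g \<in> I_A A \<Longrightarrow> dop g \<in> H_A A \<beta>"
    and euler_in_H_A: "(\<lambda>f. euler_op A i f - Const (\<beta> $ i) * f) \<in> H_A A \<beta>"
proof -
  have "(\<lambda>f. euler_op A i f - Const (\<beta> $ i) * f) \<in> D_A" for i
  proof -
    have "(\<lambda>f. euler_op A i f - Const (\<beta> $ i) * f) =
      (\<lambda>f. (\<Sum>j\<in>UNIV. (of_int (A $ i $ j) * Var j) * pd j f) + Const (- \<beta> $ i) * f)"
      by (simp add: euler_op_def Const_uminus fun_eq_iff)
    moreover have "\<dots> \<in> D_A"
      by (intro D_A.add D_A_sum D_A.const D_A_comp[OF D_A_poly_mult D_A.pd])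
    ultimately show ?thesis by simp
  qed
  then have "dop ` I_A A \<union> range (\<lambda>i f. euler_op A i f - Const (\<beta> $ i) * f) \<subseteq> D_A"
    using D_A_dop by blast
  from left_ideal_gen[OF this] show "left_ideal (H_A A \<beta>)"
    "g \<in> I_A A \<Longrightarrow> dop g \<in> H_A A \<beta>" "(\<lambda>f. euler_op A i f - Const (\<beta> $ i) * f) \<in> H_A A \<beta>"
    unfolding H_A_def by blast+
qed

text \<open>An arbitrary index set covers both the steps of the V-filtration and the operators with
  \<open>u\<close> and \<open>v\<close> of the same size k.\<close>

definition oper_span :: "complex ^ 'n \<Rightarrow> (('n \<Rightarrow> nat) \<times> ('n \<Rightarrow> nat)) set \<Rightarrow> 'n::finite oper set" where
  "oper_span p S = {(\<lambda>f. \<Sum>(u, v)\<in>T. Const (c u v) * (xpow p u * dpow v f)) | T c. finite T \<and> T \<subseteq> S}"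

lemma V_filt_eq: "V_filt k p = oper_span p {(u, v). int (\<Sum>j\<in>UNIV. u j) - int (\<Sum>j\<in>UNIV. v j) \<ge> k}"
  unfolding V_filt_def oper_span_def ..

lemma oper_span_zero: "(\<lambda>_. 0) \<in> oper_span p S"
  unfolding oper_span_def by (intro CollectI exI[of _ "{}"]) simp

lemma oper_span_base:
  assumes "(u, v) \<in> S"
  shows "(\<lambda>f. Const c * (xpow p u * dpow v f)) \<in> oper_span p S"
  unfolding oper_span_def
  by (intro CollectI exI[of _ "{(u, v)}"] exI[of _ "\<lambda>_ _. c"]) (use assms in simp)

lemma oper_span_add:
  assumes "P \<in> oper_span p S" "Q \<in> oper_span p S"
  shows "(\<lambda>f. P f + Q f) \<in> oper_span p S"
proof -
  obtain T c where P: "P = (\<lambda>f. \<Sum>(u, v)\<in>T. Const (c u v) * (xpow p u * dpow v f))" "finite T" "T \<subseteq> S"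
    using assms(1) unfolding oper_span_def by blast
  obtain T' c' where Q: "Q = (\<lambda>f. \<Sum>(u, v)\<in>T'. Const (c' u v) * (xpow p u * dpow v f))" "finite T'" "T' \<subseteq> S"
    using assms(2) unfolding oper_span_def by blast
  define d where "d = (\<lambda>u v. (if (u, v) \<in> T then c u v else 0) + (if (u, v) \<in> T' then c' u v else 0))"
  have "P f + Q f = (\<Sum>(u, v)\<in>T \<union> T'. Const (d u v) * (xpow p u * dpow v f))" for f
  proof -
    have "P f = (\<Sum>(u, v)\<in>T \<union> T'. Const (if (u, v) \<in> T then c u v else 0) * (xpow p u * dpow v f))"
      unfolding P(1) using P(2) Q(2) by (intro sum.mono_neutral_cong_left) auto
    moreover have "Q f = (\<Sum>(u, v)\<in>T \<union> T'. Const (if (u, v) \<in> T' then c' u v else 0) * (xpow p u * dpow v f))"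
      unfolding Q(1) using P(2) Q(2) by (intro sum.mono_neutral_cong_left) auto
    ultimately show ?thesis
      unfolding d_def Const_add distrib_right by (simp add: sum.distrib case_prod_unfold)
  qed
  then have "(\<lambda>f. P f + Q f) = (\<lambda>f. \<Sum>(u, v)\<in>T \<union> T'. Const (d u v) * (xpow p u * dpow v f))" by (rule ext)
  then show ?thesis
    unfolding oper_span_def using P(2,3) Q(2,3)
    by (intro CollectI exI[of _ "T \<union> T'"] exI[of _ d]) simp
qed

lemma oper_span_sum: "(\<And>x. x \<in> X \<Longrightarrow> P x \<in> oper_span p S) \<Longrightarrow> (\<lambda>f. \<Sum>x\<in>X. P x f) \<in> oper_span p S"
  by (induction X rule: infinite_finite_induct) (simp_all add: oper_span_zero oper_span_add)

lemma oper_span_induct [consumes 1, case_names zero add base]: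
  assumes "P \<in> oper_span p S"
    and "Z (\<lambda>_. 0)" and "\<And>P Q. Z P \<Longrightarrow> Z Q \<Longrightarrow> Z (\<lambda>f. P f + Q f)"
    and "\<And>u v c. (u, v) \<in> S \<Longrightarrow> Z (\<lambda>f. Const c * (xpow p u * dpow v f))"
  shows "Z P"
proof -
  obtain T c where P: "P = (\<lambda>f. \<Sum>(u, v)\<in>T. Const (c u v) * (xpow p u * dpow v f))" and T: "finite T" "T \<subseteq> S"
    using assms(1) unfolding oper_span_def by blast
  show ?thesis
    unfolding P using T
  proof (induction T rule: finite_induct)
    case empty
    show ?case using assms(2) by simp
  next
    case (insert x T)
    obtain u v where x: "x = (u, v)" by (cases x)
    have "Z (\<lambda>f. Const (c u v) * (xpow p u * dpow v f) + (\<Sum>(u, v)\<in>T. Const (c u v) * (xpow p u * dpow v f)))"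
      using insert x by (intro assms(3,4)) auto
    then show ?case using insert(1,2) by (simp add: x)
  qed
qed

lemma V_filt_base:
  assumes "k \<le> int (\<Sum>j\<in>UNIV. u j) - int (\<Sum>j\<in>UNIV. v j)"
  shows "(\<lambda>f. Const c * (xpow p u * dpow v f)) \<in> V_filt k p"
  unfolding V_filt_eq by (rule oper_span_base) (use assms in simp)

lemma V_filt_zero: "(\<lambda>_. 0) \<in> V_filt k p"
  and V_filt_add: "P \<in> V_filt k p \<Longrightarrow> Q \<in> V_filt k p \<Longrightarrow> (\<lambda>f. P f + Q f) \<in> V_filt k p"
  and V_filt_sum: "(\<And>x. x \<in> X \<Longrightarrow> P' x \<in> V_filt k p) \<Longrightarrow> (\<lambda>f. \<Sum>x\<in>X. P' x f) \<in> V_filt k p"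
  unfolding V_filt_eq by (fact oper_span_zero oper_span_add oper_span_sum)+

lemma V_filt_induct [consumes 1, case_names zero add base]:
  assumes "P \<in> V_filt k p"
    and "Z (\<lambda>_. 0)" and "\<And>P Q. Z P \<Longrightarrow> Z Q \<Longrightarrow> Z (\<lambda>f. P f + Q f)"
    and "\<And>u v c. k \<le> int (\<Sum>j\<in>UNIV. u j) - int (\<Sum>j\<in>UNIV. v j) \<Longrightarrow> Z (\<lambda>f. Const c * (xpow p u * dpow v f))"
  shows "Z P"
  using assms(1) unfolding V_filt_eq by (induction rule: oper_span_induct) (simp_all add: assms(2-4))

lemma V_filt_coordinate:
  assumes "P \<in> V_filt k p"
  shows "(\<lambda>f. coordinate p j * P f) \<in> V_filt (k + 1) p"
  using assms
proof (induction rule: V_filt_induct)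
  case zero
  show ?case by (simp add: V_filt_zero)
next
  case (add P Q)
  then show ?case using V_filt_add by (simp add: distrib_left)
next
  case (base u v c)
  have "(\<lambda>f. coordinate p j * (Const c * (xpow p u * dpow v f))) = (\<lambda>f. Const c * (xpow p (u(j := Suc (u j))) * dpow v f))"
    by (simp add: xpow_Suc mult_ac)
  then show ?case using base V_filt_base[of "k + 1" "u(j := Suc (u j))" v c p]
    unfolding sum_fun_upd_Suc by simp
qed

text \<open>By the Leibniz rule \<partial>_j either lowers the power of x + p or raises that of
  \<partial>; both cost one order.\<close>

lemma V_filt_pd:
  assumes "P \<in> V_filt k p"
  shows "(\<lambda>f. pd j (P f)) \<in> V_filt (k - 1) p"
  using assms
proof (induction rule: V_filt_induct)
  case zero
  show ?case by (simp add: V_filt_zero)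
next
  case (add P Q)
  then show ?case using V_filt_add by (simp add: pd_add)
next
  case (base u v c)
  have eq: "pd j (Const c * (xpow p u * dpow v f)) =
    Const (c * of_nat (u j)) * (xpow p (u(j := u j - 1)) * dpow v f) +
    Const c * (xpow p u * dpow (v(j := Suc (v j))) f)" for f
    unfolding pd_Const_mult
    by (simp add: pd_mult pd_xpow dpow_Suc Const_mult Const_of_nat distrib_left mult.assoc del: fun_upd_apply)
  have "(\<lambda>f. Const (c * of_nat (u j)) * (xpow p (u(j := u j - 1)) * dpow v f)) \<in> V_filt (k - 1) p"
  \<comment> \<open>For \<open>u j = 0\<close> the truncated exponent does not drop, but the
    coefficient \<open>of_nat (u j)\<close> is 0.\<close>
  proof (cases "u j = 0")
    case True
    then show ?thesis by (simp add: V_filt_zero)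
  next
    case False
    define w where "w = u(j := u j - 1)"
    have "u = w(j := Suc (w j))" using False by (auto simp: w_def)
    then have "(\<Sum>j\<in>UNIV. u j) = Suc (\<Sum>j\<in>UNIV. w j)" using sum_fun_upd_Suc[of w j] by simp
    then show ?thesis using base unfolding w_def[symmetric] by (intro V_filt_base) simp
  qed
  moreover have "(\<lambda>f. Const c * (xpow p u * dpow (v(j := Suc (v j))) f)) \<in> V_filt (k - 1) p"
    using base by (intro V_filt_base) (simp add: sum_fun_upd_Suc del: fun_upd_apply)
  ultimately show ?case unfolding eq by (rule V_filt_add)
qed

lemma V_filt_Const:
  assumes "P \<in> V_filt k p"
  shows "(\<lambda>f. Const c * P f) \<in> V_filt k p"
  using assms
proof (induction rule: V_filt_induct)
  case zero
  show ?case by (simp add: V_filt_zero)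
next
  case (add P Q)
  then show ?case using V_filt_add by (simp add: distrib_left)
next
  case (base u v d)
  then show ?case using V_filt_base[OF base, of "c * d"] by (simp add: Const_mult mult.assoc)
qed

lemma V_filt_xpow:
  assumes "P \<in> V_filt k p"
  shows "(\<lambda>f. xpow p u * P f) \<in> V_filt (k + int (\<Sum>j\<in>UNIV. u j)) p"
proof (induction u rule: exp_fun_induct)
  case zero
  then show ?case using assms by simp
next
  case (Suc u j)
  then show ?case using V_filt_coordinate[OF Suc, of j]
    unfolding sum_fun_upd_Suc xpow_Suc by (simp add: mult.assoc add_ac)
qed

lemma V_filt_dpow:
  assumes "P \<in> V_filt k p"
  shows "(\<lambda>f. dpow v (P f)) \<in> V_filt (k - int (\<Sum>j\<in>UNIV. v j)) p"
proof (induction v rule: exp_fun_induct)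
  case zero
  then show ?case using assms by (simp add: dpow_zero)
next
  case (Suc v j)
  then show ?case using V_filt_pd[OF Suc, of j]
    unfolding sum_fun_upd_Suc dpow_Suc by (simp add: algebra_simps)
qed

lemma V_filt_dop:
  assumes "P \<in> V_filt k p" "homogeneous_poly m g"
  shows "(\<lambda>f. dop g (P f)) \<in> V_filt (k - int m) p"
  unfolding dop_def
proof (rule V_filt_sum)
  fix v assume "v \<in> Poly_Mapping.keys g"
  then have "(\<Sum>j\<in>UNIV. Poly_Mapping.lookup v j) = m" using assms(2) by (simp add: homogeneous_poly_def)
  then show "(\<lambda>f. Const (Poly_Mapping.lookup g v) * dpow (Poly_Mapping.lookup v) (P f)) \<in> V_filt (k - int m) p"
    using V_filt_Const[OF V_filt_dpow[OF assms(1), of "Poly_Mapping.lookup v"]] by simp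
qed

lemma theta_eq: "theta p f = (\<Sum>j\<in>UNIV. coordinate p j * pd j f)"
  by (simp add: theta_def coordinate_def)

lemma V_filt_theta:
  assumes "P \<in> V_filt k p"
  shows "(\<lambda>f. theta p (P f)) \<in> V_filt k p"
  unfolding theta_eq using V_filt_coordinate[OF V_filt_pd[OF assms]] by (intro V_filt_sum) simp

lemma V_filt_id: "(\<lambda>f. f) \<in> V_filt 0 p"
  using V_filt_base[of 0 "\<lambda>_. 0" "\<lambda>_. 0" 1 p] by (simp add: dpow_zero)

section \<open>Polynomials in the Euler operator\<close>

lemma theta_add: "theta p (f + g) = theta p f + theta p g"
  by (simp add: theta_def pd_add distrib_left sum.distrib)

lemma theta_Const_mult: "theta p (Const c * f) = Const c * theta p f"
  by (simp add: theta_def pd_Const_mult sum_distrib_left mult.left_commute)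

lemma theta_zero: "theta p 0 = 0"
  by (simp add: theta_def)

lemma theta_sum: "theta p (sum f S) = (\<Sum>x\<in>S. theta p (f x))"
  by (induction S rule: infinite_finite_induct) (simp_all add: theta_add theta_zero)

lemma theta_mult: "theta p (f * g) = theta p f * g + f * theta p g"
  by (simp add: theta_def pd_mult distrib_left sum.distrib sum_distrib_left sum_distrib_right mult_ac)

lemma theta_xpow: "theta p (xpow p u) = of_nat (\<Sum>j\<in>UNIV. u j) * xpow p u"
proof -
  have "coordinate p j * pd j (xpow p u) = of_nat (u j) * xpow p u" for j
  proof (cases "u j")
    case (Suc m)
    then have eq: "xpow p u = coordinate p j * xpow p (u(j := m))"
      using xpow_Suc[of p "u(j := m)" j] by (simp add: fun_upd_idem)
    show ?thesis unfolding pd_xpow Suc diff_Suc_1 by (subst eq) (simp only: mult.left_commute)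
  qed (simp add: pd_xpow)
  then show ?thesis unfolding theta_eq by (simp add: sum_distrib_right)
qed

lemma poly_oper_upto:
  assumes "Polynomial.degree b \<le> n"
  shows "poly_oper b P f = (\<Sum>i\<le>n. Const (Polynomial.coeff b i) * (P ^^ i) f)"
  unfolding poly_oper_def by (rule sum.mono_neutral_left) (use assms in \<open>auto simp: coeff_eq_0\<close>)

lemma poly_oper_add: "poly_oper (b + c) P f = poly_oper b P f + poly_oper c P f"
proof -
  let ?n = "max (Polynomial.degree b) (Polynomial.degree c)"
  have "Polynomial.degree (b + c) \<le> ?n" by (rule degree_add_le_max)
  then show ?thesis
    by (simp add: poly_oper_upto[of _ ?n] Const_add distrib_right sum.distrib)
qed

lemma poly_oper_smult: "poly_oper (Polynomial.smult a b) P f = Const a * poly_oper b P f"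
proof -
  have "Polynomial.degree (Polynomial.smult a b) \<le> Polynomial.degree b" by (rule degree_smult_le)
  then show ?thesis
    by (simp add: poly_oper_upto[of _ "Polynomial.degree b"] Const_mult mult.assoc sum_distrib_left)
qed

lemma poly_oper_pCons:
  "poly_oper (pCons a b) (theta p) f = Const a * f + theta p (poly_oper b (theta p) f)"
proof -
  have "Polynomial.degree (pCons a b) \<le> Suc (Polynomial.degree b)" by (rule degree_pCons_le)
  then have "poly_oper (pCons a b) (theta p) f =
    (\<Sum>i\<le>Suc (Polynomial.degree b). Const (Polynomial.coeff (pCons a b) i) * (theta p ^^ i) f)"
    by (rule poly_oper_upto)
  also have "\<dots> = Const a * f + (\<Sum>i\<le>Polynomial.degree b. Const (Polynomial.coeff b i) * (theta p ^^ Suc i) f)"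
    by (subst sum.atMost_Suc_shift) simp
  finally have "poly_oper (pCons a b) (theta p) f =
    Const a * f + (\<Sum>i\<le>Polynomial.degree b. Const (Polynomial.coeff b i) * (theta p ^^ Suc i) f)" .
  then show ?thesis
    by (simp add: poly_oper_def theta_sum theta_Const_mult)
qed

text \<open>Induction on \<open>k\<close>: applied to (x+p)^u \<partial>^v with |u| = k, the
  derivation \<theta> multiplies the power of x + p by k, which the factor \<theta> - k cancels;
  what remains has one more coordinate and one more derivative.\<close>

lemma falling_factorial_theta:
  "poly_oper (\<Prod>i<k. [:- of_nat i, 1:]) (theta p) \<in>
    oper_span p {(u, v). (\<Sum>j\<in>UNIV. u j) = k \<and> (\<Sum>j\<in>UNIV. v j) = k}"
proof (induction k)
  case 0
  have "poly_oper 1 (theta p) = (\<lambda>f. Const 1 * (xpow p (\<lambda>_. 0) * dpow (\<lambda>_. 0) f))"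
    by (simp add: poly_oper_def dpow_zero fun_eq_iff)
  then show ?case using oper_span_base[of "\<lambda>_. 0" "\<lambda>_. 0" _ 1 p] by simp
next
  case (Suc k)
  let ?G = "\<lambda>k. oper_span p {(u, v). (\<Sum>j\<in>UNIV. u j) = k \<and> (\<Sum>j\<in>UNIV. v j) = k}"
  have step: "(\<lambda>f. theta p (Q f) - Const (of_nat k) * Q f) \<in> ?G (Suc k)" if "Q \<in> ?G k" for Q
    using that
  proof (induction rule: oper_span_induct)
    case zero
    then show ?case by (simp add: theta_zero oper_span_zero)
  next
    case (add P Q)
    have "(\<lambda>f. theta p (P f + Q f) - Const (of_nat k) * (P f + Q f)) =
      (\<lambda>f. (theta p (P f) - Const (of_nat k) * P f) + (theta p (Q f) - Const (of_nat k) * Q f))"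
      by (simp add: theta_add algebra_simps)
    then show ?case using oper_span_add[OF add] by simp
  next
    case (base u v c)
    then have u: "(\<Sum>j\<in>UNIV. u j) = k" and v: "(\<Sum>j\<in>UNIV. v j) = k" by simp_all
    have "theta p (Const c * (xpow p u * dpow v f)) - Const (of_nat k) * (Const c * (xpow p u * dpow v f))
      = (\<Sum>j\<in>UNIV. Const c * (xpow p (u(j := Suc (u j))) * dpow (v(j := Suc (v j))) f))" for f
      unfolding theta_Const_mult unfolding theta_mult theta_xpow u xpow_Suc dpow_Suc
      by (simp add: theta_eq Const_of_nat sum_distrib_left algebra_simps)
    moreover have "(\<lambda>f. \<Sum>j\<in>UNIV. Const c * (xpow p (u(j := Suc (u j))) * dpow (v(j := Suc (v j))) f)) \<in> ?G (Suc k)"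
      by (intro oper_span_sum oper_span_base) (simp add: sum_fun_upd_Suc u v del: fun_upd_apply)
    ultimately show ?case by simp
  qed
  have "(\<Prod>i<Suc k. [:- of_nat i, 1:]) = pCons 0 (\<Prod>i<k. [:- of_nat i, 1:]) + Polynomial.smult (- of_nat k) (\<Prod>i<k. [:- of_nat i, 1 :: complex:])"
    by (simp add: mult.commute[of _ "[:_, _:]"])
  then have "poly_oper (\<Prod>i<Suc k. [:- of_nat i, 1:]) (theta p) =
    (\<lambda>f. theta p (poly_oper (\<Prod>i<k. [:- of_nat i, 1:]) (theta p) f) - Const (of_nat k) * poly_oper (\<Prod>i<k. [:- of_nat i, 1:]) (theta p) f)"
    by (intro ext) (simp only: poly_oper_add poly_oper_smult poly_oper_pCons, simp add: Const_uminus)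
  then show ?case using step[OF Suc] by simp
qed

section \<open>The b-function\<close>

lemma b_condition_add:
  assumes "left_ideal I" "b_condition I p b" "b_condition I p c"
  shows "b_condition I p (b + c)"
proof -
  obtain P Q where b: "P \<in> I" "Q \<in> V_filt 1 p" "poly_oper b (theta p) = (\<lambda>f. P f + Q f)"
    using assms(2) unfolding b_condition_def by blast
  obtain P' Q' where c: "P' \<in> I" "Q' \<in> V_filt 1 p" "poly_oper c (theta p) = (\<lambda>f. P' f + Q' f)"
    using assms(3) unfolding b_condition_def by blast
  have "poly_oper (b + c) (theta p) = (\<lambda>f. (P f + P' f) + (Q f + Q' f))"
    by (rule ext) (simp add: poly_oper_add b(3) c(3))
  moreover have "(\<lambda>f. P f + P' f) \<in> I" using assms(1) b(1) c(1) by (simp add: left_ideal_def)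
  ultimately show ?thesis unfolding b_condition_def using V_filt_add[OF b(2) c(2)]
    by (intro bexI[of _ "\<lambda>f. P f + P' f"] bexI[of _ "\<lambda>f. Q f + Q' f"])
qed

lemma b_condition_smult:
  assumes "left_ideal I" "b_condition I p b"
  shows "b_condition I p (Polynomial.smult a b)"
proof -
  obtain P Q where b: "P \<in> I" "Q \<in> V_filt 1 p" "poly_oper b (theta p) = (\<lambda>f. P f + Q f)"
    using assms(2) unfolding b_condition_def by blast
  have "poly_oper (Polynomial.smult a b) (theta p) = (\<lambda>f. Const a * P f + Const a * Q f)"
    by (rule ext) (simp add: poly_oper_smult b(3) distrib_left)
  then show ?thesis unfolding b_condition_def
    using left_ideal_comp[OF assms(1) D_A.const b(1)] V_filt_Const[OF b(2)]
    by (intro bexI[of _ "\<lambda>f. Const a * P f"] bexI[of _ "\<lambda>f. Const a * Q f"])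
qed

text \<open>Multiplication by s is composition with \<theta> on the left, which preserves the left
  ideal and V^1.\<close>

lemma b_condition_pCons:
  assumes "left_ideal I" "b_condition I p b"
  shows "b_condition I p (pCons 0 b)"
proof -
  obtain P Q where b: "P \<in> I" "Q \<in> V_filt 1 p" "poly_oper b (theta p) = (\<lambda>f. P f + Q f)"
    using assms(2) unfolding b_condition_def by blast
  have "poly_oper (pCons 0 b) (theta p) = (\<lambda>f. theta p (P f) + theta p (Q f))"
    by (rule ext) (simp add: poly_oper_pCons b(3) theta_add)
  then show ?thesis unfolding b_condition_def
    using left_ideal_comp[OF assms(1) D_A_theta b(1)] V_filt_theta[OF b(2)]
    by (intro bexI[of _ "\<lambda>f. theta p (P f)"] bexI[of _ "\<lambda>f. theta p (Q f)"])
qed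

lemma b_condition_mult:
  assumes "left_ideal I" "b_condition I p b"
  shows "b_condition I p (c * b)"
proof (induction c)
  case 0
  then show ?case using b_condition_smult[OF assms, of 0] by simp
next
  case (pCons a c)
  then show ?case
    using b_condition_add[OF assms(1) b_condition_smult[OF assms] b_condition_pCons[OF assms(1)]]
    by (simp add: mult_pCons_left)
qed

text \<open>The polynomials satisfying \<open>b_condition\<close> form an ideal of the principal
  ideal domain C[s], and the b-function is its monic generator.\<close>

lemma b_function:
  assumes I: "left_ideal I" and b0: "b_condition I p b0" "b0 \<noteq> 0"
  shows "\<exists>!b. is_b_function I p b"
    and "b_condition I p c \<Longrightarrow> b_function I p dvd c"
proof -
  define n where "n = (LEAST n. \<exists>b. b_condition I p b \<and> b \<noteq> 0 \<and> Polynomial.degree b = n)"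
  have "\<exists>b. b_condition I p b \<and> b \<noteq> 0 \<and> Polynomial.degree b = n"
    unfolding n_def by (rule LeastI_ex) (use b0 in blast)
  then obtain b1 where b1: "b_condition I p b1" "b1 \<noteq> 0" "Polynomial.degree b1 = n" by blast
  have min: "n \<le> Polynomial.degree c" if "b_condition I p c" "c \<noteq> 0" for c
    unfolding n_def by (rule Least_le) (use that in blast)
  define b where "b = Polynomial.smult (1 / lead_coeff b1) b1"
  have b: "b_condition I p b" "lead_coeff b = 1" "Polynomial.degree b = n"
    using b_condition_smult[OF I b1(1)] b1(2,3) leading_coeff_neq_0[OF b1(2)]
    by (simp_all add: b_def del: leading_coeff_0_iff)
  have dvd: "b' dvd c" if "b_condition I p b'" "b' \<noteq> 0" "Polynomial.degree b' = n" "b_condition I p c" for b' c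
  proof -
    have "c mod b' = c + (- (c div b')) * b'"
      by (simp add: minus_div_mult_eq_mod[symmetric])
    then have "b_condition I p (c mod b')"
      using b_condition_add[OF I that(4) b_condition_mult[OF I that(1)]] by (simp only:)
    then have "c mod b' = 0"
      using min[of "c mod b'"] degree_mod_less[OF that(2), of c] that(3) by linarith
    then show ?thesis by (simp add: dvd_eq_mod_eq_0)
  qed
  have isb: "is_b_function I p b"
    unfolding is_b_function_def
  proof (intro conjI allI impI)
    fix c :: "complex poly" assume c: "lead_coeff c = 1" "b_condition I p c"
    then have "c \<noteq> 0" by auto
    then show "Polynomial.degree b \<le> Polynomial.degree c" using min[OF c(2)] b(3) by simp
  qed (use b in simp_all)
  have uniq: "b' = b" if "is_b_function I p b'" for b'
  proof -
    have b': "lead_coeff b' = 1" "b_condition I p b'" "Polynomial.degree b' \<le> n"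
      using that b unfolding is_b_function_def by auto
    then have "b' \<noteq> 0" "b \<noteq> 0" using b(2) by auto
    then have "Polynomial.degree b' = n" using min[OF b'(2)] b'(3) by simp
    then have "Polynomial.degree (b' - b) \<le> n" "Polynomial.coeff (b' - b) n = 0"
      using degree_diff_le_max[of b' b] b b' by simp_all
    then have "b' - b = 0 \<or> Polynomial.degree (b' - b) < n" by (rule eq_zero_or_degree_less)
    moreover have "b_condition I p (b' - b)"
      using b_condition_add[OF I b'(2) b_condition_smult[OF I b(1), of "- 1"]] by simp
    ultimately show ?thesis using min[of "b' - b"] by (cases "b' = b") simp_all
  qed
  show "\<exists>!b. is_b_function I p b" using isb uniq by blast
  have "b_function I p = b" unfolding b_function_def using isb uniq by (rule the_equality)
  moreover assume "b_condition I p c"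
  moreover have "b \<noteq> 0" using b(2) by auto
  ultimately show "b_function I p dvd c" using dvd[OF b(1) _ b(3)] by simp
qed

section \<open>Homogeneity and the falling factorial\<close>

lemma hcomp_I_A:
  assumes "\<And>u w. A_deg A u = A_deg A w \<Longrightarrow> mdeg u = mdeg w" "h \<in> I_A A"
  shows "hcomp m h \<in> I_A A"
  using assms(2)
proof (induction rule: I_A_induct)
  case (binomial c u w)
  have "Const c * (mon u - mon w) \<in> I_A A" by (rule I_A_mult[OF I_A_binomial[OF binomial]])
  then have "Poly_Mapping.single u c - Poly_Mapping.single w c \<in> I_A A"
    by (simp add: right_diff_distrib Const_mult_single)
  moreover have "hcomp m (Poly_Mapping.single u c - Poly_Mapping.single w c) =
    (if mdeg u = m then Poly_Mapping.single u c - Poly_Mapping.single w c else 0)"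
    using assms(1)[OF binomial] by (simp add: hcomp_diff hcomp_single)
  ultimately show ?case by (simp add: I_A_zero)
qed (simp_all add: I_A_zero hcomp_add I_A_add)

lemma hcomp_mult_AE_form: "hcomp (Suc m) (c * AE_form A p i) = hcomp m c * AE_form A p i"
proof -
  have eq: "c * AE_form A p i = (\<Sum>j\<in>UNIV. Const (of_int (A $ i $ j) * p $ j) * (c * Var j))" for c
    unfolding AE_form_def sum_distrib_left by (simp only: mult.left_commute)
  show ?thesis unfolding eq hcomp_sum hcomp_Const_mult hcomp_mult_Var ..
qed

text \<open>From p_j \<partial>_j = (x_j + p_j) \<partial>_j - x_j \<partial>_j: an operator of V^0
  minus an Euler operator. The constant \<beta> is added and subtracted so that the second part
  becomes a generator of \<open>H_A\<close>.\<close>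

lemma dop_AE_form:
  fixes A :: "int ^ 'n::finite ^ 'd"
  shows "dop (AE_form A p i) f =
    ((\<Sum>j\<in>UNIV. Const (of_int (A $ i $ j)) * (coordinate p j * pd j f)) + Const (- \<beta>) * f) -
    (euler_op A i f - Const \<beta> * f)"
proof -
  have "dop (AE_form A p i) f = (\<Sum>j\<in>UNIV. Const (of_int (A $ i $ j)) * (Const (p $ j) * pd j f))"
    by (simp add: AE_form_def dop_sum dop_mult dop_Const dop_Var Const_mult mult.assoc)
  moreover have "(\<Sum>j\<in>UNIV. Const (of_int (A $ i $ j)) * (coordinate p j * pd j f)) =
    (\<Sum>j\<in>UNIV. Const (of_int (A $ i $ j)) * (Const (p $ j) * pd j f)) + euler_op A i f"
    by (simp add: coordinate_def euler_op_def Const_of_int distrib_right distrib_left sum.distrib mult.assoc add.commute)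
  ultimately show ?thesis by (simp add: Const_uminus)
qed

text \<open>In \<partial>^v with |v| = k each form is replaced by an element of V^0 modulo
  \<open>H_A\<close>. Its cofactor has degree k - 1 and costs only k - 1 orders, while (x+p)^u
  contributes k; the result lies in V^1.\<close>

lemma b_condition_falling_factorial:
  fixes A :: "int ^ 'n::finite ^ 'd::finite"
  assumes hom: "\<And>u w. A_deg A u = A_deg A w \<Longrightarrow> mdeg u = mdeg w"
    and J: "\<And>u. mdeg u = k \<Longrightarrow> mon u \<in> J_A A p" and "k > 0"
  shows "b_condition (H_A A \<beta>) p (\<Prod>i<k. [:- of_nat i, 1:])"
proof -
  define HV where "HV = {P. \<exists>P1\<in>H_A A \<beta>. \<exists>Q\<in>V_filt 1 p. P = (\<lambda>f. P1 f + Q f)}"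
  obtain m where k: "k = Suc m" using \<open>k > 0\<close> by (cases k) simp_all
  note H = left_ideal_H_A[of A \<beta>]
  have span_in_HV: "(\<lambda>f. Const c * (xpow p u * dpow v f)) \<in> HV"
    if u: "(\<Sum>j\<in>UNIV. u j) = k" and v: "(\<Sum>j\<in>UNIV. v j) = k" for u v c
  proof -
    define w where "w = Abs_poly_mapping v"
    have lw: "Poly_Mapping.lookup w = v" by (simp add: w_def)
    then have w: "mdeg w = k" by (simp add: mdeg_def v)
    obtain h b where wh: "mon w = h + (\<Sum>i\<in>UNIV. b i * AE_form A p i)" and h: "h \<in> I_A A"
      using J[OF w] unfolding J_A_def by blast
    \<comment> \<open>The cofactors of the forms become homogeneous of degree \<open>m\<close>,
      which the count of orders requires.\<close>
    have "mon w = hcomp k (mon w)" by (simp add: hcomp_single w)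
    also have "\<dots> = hcomp k h + (\<Sum>i\<in>UNIV. hcomp m (b i) * AE_form A p i)"
      unfolding wh by (simp add: hcomp_add hcomp_sum k hcomp_mult_AE_form)
    finally have eq: "mon w = hcomp k h + (\<Sum>i\<in>UNIV. hcomp m (b i) * AE_form A p i)" .
    define E where "E = (\<lambda>i f. euler_op A i f - Const (\<beta> $ i) * f)"
    define Z where "Z = (\<lambda>i f. (\<Sum>j\<in>UNIV. Const (of_int (A $ i $ j)) * (coordinate p j * pd j f)) + Const (- \<beta> $ i) * f)"
    have AE: "dop (AE_form A p i) f = Z i f - E i f" for i f
      unfolding Z_def E_def using dop_AE_form[of A p i f "\<beta> $ i"] by simp
    have "dpow v f = dop (mon w) f" for f by (simp add: dop_single lw)
    \<comment> \<open>The cofactors stand to the left of \<open>E i\<close>, so these terms stay in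
      the left ideal.\<close>
    then have dp: "dpow v f = dop (hcomp k h) f + (\<Sum>i\<in>UNIV. dop (hcomp m (b i)) (Z i f) - dop (hcomp m (b i)) (E i f))" for f
      unfolding eq dop_plus dop_sum dop_mult AE dop_diff .
    define P1 where "P1 = (\<lambda>f. (Const c * xpow p u) * dop (hcomp k h) f +
      (\<Sum>i\<in>UNIV. (- Const c * xpow p u) * dop (hcomp m (b i)) (E i f)))"
    define Q where "Q = (\<lambda>f. \<Sum>i\<in>UNIV. Const c * (xpow p u * dop (hcomp m (b i)) (Z i f)))"
    have "Const c * (xpow p u * dpow v f) = P1 f + Q f" for f
      unfolding dp P1_def Q_def by (simp add: algebra_simps sum_distrib_left sum_subtractf sum_negf)
    moreover have "P1 \<in> H_A A \<beta>"
    proof -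
      have 1: "(\<lambda>f. (Const c * xpow p u) * dop (hcomp k h) f) \<in> H_A A \<beta>"
        by (rule left_ideal_comp[OF H D_A_poly_mult dop_in_H_A[OF hcomp_I_A[OF hom h]]])
      have "E i \<in> H_A A \<beta>" for i unfolding E_def by (rule euler_in_H_A)
      then have "(\<lambda>f. (- Const c * xpow p u) * dop (hcomp m (b i)) (E i f)) \<in> H_A A \<beta>" for i
        by (intro left_ideal_comp[OF H D_A_poly_mult] left_ideal_comp[OF H D_A_dop])
      then have "(\<lambda>f. \<Sum>i\<in>UNIV. (- Const c * xpow p u) * dop (hcomp m (b i)) (E i f)) \<in> H_A A \<beta>"
        by (rule left_ideal_sum[OF H])
      then show ?thesis unfolding P1_def using 1 H by (simp add: left_ideal_def)
    qed
    moreover have "Q \<in> V_filt 1 p"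
      unfolding Q_def
    proof (rule V_filt_sum)
      fix i
      have "(\<lambda>f. coordinate p j * pd j f) \<in> V_filt 0 p" for j
        using V_filt_coordinate[OF V_filt_pd[OF V_filt_id]] by simp
      then have "Z i \<in> V_filt 0 p"
        unfolding Z_def by (intro V_filt_add V_filt_sum V_filt_Const V_filt_id)
      then have "(\<lambda>f. xpow p u * dop (hcomp m (b i)) (Z i f)) \<in> V_filt (0 - int m + int (\<Sum>j\<in>UNIV. u j)) p"
        by (intro V_filt_xpow V_filt_dop homogeneous_hcomp)
      then show "(\<lambda>f. Const c * (xpow p u * dop (hcomp m (b i)) (Z i f))) \<in> V_filt 1 p"
        unfolding u k by (intro V_filt_Const) simp
    qed
    ultimately show ?thesis unfolding HV_def by (intro CollectI bexI[of _ P1] bexI[of _ Q]) auto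
  qed
  have "poly_oper (\<Prod>i<k. [:- of_nat i, 1:]) (theta p) \<in> HV"
    using falling_factorial_theta
  proof (induction rule: oper_span_induct)
    case zero
    have "(\<lambda>_. 0) \<in> H_A A \<beta>" using H by (simp add: left_ideal_def)
    then show ?case unfolding HV_def using V_filt_zero
      by (intro CollectI bexI[of _ "\<lambda>_. 0"]) simp_all
  next
    case (add P Q)
    then obtain P1 P2 Q1 Q2 where *: "P1 \<in> H_A A \<beta>" "Q1 \<in> V_filt 1 p" "P = (\<lambda>f. P1 f + Q1 f)"
      "P2 \<in> H_A A \<beta>" "Q2 \<in> V_filt 1 p" "Q = (\<lambda>f. P2 f + Q2 f)" unfolding HV_def by blast
    have "(\<lambda>f. P1 f + P2 f) \<in> H_A A \<beta>" using * H by (simp add: left_ideal_def)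
    then show ?case unfolding HV_def using V_filt_add[OF *(2,5)] *(3,6)
      by (intro CollectI bexI[of _ "\<lambda>f. P1 f + P2 f"] bexI[of _ "\<lambda>f. Q1 f + Q2 f"]) (simp_all add: add_ac)
  next
    case (base u v c)
    then show ?case by (simp add: span_in_HV)
  qed
  then show ?thesis unfolding HV_def b_condition_def by blast
qed

text \<open>The constant term vanishes on \<open>J_A\<close>: equal degrees prevent a binomial from
  involving the monomial 1 nontrivially, and the forms have none. Hence 0 is always a nonzero
  degree.\<close>

lemma one_notin_J_A:
  fixes A :: "int ^ 'n::finite ^ 'd::finite"
  assumes hom: "\<And>u w. A_deg A u = A_deg A w \<Longrightarrow> mdeg u = mdeg w"
  shows "1 \<notin> J_A A p"
proof
  define \<phi> :: "('n \<Rightarrow>\<^sub>0 nat) \<Rightarrow> complex" where "\<phi> = (\<lambda>u. if u = 0 then 1 else 0)"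
  have \<phi>: "\<phi> u = \<phi> w" if "A_deg A u = A_deg A w" for u w
    using hom[OF that] mdeg_eq_0_iff[of u] mdeg_eq_0_iff[of w] by (simp add: \<phi>_def)
  have "u + unit_exp j \<noteq> 0" for u :: "'n \<Rightarrow>\<^sub>0 nat" and j
    using mdeg_add[of u "unit_exp j"] mdeg_zero by (metis add_is_0 mdeg_single zero_neq_one)
  then have "lin \<phi> (f * Var j) = 0" for f j
    unfolding Var_def lin_mult_mon by (simp add: \<phi>_def lin_def)
  then have "lin \<phi> (f * AE_form A p i) = 0" for f i
  proof -
    assume *: "\<And>f j. lin \<phi> (f * Var j) = 0"
    have "lin \<phi> (\<Sum>j\<in>S. g j * Var j) = 0" for S g
      by (induction S rule: infinite_finite_induct) (simp_all add: lin_zero lin_add *)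
    moreover have "f * AE_form A p i = (\<Sum>j\<in>UNIV. (f * Const (of_int (A $ i $ j) * p $ j)) * Var j)"
      unfolding AE_form_def sum_distrib_left by (simp only: mult.assoc)
    ultimately show ?thesis by (simp only:)
  qed
  then have "lin \<phi> (\<Sum>i\<in>S. c i * AE_form A p i) = 0" for S c
    by (induction S rule: infinite_finite_induct) (simp_all add: lin_zero lin_add)
  moreover assume "1 \<in> J_A A p"
  then obtain h c where 1: "1 = h + (\<Sum>i\<in>UNIV. c i * AE_form A p i)" and h: "h \<in> I_A A"
    unfolding J_A_def by blast
  ultimately have "lin \<phi> 1 = 0" unfolding 1 lin_add using lin_I_A[OF h \<phi>] by simp
  moreover have "lin \<phi> 1 = 1" using lin_single[of \<phi> 0 1] by (simp add: \<phi>_def)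
  ultimately show False by simp
qed

lemma J_A_degree_mono:
  assumes "\<And>u. mdeg u = N \<Longrightarrow> mon u \<in> J_A A p" "N \<le> mdeg u"
  shows "mon u \<in> J_A A p"
  using assms(2)
proof (induction "mdeg u - N" arbitrary: u)
  case 0
  then show ?case using assms(1) by simp
next
  case (Suc m)
  have "\<exists>j. Poly_Mapping.lookup u j > 0"
  proof (rule ccontr)
    assume "\<not> ?thesis"
    then have "mdeg u = 0" by (simp add: mdeg_def)
    then show False using Suc(2) by simp
  qed
  then obtain j w where w: "u = w + unit_exp j" using exp_split by metis
  then have "mdeg u = mdeg w + 1" by (simp add: mdeg_add)
  then have "mon w \<in> J_A A p" using Suc by simp
  then have "mon (unit_exp j) * mon w \<in> J_A A p" by (rule J_A_mult)
  then show ?case by (simp add: w mult_single add.commute)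
qed

theorem theorem3p11:
  fixes A :: "int ^ 'n::finite ^ 'd::finite" and \<beta> :: "complex ^ 'd"
  assumes "CARD('d) \<le> CARD('n)"
    and "range ((*v) A) = UNIV"
    and "1 \<in> span (rows (\<chi> i j. real_of_int (A $ i $ j)))"
  shows "\<exists>U :: (complex ^ 'n) set. zariski_open U \<and> U \<noteq> {} \<and>
    (\<forall>p\<in>U. (\<exists>!b. is_b_function (H_A A \<beta>) p b) \<and>
      (\<exists>k>0. k - 1 \<in> nonzero_degrees A p \<and> (\<forall>m\<in>nonzero_degrees A p. m \<le> k - 1) \<and>
        b_function (H_A A \<beta>) p dvd (\<Prod>i<k. [:- of_nat i, 1:])) \<and>
      (normal_domain (S_A A) \<longrightarrow>
        b_function (H_A A \<beta>) p dvd (\<Prod>i<CARD('d). [:- of_nat i, 1:])))"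
proof -
  obtain g where graded: "\<And>i. g \<bullet> acol A i = 1" using grading_functional[OF assms(3)] by blast
  note hom = graded_A_deg_eq[OF graded]
  obtain D N where ex: "\<exists>p. peval D p \<noteq> 0" and D: "\<forall>p. peval D p \<noteq> 0 \<longrightarrow>
      (\<forall>u. mdeg u = N \<longrightarrow> mon u \<in> J_A A p) \<and>
      (saturated A \<longrightarrow> (\<forall>u. mdeg u = CARD('d) \<longrightarrow> mon u \<in> J_A A p))"
    using generic_vanishing[OF assms(2) graded] by blast
  show ?thesis
  proof (intro exI[of _ "{p. peval D p \<noteq> 0}"] conjI ballI)
    show "zariski_open {p. peval D p \<noteq> 0}" by (rule zariski_open_peval_neq_0)
    show "{p. peval D p \<noteq> 0} \<noteq> {}" using ex by blast
  next
    fix p assume "p \<in> {p. peval D p \<noteq> 0}"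
    then have N: "\<And>u. mdeg u = N \<Longrightarrow> mon u \<in> J_A A p"
      and sat: "saturated A \<Longrightarrow> (\<And>u. mdeg u = CARD('d) \<Longrightarrow> mon u \<in> J_A A p)"
      using D by blast+
    define S where "S = nonzero_degrees A p"
    have "m < N" if "m \<in> S" for m
    proof (rule ccontr)
      assume "\<not> m < N"
      then show False using that J_A_degree_mono[OF N] unfolding S_def nonzero_degrees_iff by auto
    qed
    \<comment> \<open>The role of \<open>N\<close>: the maximum of the nonzero degrees
      exists.\<close>
    then have fin: "finite S" using finite_subset[of S "{..<N}"] by blast
    have "0 \<in> S"
      unfolding S_def nonzero_degrees_iff using one_notin_J_A[OF hom] by (intro exI[of _ 0]) simp
    then have max: "Max S \<in> S" "\<And>m. m \<in> S \<Longrightarrow> m \<le> Max S"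
      using Max_in[OF fin] Max_ge[OF fin] by blast+
    \<comment> \<open>\<open>k\<close> depends on \<open>p\<close>; being larger than every nonzero
      degree, it is a degree in which all monomials lie in \<open>J_A\<close>.\<close>
    define k where "k = Suc (Max S)"
    have "k \<notin> S" using max(2)[of k] by (auto simp: k_def)
    then have k: "\<And>u. mdeg u = k \<Longrightarrow> mon u \<in> J_A A p"
      unfolding S_def nonzero_degrees_iff by blast
    have bk: "b_condition (H_A A \<beta>) p (\<Prod>i<k. [:- of_nat i, 1:])"
      by (rule b_condition_falling_factorial) (fact hom k | simp add: k_def)+
    have nz: "(\<Prod>i<k. [:- of_nat i, 1 :: complex:]) \<noteq> 0" by simp
    note bf = b_function[OF left_ideal_H_A bk nz]
    show "\<exists>!b. is_b_function (H_A A \<beta>) p b" by (rule bf(1))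
    show "\<exists>k>0. k - 1 \<in> nonzero_degrees A p \<and> (\<forall>m\<in>nonzero_degrees A p. m \<le> k - 1) \<and>
        b_function (H_A A \<beta>) p dvd (\<Prod>i<k. [:- of_nat i, 1:])"
      using max bf(2)[OF bk] unfolding S_def[symmetric] by (intro exI[of _ k]) (simp add: k_def)
    show "normal_domain (S_A A) \<longrightarrow> b_function (H_A A \<beta>) p dvd (\<Prod>i<CARD('d). [:- of_nat i, 1:])"
    proof
      assume "normal_domain (S_A A)"
      then have d: "\<And>u. mdeg u = CARD('d) \<Longrightarrow> mon u \<in> J_A A p"
        using sat normal_imp_saturated[OF assms(2)] by blast
      have "b_condition (H_A A \<beta>) p (\<Prod>i<CARD('d). [:- of_nat i, 1:])"
        by (rule b_condition_falling_factorial) (fact hom d | simp)+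
      then show "b_function (H_A A \<beta>) p dvd (\<Prod>i<CARD('d). [:- of_nat i, 1:])"
        by (rule bf(2))
    qed
  qed
qed

end
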